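(* Assume (A1) and (A2) below and let $T>0$, $(x_0,y_0)\in\mathcal D$. For $\theta>0$ let $\mathcal S_\theta$ be the set of absolutely continuous solutions $\Pi(\cdot)=(x(\cdot),y(\cdot),z(\cdot))$ on $[0,T]$ of $$\dot x=f(x,y,u),\qquad \dot y=g(x,y,u),\qquad \dot z=\max(g(x,y,u),0)\big(1-v\,e^{-\theta\max(y-z,0)}\big)$$ with $\Pi(0)=(x_0,y_0,y_0)$, over measurable controls $u(\cdot):[0,T]\to U$, $v(\cdot):[0,T]\to[0,1]$, and consider the problem $$\mathcal P_3^\theta:\quad \inf_{\Pi(\cdot)\in\mathcal S_\theta} z(T).$$ Let $(\theta_n)_{n\in\mathbb N}$ be any increasing sequence of positive numbers tending to $+\infty$. Then the problem $\mathcal P_3^{\theta_n}$ admits an optimal solution, and for any sequence of optimal solutions $(x_n(\cdot),y_n(\cdot),z_n(\cdot))$ of $\mathcal P_3^{\theta_n}$, the sequence $(x_n(\cdot),y_n(\cdot))$ converges, up to a sub-sequence, uniformly to an optimal solution $(x^\star(\cdot),y^\star(\cdot))$ of the problem $$\mathcal P:\quad \inf_{u(\cdot)\in\mathcal U}\Big(\max_{t\in[0,T]}y(t)\Big),$$ and its derivatives converge weakly to $(\dot x^\star(\cdot),\dot y^\star(\cdot))$ in $L_2$. Moreover, $z_n(T)$ is an increasing sequence that converges to $\max_{t\in[0,T]}y^\star(t)$.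
   Context: Setting. Let $\mathcal D\subset\mathbb R^{n+1}$ be a domain and $U\subset\mathbb R^p$. Let $f:\mathcal D\times U\to\mathbb R^n$ and $g:\mathcal D\times U\to\mathbb R$ define the controlled system $$\dot x=f(x,y,u),\qquad \dot y=g(x,y,u),\qquad (x,y)\in\mathcal D,\ u\in U,$$ and assume that $\mathcal D$ is invariant for this system (solutions starting in $\mathcal D$ stay in $\mathcal D$, whatever the control). (The dimension $n$ here is unrelated to the sequence index $n$.) Assumption (A1): (i) $U$ is compact; (ii) $f$ and $g$ are $C^1$ on $\mathcal D\times U$; (iii) $f,g$ have linear growth: there is $C>0$ with $\|f(x,y,u)\|+|g(x,y,u)|\le C(1+\|x\|+|y|)$ for all $(x,y)\in\mathcal D$, $u\in U$. Assumption (A2): for every $(x,y)\in\mathcal D$ the set $G(x,y):=\bigcup_{u\in U}\{(f(x,y,u),g(x,y,u))\}\subset\mathbb R^{n+1}$ is convex. Notation. $\mathcal U$ is the set of measurable functions $u(\cdot):[0,T]\to U$. Solutions are absolutely continuous functions satisfying the equations for a.e. $t$; under (A1) they exist on $[0,T]$ and are unique for each choice of controls and initial condition. In $\mathcal P$, $(x(\cdot),y(\cdot))$ denotes the solution of the control system associated with $u(\cdot)$ with $(x(0),y(0))=(x_0,y_0)$; an optimal solution of $\mathcal P$ is such a trajectory attaining the infimum. *)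

theory Defs
  imports "HOL-Analysis.Analysis"
begin

text \<open>A derivative within \<open>S\<close> that is continuous on \<open>S\<close>. The set \<open>S\<close> need not be open: below it is
  \<open>D \<times> U\<close> with \<open>U\<close> an arbitrary compact set, and the restriction to \<open>D \<times> U\<close> of any \<open>C\<^sup>1\<close> map on an
  open neighbourhood qualifies. For open \<open>S\<close> this is the usual notion.\<close>

definition C1_on :: "('a::real_normed_vector \<Rightarrow> 'b::real_normed_vector) \<Rightarrow> 'a set \<Rightarrow> bool"
    (infix "C1'_on" 50)
  where "F C1_on S \<longleftrightarrow>
    (\<exists>F'. (\<forall>z\<in>S. (F has_derivative blinfun_apply (F' z)) (at z within S)) \<and> continuous_on S F')"

definition abs_continuous_on_interval :: "(real \<Rightarrow> 'a::real_normed_vector) \<Rightarrow> real \<Rightarrow> real \<Rightarrow> bool"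
  where "abs_continuous_on_interval w a b \<longleftrightarrow>
    (\<forall>\<epsilon>>0. \<exists>\<delta>>0. \<forall>I :: (real \<times> real) set.
       finite I \<and> (\<forall>(s, t)\<in>I. a \<le> s \<and> s \<le> t \<and> t \<le> b) \<and>
       pairwise (\<lambda>(s, t) (s', t'). {s<..<t} \<inter> {s'<..<t'} = {}) I \<and>
       (\<Sum>(s, t)\<in>I. t - s) < \<delta>
       \<longrightarrow> (\<Sum>(s, t)\<in>I. norm (w t - w s)) < \<epsilon>)"

definition measurable_controls :: "real \<Rightarrow> 'c::topological_space set \<Rightarrow> (real \<Rightarrow> 'c) set"
  where "measurable_controls T U =
    {u. u \<in> borel_measurable (lebesgue_on {0..T}) \<and> (\<forall>t\<in>{0..T}. u t \<in> U)}"

text \<open>\<open>F t s\<close> is the velocity at time \<open>t\<close> in state \<open>s\<close>. Values of \<open>w\<close> outside \<open>[0, T]\<close> are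
  irrelevant.\<close>

definition ae_solution ::
    "real \<Rightarrow> (real \<Rightarrow> 'a \<Rightarrow> 'a) \<Rightarrow> (real \<Rightarrow> 'a::real_normed_vector) \<Rightarrow> bool"
  where "ae_solution T F w \<longleftrightarrow> abs_continuous_on_interval w 0 T \<and>
    (AE t in lebesgue_on {0..T}. (w has_vector_derivative F t (w t)) (at t within {0..T}))"

text \<open>Solutions starting in \<open>D\<close> stay in \<open>D\<close>. The maps \<open>f\<close> and \<open>g\<close> are only meaningful on
  \<open>D \<times> U\<close>, so this is phrased without evaluating them elsewhere: a solution that is in \<open>D\<close> on
  \<open>[0, \<tau>)\<close> cannot have left \<open>D\<close> at time \<open>\<tau>\<close>. (As \<open>D\<close> is open, a trajectory starting in \<open>D\<close> and not
  staying there has a first time at which it is outside \<open>D\<close>.)\<close>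

definition invariant_domain ::
    "('x::real_normed_vector \<Rightarrow> real \<Rightarrow> 'c::topological_space \<Rightarrow> 'x) \<Rightarrow> ('x \<Rightarrow> real \<Rightarrow> 'c \<Rightarrow> real)
      \<Rightarrow> ('x \<times> real) set \<Rightarrow> 'c set \<Rightarrow> bool"
  where "invariant_domain f g D U \<longleftrightarrow>
    (\<forall>\<tau>>0. \<forall>u\<in>measurable_controls \<tau> U. \<forall>x y.
       ae_solution \<tau> (\<lambda>t (x, y). (f x y (u t), g x y (u t))) (\<lambda>t. (x t, y t)) \<and>
       (\<forall>t\<in>{0..<\<tau>}. (x t, y t) \<in> D)
       \<longrightarrow> (x \<tau>, y \<tau>) \<in> D)"

definition trajectories ::
    "('x::real_normed_vector \<Rightarrow> real \<Rightarrow> 'c::topological_space \<Rightarrow> 'x) \<Rightarrow> ('x \<Rightarrow> real \<Rightarrow> 'c \<Rightarrow> real)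
      \<Rightarrow> ('x \<times> real) set \<Rightarrow> 'c set \<Rightarrow> real \<Rightarrow> 'x \<Rightarrow> real \<Rightarrow> ((real \<Rightarrow> 'x) \<times> (real \<Rightarrow> real)) set"
  where "trajectories f g D U T x0 y0 =
    {(x, y). \<exists>u\<in>measurable_controls T U.
       ae_solution T (\<lambda>t (x, y). (f x y (u t), g x y (u t))) (\<lambda>t. (x t, y t)) \<and>
       (\<forall>t\<in>{0..T}. (x t, y t) \<in> D) \<and> x 0 = x0 \<and> y 0 = y0}"

definition trajectories3 ::
    "real \<Rightarrow> ('x::real_normed_vector \<Rightarrow> real \<Rightarrow> 'c::topological_space \<Rightarrow> 'x)
      \<Rightarrow> ('x \<Rightarrow> real \<Rightarrow> 'c \<Rightarrow> real) \<Rightarrow> ('x \<times> real) set \<Rightarrow> 'c set \<Rightarrow> real \<Rightarrow> 'x \<Rightarrow> real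
      \<Rightarrow> ((real \<Rightarrow> 'x) \<times> (real \<Rightarrow> real) \<times> (real \<Rightarrow> real)) set"
  where "trajectories3 \<theta> f g D U T x0 y0 =
    {(x, y, z). \<exists>u\<in>measurable_controls T U. \<exists>v\<in>measurable_controls T {0..1::real}.
       ae_solution T
         (\<lambda>t (x, y, z). (f x y (u t), g x y (u t),
            max (g x y (u t)) 0 * (1 - v t * exp (- \<theta> * max (y - z) 0))))
         (\<lambda>t. (x t, y t, z t)) \<and>
       (\<forall>t\<in>{0..T}. (x t, y t) \<in> D) \<and> x 0 = x0 \<and> y 0 = y0 \<and> z 0 = y0}"

text \<open>Along a trajectory \<open>y\<close> is continuous on \<open>[0, T]\<close>, so the supremum is the maximum.\<close>

definition max_on :: "real \<Rightarrow> (real \<Rightarrow> real) \<Rightarrow> real"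
  where "max_on T y = (SUP t\<in>{0..T}. y t)"

definition optimal_P ::
    "('x::real_normed_vector \<Rightarrow> real \<Rightarrow> 'c::topological_space \<Rightarrow> 'x) \<Rightarrow> ('x \<Rightarrow> real \<Rightarrow> 'c \<Rightarrow> real)
      \<Rightarrow> ('x \<times> real) set \<Rightarrow> 'c set \<Rightarrow> real \<Rightarrow> 'x \<Rightarrow> real
      \<Rightarrow> (real \<Rightarrow> 'x) \<times> (real \<Rightarrow> real) \<Rightarrow> bool"
  where "optimal_P f g D U T x0 y0 =
    is_arg_min (\<lambda>(x, y). max_on T y) (\<lambda>w. w \<in> trajectories f g D U T x0 y0)"

definition optimal_P3 ::
    "real \<Rightarrow> ('x::real_normed_vector \<Rightarrow> real \<Rightarrow> 'c::topological_space \<Rightarrow> 'x)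
      \<Rightarrow> ('x \<Rightarrow> real \<Rightarrow> 'c \<Rightarrow> real) \<Rightarrow> ('x \<times> real) set \<Rightarrow> 'c set \<Rightarrow> real \<Rightarrow> 'x \<Rightarrow> real
      \<Rightarrow> (real \<Rightarrow> 'x) \<times> (real \<Rightarrow> real) \<times> (real \<Rightarrow> real) \<Rightarrow> bool"
  where "optimal_P3 \<theta> f g D U T x0 y0 =
    is_arg_min (\<lambda>(x, y, z). z T) (\<lambda>w. w \<in> trajectories3 \<theta> f g D U T x0 y0)"

definition L2_on :: "real \<Rightarrow> (real \<Rightarrow> 'a::euclidean_space) set"
  where "L2_on T = {h. h \<in> borel_measurable (lebesgue_on {0..T}) \<and>
    integrable (lebesgue_on {0..T}) (\<lambda>t. (norm (h t))\<^sup>2)}"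

definition weakly_converges_L2 ::
    "real \<Rightarrow> (nat \<Rightarrow> real \<Rightarrow> 'a::euclidean_space) \<Rightarrow> (real \<Rightarrow> 'a) \<Rightarrow> bool"
  where "weakly_converges_L2 T h l \<longleftrightarrow> (\<forall>n. h n \<in> L2_on T) \<and> l \<in> L2_on T \<and>
    (\<forall>\<phi>\<in>L2_on T. (\<lambda>n. integral\<^sup>L (lebesgue_on {0..T}) (\<lambda>t. h n t \<bullet> \<phi> t))
       \<longlonglongrightarrow> integral\<^sup>L (lebesgue_on {0..T}) (\<lambda>t. l t \<bullet> \<phi> t))"

text \<open>Where \<open>w\<close> is not differentiable (a null set if \<open>w\<close> is absolutely continuous) the value is
  unspecified.\<close>

definition time_deriv :: "real \<Rightarrow> (real \<Rightarrow> 'a::real_normed_vector) \<Rightarrow> real \<Rightarrow> 'a"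
  where "time_deriv T w t = vector_derivative w (at t within {0..T})"

end

theory Submission
  imports Defs "HOL-Complex_Analysis.Great_Picard"
begin

text \<open>Since \<open>g\<close> is the derivative of \<open>y\<close>, the equation for \<open>z\<close> depends on \<open>y\<close> only, and its
  right-hand side is decreasing in \<open>z\<close> and \<open>v\<close> and increasing in \<open>\<theta>\<close>. By comparison, \<open>v = 1\<close> is
  optimal, the optimal values increase with \<open>\<theta>\<close>, and they stay below \<open>max y\<close>, because \<open>z\<close> is at rest
  while it exceeds \<open>y\<close>. Conversely \<open>y - z\<close> can grow beyond \<open>\<epsilon>\<close> at a rate at most \<open>K exp (- \<theta> \<epsilon>)\<close>, so
  \<open>y \<le> z + \<epsilon> + K T exp (- \<theta> \<epsilon>)\<close>, which squeezes the limit of the optimal values.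

  Compactness of the set of trajectories is obtained by Arzela-Ascoli. The limit is a trajectory:
  its velocity lies in the closed convex set \<open>G(x, y)\<close> because that set cannot be left by averages
  of nearby velocities, a measurable selection provides the control, and invariance excludes a first
  exit from \<open>D\<close>. The velocity set of the extended system is not convex, but along a minimising
  sequence the limit of \<open>z\<close> is a supersolution of the equation with \<open>v = 1\<close>, and this is enough.\<close>

text \<open>Solutions are only absolutely continuous and their speeds are bounded only a posteriori,
  so such functions are first shown to be Lipschitz, and Lipschitz functions to be integrals of
  bounded Borel functions. Comparisons then become integral inequalities. A limit velocity is
  identified without weak compactness: where the limit is differentiable, its difference quotients
  are limits of averages of nearby velocities, so a closed half-space containing those velocities
  contains the derivative. Half-spaces also explain why supersolutions survive. With p and q the
  velocities of y and z, and c the factor for \<open>v = 1\<close>, the admissible pairs satisfy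
  max(p, 0) c <= q <= max(p, 0). The upper bound is not convex, but the lower one says q >= 0 and q
  >= c p. The lost equality is restored by solving the equation with \<open>v = 1\<close> afresh
  along the limit of the (x, y), which ends no higher by comparison. Since \<open>f\<close> and
  \<open>g\<close> mean nothing outside \<open>D\<close>, a control can be selected only up to a
  first exit time, and the first trajectory has to come from a cut-off field.\<close>

subsection \<open>Lebesgue differentiation for bounded functions\<close>

text \<open>On a Vitali family of intervals on which the mean of \<open>d\<close> exceeds \<open>q\<close>, inside an open set that
  barely exceeds \<open>{x. d x < p}\<close>, the surplus \<open>q - p\<close> must come from the small excess set.\<close>

lemma negligible_slope_above:
  fixes d F :: "real \<Rightarrow> real"
  assumes d: "d \<in> borel_measurable borel" and bd: "\<And>t. \<bar>d t\<bar> \<le> K"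
    and F: "\<And>a b. a \<le> b \<Longrightarrow> (d has_integral (F b - F a)) {a..b}"
    and pq: "p < q"
  shows "negligible {x. d x < p \<and> (\<forall>\<delta>>0. \<exists>y. y \<noteq> x \<and> \<bar>y - x\<bar> < \<delta> \<and> q < (F y - F x) / (y - x))}"
    (is "negligible ?E")
proof -
  have "negligible (?E \<inter> cbox u v)" for u v
  proof -
    define S where "S = {x. d x < p} \<inter> cbox u v"
    have "{x. d x < p} \<in> sets borel" using d by measurable
    then have S: "S \<in> sets lebesgue" unfolding S_def
      by (intro sets_completionI_sets) auto
    \<comment> \<open>\<open>M\<close> bounds \<open>d - p\<close> from above everywhere, so
      \<open>d\<close> is at most \<open>p + M\<close> on the excess set \<open>V - S\<close>, while
      it is below \<open>p\<close> on \<open>S\<close>.\<close>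
    define M where "M = K + \<bar>p\<bar> + 1"
    have "0 \<le> K" using bd[of 0] by linarith
    then have M: "M > 0" by (simp add: M_def)
    show ?thesis unfolding negligible_outer_le
    proof (intro allI impI)
      fix e :: real assume e: "e > 0"
      \<comment> \<open>The excess may contribute \<open>M * \<epsilon>\<close>, which this choice
        makes equal to \<open>(q - p) * e\<close>.\<close>
      define \<epsilon> where "\<epsilon> = e * (q - p) / M"
      have \<epsilon>: "\<epsilon> > 0" using e pq M by (simp add: \<epsilon>_def)
      obtain V where V: "open V" "S \<subseteq> V" "V - S \<in> lmeasurable"
        "emeasure lebesgue (V - S) < ennreal \<epsilon>"
        using sets_lebesgue_outer_open[OF S \<epsilon>] by blast
      have mV: "measure lebesgue (V - S) \<le> \<epsilon>"
        using V(3,4) \<epsilon> by (simp add: emeasure_eq_measure2 ennreal_less_iff less_imp_le)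
      define I where "I = {(c, r). 0 < r \<and> cball c r \<subseteq> V \<and> q * (2 * r) < F (c + r) - F (c - r)}"
      have cov: "\<exists>i. i \<in> I \<and> x \<in> cball (fst i) (snd i) \<and> snd i < \<delta>"
        if x: "x \<in> ?E \<inter> cbox u v" and \<delta>: "0 < \<delta>" for x \<delta>
      proof -
        have "x \<in> V" using x V(2) by (auto simp: S_def)
        then obtain \<eta> where \<eta>: "\<eta> > 0" "ball x \<eta> \<subseteq> V" using V(1) openE by blast
        obtain y where y: "y \<noteq> x" "\<bar>y - x\<bar> < min \<delta> \<eta>" "q < (F y - F x) / (y - x)"
          using x \<delta> \<eta>(1) by (auto dest: spec[of _ "min \<delta> \<eta>"])
        \<comment> \<open>The chord gives an interval with \<open>x\<close> as an end point. It is
          recast as a ball around its midpoint; in the Vitali theorem the covered point need not be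
          the centre.\<close>
        define c r where "c = (x + y) / 2" and "r = \<bar>y - x\<bar> / 2"
        have r: "r > 0" "r < \<delta>" "x \<in> cball c r"
          using y by (auto simp: c_def r_def dist_real_def field_simps)
        have "cball c r \<subseteq> ball x \<eta>"
        proof
          fix s assume "s \<in> cball c r"
          then have "\<bar>c - s\<bar> \<le> r" by (simp add: dist_real_def)
          then have "\<bar>x - s\<bar> \<le> \<bar>y - x\<bar>" by (auto simp: c_def r_def abs_if field_simps split: if_splits)
          then show "s \<in> ball x \<eta>" using y(2) by (simp add: dist_real_def)
        qed
        moreover have "q * (2 * r) < F (c + r) - F (c - r)"
        proof (cases "y > x")
          case True
          then have *: "c + r = y" "c - r = x" "2 * r = y - x" by (auto simp: c_def r_def field_simps)
          show ?thesis unfolding * using y(3) True by (simp add: pos_less_divide_eq)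
        next
          case False
          then have yx: "y < x" using y(1) by simp
          then have *: "c + r = x" "c - r = y" "2 * r = x - y" by (auto simp: c_def r_def field_simps)
          show ?thesis unfolding * using y(3) yx by (simp add: neg_less_divide_eq algebra_simps)
        qed
        ultimately have "(c, r) \<in> I" using r \<eta>(2) by (auto simp: I_def)
        then show ?thesis using r by force
      qed
      obtain C where C: "countable C" "C \<subseteq> I"
        "pairwise (\<lambda>i j. disjnt (cball (fst i) (snd i)) (cball (fst j) (snd j))) C"
        "negligible (?E \<inter> cbox u v - (\<Union>i\<in>C. cball (fst i) (snd i)))"
      proof (rule Vitali_covering_theorem_cballs[of I snd "?E \<inter> cbox u v" fst])
        show "0 < snd i" if "i \<in> I" for i using that by (auto simp: I_def)
      qed (rule cov)
      let ?B = "\<lambda>i::real\<times>real. cball (fst i) (snd i)"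
      have one: "(q - p) * measure lebesgue (?B i) \<le> M * measure lebesgue (?B i \<inter> (V - S))"
        if "i \<in> I" for i
      proof -
        obtain c r where i: "i = (c, r)" by force
        have r: "r > 0" "cball c r \<subseteq> V" "q * (2 * r) < F (c + r) - F (c - r)"
          using that by (auto simp: I_def i)
        have cb: "cball c r = {c - r..c + r}" by (simp add: cball_eq_atLeastAtMost)
        have mb: "measure lebesgue (cball c r) = 2 * r" using r(1) by (simp add: cb)
        have lm: "(V - S) \<inter> {c - r..c + r} \<in> lmeasurable"
          using V(3) by (intro fmeasurable_Int_fmeasurable) auto
        have "((indicat_real (V - S)) has_integral measure lebesgue ((V - S) \<inter> {c - r..c + r})) {c - r..c + r}"
          using lm by (simp add: has_integral_iff integral_indicator integrable_on_indicator Int_commute)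
        then have i1: "((\<lambda>x. p + M * indicat_real (V - S) x) has_integral
            (p * (2 * r) + M * measure lebesgue ((V - S) \<inter> {c - r..c + r}))) {c - r..c + r}"
          using has_integral_const_real[of p "c - r" "c + r"] r(1)
          by (intro has_integral_add has_integral_mult_right) (auto simp: algebra_simps)
        have i2: "(d has_integral (F (c + r) - F (c - r))) {c - r..c + r}"
          using F r(1) by simp
        have i3: "d x \<le> p + M * indicat_real (V - S) x" if "x \<in> {c - r..c + r}" for x
        proof (cases "x \<in> S")
          case True then show ?thesis by (simp add: S_def)
        next
          case False
          then have "x \<in> V - S" using that r(2) cb by auto
          then show ?thesis using bd[of x] by (simp add: M_def)
        qed
        have "F (c + r) - F (c - r) \<le> p * (2 * r) + M * measure lebesgue ((V - S) \<inter> {c - r..c + r})"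
          by (rule has_integral_le[OF i2 i1 i3])
        then have "(q - p) * (2 * r) \<le> M * measure lebesgue ((V - S) \<inter> {c - r..c + r})"
          using r(3) by (simp add: algebra_simps)
        moreover have "?B i \<inter> (V - S) = (V - S) \<inter> {c - r..c + r}" "measure lebesgue (?B i) = 2 * r"
          using mb by (auto simp: i cb)
        ultimately show ?thesis by simp
      qed
      have fin: "measure lebesgue (\<Union>i\<in>C'. ?B i) \<le> e" if C': "C' \<subseteq> C" "finite C'" for C'
      proof -
        have pw: "pairwise (\<lambda>i j. disjnt (?B i) (?B j)) C'"
          by (rule pairwise_subset[OF C(3) C'(1)])
        have "(q - p) * measure lebesgue (\<Union>i\<in>C'. ?B i) = (\<Sum>i\<in>C'. (q - p) * measure lebesgue (?B i))"
          by (subst measure_UNION'[OF C'(2) _ pw]) (auto simp: sum_distrib_left)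
        also have "\<dots> \<le> (\<Sum>i\<in>C'. M * measure lebesgue (?B i \<inter> (V - S)))"
          using one C' C(2) by (intro sum_mono) blast
        also have "\<dots> = M * measure lebesgue (\<Union>i\<in>C'. ?B i \<inter> (V - S))"
        proof (subst measure_UNION'[OF C'(2)])
          show "\<And>i. i \<in> C' \<Longrightarrow> ?B i \<inter> (V - S) \<in> lmeasurable"
            using V(3) by (subst Int_commute, intro fmeasurable_Int_fmeasurable) auto
          show "pairwise (\<lambda>i j. disjnt (?B i \<inter> (V - S)) (?B j \<inter> (V - S))) C'"
            using pw unfolding pairwise_def disjnt_def by blast
        qed (simp add: sum_distrib_left)
        also have "\<dots> \<le> M * measure lebesgue (V - S)"
        proof (intro mult_left_mono measure_mono_fmeasurable V(3))
          show "(\<Union>i\<in>C'. ?B i \<inter> (V - S)) \<in> sets lebesgue"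
            using V(3) C'(2) by (intro sets.finite_UN sets.Int) (auto simp: fmeasurableD)
        qed (use M in auto)
        also have "\<dots> \<le> M * \<epsilon>" using mV M by simp
        also have "\<dots> = (q - p) * e" using M by (simp add: \<epsilon>_def)
        finally show ?thesis using pq by simp
      qed
      let ?W = "\<Union>i\<in>C. ?B i"
      have W: "?W \<in> lmeasurable" "measure lebesgue ?W \<le> e"
        by (rule fmeasurable_UN_bound[OF C(1) _ fin], simp, assumption+,
            rule measure_UN_bound[OF C(1) _ fin], simp, assumption+)
      let ?T = "?W \<union> (?E \<inter> cbox u v - ?W)"
      have "?W \<union> N' \<in> lmeasurable" "measure lebesgue (?W \<union> N') = measure lebesgue ?W" if "negligible N'" for N'
        using W(1) that emeasure_Un_null_set[of ?W lebesgue N']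
        by (simp_all add: fmeasurable.Un negligible_imp_measurable measure_def fmeasurableD negligible_iff_null_sets)
      from this[OF C(4)] W(2) show "\<exists>T. ?E \<inter> cbox u v \<subseteq> T \<and> T \<in> lmeasurable \<and> measure lebesgue T \<le> e"
        by (intro exI[of _ ?T] conjI) (blast, simp_all)
    qed
  qed
  then show ?thesis unfolding negligible_on_intervals[of ?E] by blast
qed


text \<open>If the difference quotients do not tend to \<open>d x\<close>, they exceed it or fall
  below it by a margin that leaves room for two rationals \<open>p < q\<close>. This gives countably
  many exceptional sets, all null; those for falling below are the exceeding ones for
  \<open>- d\<close> and \<open>- F\<close>.\<close>

lemma AE_has_real_derivative_integral:
  fixes d F :: "real \<Rightarrow> real"
  assumes d: "d \<in> borel_measurable borel" and bd: "\<And>t. \<bar>d t\<bar> \<le> K"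
    and F: "\<And>a b. a \<le> b \<Longrightarrow> (d has_integral (F b - F a)) {a..b}"
  shows "AE t in lebesgue. (F has_real_derivative d t) (at t)"
proof -
  define E where "E d F p q = {x. d x < p \<and> (\<forall>\<delta>>0. \<exists>y. y \<noteq> x \<and> \<bar>y - x\<bar> < \<delta> \<and> q < (F y - F x) / (y - x))}"
    for d F :: "real \<Rightarrow> real" and p q
  have E1: "negligible (E d F p q)" if "p < q" for p q
    unfolding E_def by (rule negligible_slope_above[OF d bd F that])
  have E2: "negligible (E (\<lambda>x. - d x) (\<lambda>x. - F x) p q)" if "p < q" for p q
    unfolding E_def
  proof (rule negligible_slope_above[of "\<lambda>x. - d x" K "\<lambda>x. - F x", OF _ _ _ that])
    show "((\<lambda>x. - d x) has_integral - F b - - F a) {a..b}" if "a \<le> b" for a b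
      using has_integral_neg[OF F[OF that]] by simp
  qed (use d bd in auto)
  define R where "R = {(p, q). p \<in> \<rat> \<and> q \<in> \<rat> \<and> p < (q::real)}"
  have "R \<subseteq> \<rat> \<times> \<rat>" by (auto simp: R_def)
  then have "countable R" by (rule countable_subset) (intro countable_SIGMA countable_rat)
  define N where "N = (\<Union>(p, q)\<in>R. E d F p q \<union> E (\<lambda>x. - d x) (\<lambda>x. - F x) p q)"
  have "negligible N"
    unfolding N_def using \<open>countable R\<close> E1 E2
    by (intro negligible_countable_Union) (auto simp: R_def)
  moreover have "(F has_real_derivative d x) (at x)" if x: "x \<notin> N" for x
  proof -
    have notE: "x \<notin> E d F p q" "x \<notin> E (\<lambda>x. - d x) (\<lambda>x. - F x) p q" if "p \<in> \<rat>" "q \<in> \<rat>" "p < q" for p q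
      using x that by (auto simp: N_def R_def)
    have conv: "\<not> (\<forall>\<delta>>0. \<exists>y. y \<noteq> x \<and> \<bar>y - x\<bar> < \<delta> \<and> q < S y) \<Longrightarrow>
        \<exists>\<delta>>0. \<forall>y. y \<noteq> x \<longrightarrow> \<bar>y - x\<bar> < \<delta> \<longrightarrow> S y \<le> q" for q and S :: "real \<Rightarrow> real"
      by (meson not_less)
    have "((\<lambda>y. (F y - F x) / (y - x)) \<longlongrightarrow> d x) (at x)"
    proof (rule order_tendstoI)
      fix a assume "d x < a"
      then obtain p where p: "p \<in> \<rat>" "d x < p" "p < a" using Rats_dense_in_real by blast
      then obtain q where q: "q \<in> \<rat>" "p < q" "q < a" using Rats_dense_in_real by blast
      obtain \<delta> where \<delta>: "\<delta> > 0" "\<And>y. y \<noteq> x \<Longrightarrow> \<bar>y - x\<bar> < \<delta> \<Longrightarrow> (F y - F x) / (y - x) \<le> q"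
        using notE(1)[OF p(1) q(1,2)] p(2) conv[of q "\<lambda>y. (F y - F x) / (y - x)"]
        unfolding E_def mem_Collect_eq by blast
      have "(F y - F x) / (y - x) < a" if "y \<noteq> x" "\<bar>y - x\<bar> < \<delta>" for y
        using \<delta>(2)[OF that] q(3) by simp
      with \<delta>(1) show "\<forall>\<^sub>F y in at x. (F y - F x) / (y - x) < a"
        unfolding eventually_at dist_real_def by blast
    next
      fix a assume "a < d x"
      then have "- d x < - a" by simp
      then obtain p where p: "p \<in> \<rat>" "- d x < p" "p < - a" using Rats_dense_in_real by blast
      then obtain q where q: "q \<in> \<rat>" "p < q" "q < - a" using Rats_dense_in_real by blast
      obtain \<delta> where \<delta>: "\<delta> > 0" "\<And>y. y \<noteq> x \<Longrightarrow> \<bar>y - x\<bar> < \<delta> \<Longrightarrow> (- F y - - F x) / (y - x) \<le> q"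
        using notE(2)[OF p(1) q(1,2)] p(2) conv[of q "\<lambda>y. (- F y - - F x) / (y - x)"]
        unfolding E_def mem_Collect_eq by blast
      have *: "(- F y - - F x) / (y - x) = - ((F y - F x) / (y - x))" for y
        unfolding minus_divide_left by simp
      have "a < (F y - F x) / (y - x)" if "y \<noteq> x" "\<bar>y - x\<bar> < \<delta>" for y
        using \<delta>(2)[OF that] q(3) unfolding * by simp
      with \<delta>(1) show "\<forall>\<^sub>F y in at x. a < (F y - F x) / (y - x)"
        unfolding eventually_at dist_real_def by blast
    qed
    then show ?thesis by (simp add: has_field_derivative_iff)
  qed
  ultimately show ?thesis
    by (intro AE_I[where N=N]) (auto simp: negligible_iff_null_sets null_sets_def)
qed

subsection \<open>Lipschitz functions are primitives\<close>

text \<open>The density is a Radon-Nikodym derivative of the image of Lebesgue measure under \<open>inv G\<close>; a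
  Lipschitz map preserves null sets, so this image is absolutely continuous.\<close>

lemma strict_mono_lipschitz_density:
  fixes G :: "real \<Rightarrow> real"
  assumes c: "c > 0" and lo: "\<And>a b. a \<le> b \<Longrightarrow> c * (b - a) \<le> G b - G a"
    and hi: "\<And>a b. a \<le> b \<Longrightarrow> G b - G a \<le> L * (b - a)"
  obtains h :: "real \<Rightarrow> ennreal" where "h \<in> borel_measurable borel"
    "\<And>a b. a \<le> b \<Longrightarrow> emeasure (density lborel h) {a<..<b} = ennreal (G b - G a)"
proof -
  have lip: "\<bar>G b - G a\<bar> \<le> \<bar>L\<bar> * \<bar>b - a\<bar>" for a b
  proof (induction a b rule: linorder_wlog)
    case (le a b)
    have "0 \<le> c * (b - a)" using c le by simp
    then show ?case using lo[OF le] hi[OF le] le mult_right_mono[OF abs_ge_self[of L], of "b - a"] by simp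
  qed (simp add: abs_minus_commute)
  have mono: "a < b \<Longrightarrow> G a < G b" for a b
    using lo[of a b] mult_pos_pos[OF c, of "b - a"] by simp
  then have sm: "strict_mono G" by (simp add: strict_mono_def)
  have cont: "continuous_on UNIV G"
  proof -
    have "\<bar>L\<bar>-lipschitz_on UNIV G" by (rule lipschitz_onI) (use lip in \<open>auto simp: dist_real_def abs_minus_commute\<close>)
    then show ?thesis by (rule lipschitz_on_continuous_on)
  qed
  have surj: "\<exists>x. G x = y" for y
  proof -
    \<comment> \<open>The slope of \<open>G\<close> is at least \<open>c\<close>, so within distance
      \<open>r\<close> of \<open>0\<close> it moves far enough to bracket \<open>y\<close>.\<close>
    define r where "r = \<bar>y - G 0\<bar> / c"
    have r: "r \<ge> 0" "c * r = \<bar>y - G 0\<bar>" using c by (auto simp: r_def)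
    have "G (-r) \<le> y" using lo[of "-r" 0] r by simp
    moreover have "y \<le> G r" using lo[of 0 r] r by simp
    ultimately have "\<exists>x\<ge>-r. x \<le> r \<and> G x = y"
      using r(1) cont by (intro IVT') (auto intro: continuous_on_subset)
    then show ?thesis by blast
  qed
  then have surj': "surj G" by (metis surjI)
  have inj: "inj G" using sm by (simp add: strict_mono_imp_inj_on)
  define H where "H = inv G"
  have HG: "H (G x) = x" and GH: "G (H y) = y" for x y
    using inj surj' by (auto simp: H_def surj_f_inv_f)
  have "(1/c)-lipschitz_on UNIV H"
  proof (rule lipschitz_onI)
    fix u v :: real
    have "\<bar>H b - H a\<bar> \<le> 1 / c * \<bar>b - a\<bar>" for a b
    proof (induction a b rule: linorder_wlog)
      case (le a b)
      have "H a \<le> H b" using le GH mono by (metis not_le)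
      then show ?case using lo[of "H a" "H b"] c le by (simp add: GH field_simps)
    qed (simp add: abs_minus_commute)
    then show "dist (H u) (H v) \<le> 1 / c * dist u v" by (simp add: dist_real_def)
  qed (use c in auto)
  then have Hm: "H \<in> borel_measurable borel"
    by (intro borel_measurable_continuous_onI lipschitz_on_continuous_on)
  define \<mu> where "\<mu> = distr lborel borel H"
  \<comment> \<open>\<open>G\<close> is a bijection with inverse \<open>H\<close>, so the mass that
    \<open>\<mu>\<close> gives to a Borel set is the Lebesgue measure of its image under
    \<open>G\<close>; for an interval this is the increment of \<open>G\<close>.\<close>
  have vim: "H -` A = G ` A" for A :: "real set"
    using HG GH by (auto simp: image_iff) (metis GH)
  have em: "emeasure \<mu> A = emeasure lborel (G ` A)" if "A \<in> sets borel" for A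
    using that Hm by (simp add: \<mu>_def emeasure_distr vim)
  have "absolutely_continuous lborel \<mu>"
    unfolding absolutely_continuous_def
  proof
    fix A :: "real set" assume "A \<in> null_sets lborel"
    then have A: "A \<in> sets borel" and "negligible A"
      by (auto simp: negligible_iff_null_sets null_sets_completionI)
    then have "negligible (G ` A)"
    proof (intro negligible_locally_Lipschitz_image)
      show "\<exists>T B. open T \<and> x \<in> T \<and> (\<forall>y\<in>A \<inter> T. norm (G y - G x) \<le> B * norm (y - x))" for x
        using lip by (intro exI[of _ UNIV] exI[of _ "\<bar>L\<bar>"]) auto
    qed auto
    moreover have "G ` A \<in> sets borel" using measurable_sets[OF Hm A] by (simp add: vim)
    ultimately have "emeasure lborel (G ` A) = 0"
      by (simp add: negligible_iff_emeasure0)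
    then show "A \<in> null_sets \<mu>" using A em by (auto simp: null_sets_def \<mu>_def)
  qed
  then obtain h where h: "h \<in> borel_measurable lborel" "density lborel h = \<mu>"
    using sigma_finite_measure.Radon_Nikodym[OF sigma_finite_lborel, of \<mu>] by (auto simp: \<mu>_def)
  show thesis
  proof
    show "h \<in> borel_measurable borel" using h(1) by simp
    fix a b :: real assume "a \<le> b"
    have "G ` {a<..<b} = {G a<..<G b}"
    proof (intro equalityI subsetI)
      fix y assume "y \<in> {G a<..<G b}"
      then have "a < H y \<and> H y < b" using sm GH by (metis greaterThanLessThan_iff strict_mono_less)
      then show "y \<in> G ` {a<..<b}" by (metis GH greaterThanLessThan_iff image_eqI)
    qed (use mono in auto)
    moreover have "G a \<le> G b" using sm \<open>a \<le> b\<close> by (simp add: strict_mono_less_eq)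
    ultimately show "emeasure (density lborel h) {a<..<b} = ennreal (G b - G a)"
      by (simp add: h(2) em)
  qed
qed

text \<open>With \<open>G \<sigma> t = ((K + 1) t + \<sigma> f t) / L\<close> one has \<open>G 1 t + G (-1) t = t\<close>, so the two densities
  sum to \<open>1\<close>; in particular they are bounded.\<close>

lemma lipschitz_imp_integral:
  fixes f :: "real \<Rightarrow> real"
  assumes "K-lipschitz_on UNIV f"
  obtains d B where "d \<in> borel_measurable borel" "\<And>t. \<bar>d t\<bar> \<le> B"
    "\<And>a b. a \<le> b \<Longrightarrow> (d has_integral (f b - f a)) {a..b}"
proof -
  have K: "K \<ge> 0" using assms lipschitz_on_nonneg by blast
  have lip: "\<bar>f b - f a\<bar> \<le> K * (b - a)" if "a \<le> b" for a b
    using lipschitz_onD[OF assms, of b a] that by (simp add: dist_real_def)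
  \<comment> \<open>The numerators in \<open>G\<close> have slopes between \<open>1\<close> and
    \<open>2 * K + 1\<close>. Dividing by \<open>L\<close> keeps the slopes positive and at most
    \<open>1\<close>, and normalises the sum over both signs to the identity.\<close>
  define L where "L = 2 * (K + 1)"
  have L: "L > 0" using K by (simp add: L_def)
  define G where "G \<sigma> t = ((K + 1) * t + \<sigma> * f t) / L" for \<sigma> t :: real
  have G_bounds: "1 / L * (b - a) \<le> G \<sigma> b - G \<sigma> a \<and> G \<sigma> b - G \<sigma> a \<le> 1 * (b - a)"
    if "\<bar>\<sigma>\<bar> = 1" "a \<le> b" for \<sigma> a b
  proof -
    have "\<sigma> = 1 \<or> \<sigma> = -1" using that(1) by (auto simp: abs_if split: if_splits)
    then have s: "\<bar>\<sigma> * f b - \<sigma> * f a\<bar> \<le> K * (b - a)" using lip[OF that(2)] by auto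
    have e: "G \<sigma> b - G \<sigma> a = ((K + 1) * (b - a) + (\<sigma> * f b - \<sigma> * f a)) / L"
      by (simp add: G_def diff_divide_distrib[symmetric] algebra_simps)
    have "(b - a) \<le> (K + 1) * (b - a) + (\<sigma> * f b - \<sigma> * f a)"
      using s by (simp add: algebra_simps abs_le_iff)
    moreover have "(K + 1) * (b - a) + (\<sigma> * f b - \<sigma> * f a) \<le> L * (b - a)"
      using s that(2) by (simp add: L_def algebra_simps abs_le_iff)
    ultimately show ?thesis unfolding e using L
      by (simp add: divide_le_eq divide_right_mono mult.commute)
  qed
  have Gmono: "0 \<le> G \<sigma> b - G \<sigma> a" if "\<bar>\<sigma>\<bar> = 1" "a \<le> b" for \<sigma> a b
  proof -
    have "0 \<le> 1 / L * (b - a)" using L that(2) by simp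
    then show ?thesis using G_bounds[OF that] by linarith
  qed
  have "\<exists>h. h \<in> borel_measurable borel \<and> (\<forall>a b. a \<le> b \<longrightarrow>
      emeasure (density lborel h) {a<..<b} = ennreal (G \<sigma> b - G \<sigma> a))" if \<sigma>: "\<bar>\<sigma>\<bar> = 1" for \<sigma>
  proof -
    obtain h where "h \<in> borel_measurable borel"
      "\<And>a b. a \<le> b \<Longrightarrow> emeasure (density lborel h) {a<..<b} = ennreal (G \<sigma> b - G \<sigma> a)"
      using strict_mono_lipschitz_density[of "1/L" "G \<sigma>" 1] L G_bounds[OF \<sigma>]
      by (metis zero_less_divide_1_iff)
    then show ?thesis by blast
  qed
  from this[of 1] this[of "-1"] obtain h1 h2 where h1[measurable]: "h1 \<in> borel_measurable borel"
    and h2[measurable]: "h2 \<in> borel_measurable borel"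
    and e1: "\<And>a b. a \<le> b \<Longrightarrow> emeasure (density lborel h1) {a<..<b} = ennreal (G 1 b - G 1 a)"
    and e2: "\<And>a b. a \<le> b \<Longrightarrow> emeasure (density lborel h2) {a<..<b} = ennreal (G (-1) b - G (-1) a)"
    by auto
  have G12: "G 1 t + G (-1) t = t" for t
  proof -
    have "G 1 t + G (-1) t = L * t / L"
      by (simp add: G_def add_divide_distrib[symmetric] L_def algebra_simps)
    then show ?thesis using L by simp
  qed
  have "lborel = density lborel (\<lambda>x. h1 x + h2 x)"
  proof (rule lborel_eqI)
    fix l u :: real assume "\<And>b. b \<in> Basis \<Longrightarrow> l \<bullet> b \<le> u \<bullet> b"
    then have lu: "l \<le> u" by simp
    have "emeasure (density lborel (\<lambda>x. h1 x + h2 x)) {l<..<u}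
       = emeasure (density lborel h1) {l<..<u} + emeasure (density lborel h2) {l<..<u}"
      by (simp add: emeasure_density distrib_right nn_integral_add)
    also have "\<dots> = ennreal (u - l)"
      using e1[OF lu] e2[OF lu] Gmono[of 1 l u] Gmono[of "-1" l u] lu G12[of u] G12[of l]
      by (simp add: ennreal_plus[symmetric] algebra_simps del: ennreal_plus)
    finally show "emeasure (density lborel (\<lambda>x. h1 x + h2 x)) (box l u) = ennreal (\<Prod>b\<in>Basis. (u - l) \<bullet> b)"
      by (simp add: box_real)
  qed simp
  then have "density lborel (\<lambda>x. h1 x + h2 x) = density lborel (\<lambda>_. 1)"
    by (simp add: density_1)
  then have "AE x in lborel. h1 x + h2 x = 1"
    by (subst (asm) sigma_finite_measure.density_unique_iff[OF sigma_finite_lborel]) auto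
  then have h1le: "AE x in lborel. h1 x \<le> 1"
    by eventually_elim (metis le_iff_add)
  \<comment> \<open>\<open>h1\<close> is at most \<open>1\<close> only almost everywhere. Truncation
    changes it on a null set and gives a real density that is bounded everywhere.\<close>
  define k where "k x = enn2real (min (h1 x) 1)" for x
  have k: "k \<in> borel_measurable borel" "0 \<le> k x" "k x \<le> 1" for x
    unfolding k_def by (auto simp: enn2real_leI min_def)
  have AEk: "AE x in lborel. ennreal (k x) = h1 x"
    using h1le by eventually_elim (auto simp: k_def min_def ennreal_enn2real_if top_unique)
  show thesis
  proof
    \<comment> \<open>This density undoes the affine change from \<open>f\<close> to
      \<open>G 1\<close>: \<open>f t = L * G 1 t - (K + 1) * t\<close>.\<close>
    show "(\<lambda>t. L * k t - (K + 1)) \<in> borel_measurable borel" using k by measurable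
    show "\<bar>L * k t - (K + 1)\<bar> \<le> L + K + 1" for t
    proof -
      have "L * k t \<le> L" using k(3) L by (simp add: mult_left_le)
      moreover have "0 \<le> L * k t" using k(2) L by simp
      ultimately show ?thesis using K L unfolding abs_le_iff by linarith
    qed
    fix a b :: real assume ab: "a \<le> b"
    have "(\<integral>\<^sup>+x. ennreal (k x * indicator {a..b} x) \<partial>lborel) = (\<integral>\<^sup>+x. h1 x * indicator {a<..<b} x \<partial>lborel)"
    proof (rule nn_integral_cong_AE)
      show "AE x in lborel. ennreal (k x * indicator {a..b} x) = h1 x * indicator {a<..<b} x"
        using AEk AE_lborel_singleton[of a] AE_lborel_singleton[of b]
        by eventually_elim (auto simp: indicator_def)
    qed
    also have "\<dots> = ennreal (G 1 b - G 1 a)"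
      using e1[OF ab] by (simp add: emeasure_density)
    finally have "((\<lambda>x. k x * indicator {a..b} x) has_integral (G 1 b - G 1 a)) UNIV"
      using k Gmono[of 1 a b] ab by (intro nn_integral_has_integral) auto
    then have "(k has_integral (G 1 b - G 1 a)) {a..b}"
      by (subst has_integral_restrict_UNIV[symmetric]) (simp add: indicator_def if_distrib mult.commute of_bool_def cong: if_cong)
    then have "((\<lambda>t. L * k t - (K + 1)) has_integral (L * (G 1 b - G 1 a) - (K + 1) * (b - a))) {a..b}"
      using has_integral_const_real[of "K + 1" a b] ab
      by (intro has_integral_diff has_integral_mult_right) (auto simp: algebra_simps)
    moreover have "L * (G 1 b - G 1 a) - (K + 1) * (b - a) = f b - f a"
      using L by (simp add: G_def field_simps)
    ultimately show "((\<lambda>t. L * k t - (K + 1)) has_integral (f b - f a)) {a..b}" by simp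
  qed
qed

subsection \<open>Absolutely continuous functions with bounded derivative\<close>

text \<open>Trajectories have bounded velocities, so they are Lipschitz and it suffices to work with
  primitives of bounded Borel functions.\<close>

definition primitive :: "real \<Rightarrow> (real \<Rightarrow> 'a::euclidean_space) \<Rightarrow> (real \<Rightarrow> 'a) \<Rightarrow> bool"
  where "primitive T w d \<longleftrightarrow> d \<in> borel_measurable borel \<and> bounded (range d) \<and>
    (\<forall>a b. 0 \<le> a \<longrightarrow> a \<le> b \<longrightarrow> b \<le> T \<longrightarrow> (d has_integral (w b - w a)) {a..b})"

lemma AE_lebesgue_on_interval_iff:
  "(AE t in lebesgue_on {a..b::real}. P t) \<longleftrightarrow> negligible {t \<in> {a..b}. \<not> P t}"
  by (subst AE_restrict_space_iff)
    (auto simp: AE_iff_null_sets negligible_iff_null_sets eventually_ae_filter null_sets_completion_subset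
      intro: null_sets_subset)

lemma AE_in_interval: "AE t in lebesgue_on {a..b::real}. t \<in> {a..b}"
  by (rule AE_I2) simp

lemma primitive_has_derivative:
  fixes w :: "real \<Rightarrow> 'a::euclidean_space"
  assumes T: "0 \<le> T" and w: "primitive T w d"
  shows "AE t in lebesgue_on {0..T}. (w has_vector_derivative d t) (at t within {0..T})"
proof -
  from w have dm: "d \<in> borel_measurable borel" and "bounded (range d)"
    and int: "\<And>a b. 0 \<le> a \<Longrightarrow> a \<le> b \<Longrightarrow> b \<le> T \<Longrightarrow> (d has_integral (w b - w a)) {a..b}"
    by (auto simp: primitive_def)
  then obtain B where B: "\<And>t. norm (d t) \<le> B" by (auto simp: bounded_iff)
  then have B0: "0 \<le> B" using norm_ge_zero order_trans by blast
  \<comment> \<open>Clamping the time extends \<open>w\<close> by constants to the whole line, where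
    its density is \<open>d\<close> cut off to \<open>0\<close> outside
    \<open>[0, T]\<close>.\<close>
  define cl where "cl t = max 0 (min t T)" for t :: real
  have comp: "AE t in lebesgue. ((\<lambda>s. w (cl s) \<bullet> i) has_real_derivative (indicator {0..T} t *\<^sub>R d t) \<bullet> i) (at t)"
    if i: "i \<in> Basis" for i
  proof (rule AE_has_real_derivative_integral[of _ B])
    show "(\<lambda>t. (indicator {0..T} t *\<^sub>R d t) \<bullet> i) \<in> borel_measurable borel" using dm by measurable
    show "\<bar>(indicator {0..T} t *\<^sub>R d t) \<bullet> i\<bar> \<le> B" for t
      using B[of t] Basis_le_norm[OF i, of "d t"] B0 by (auto simp: indicator_def)
    fix a b :: real assume ab: "a \<le> b"
    have "((\<lambda>t. if t \<in> {max a 0..min b T} then d t else 0) has_integral w (cl b) - w (cl a)) {a..b}"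
    proof (cases "max a 0 \<le> min b T")
      case True
      then have "cl a = max a 0" "cl b = min b T" using ab by (auto simp: cl_def)
      then show ?thesis using int[of "max a 0" "min b T"] True
        by (subst has_integral_restrict) auto
    next
      case False
      then have e: "{max a 0..min b T} = {}" "cl a = cl b" using ab T by (auto simp: cl_def)
      show ?thesis unfolding e by simp
    qed
    from has_integral_linear[OF this bounded_linear_inner_left[of i]]
    have "((\<lambda>t. (if t \<in> {max a 0..min b T} then d t else 0) \<bullet> i) has_integral (w (cl b) \<bullet> i - w (cl a) \<bullet> i)) {a..b}"
      by (simp add: inner_diff_left o_def)
    then show "((\<lambda>t. (indicator {0..T} t *\<^sub>R d t) \<bullet> i) has_integral (w (cl b) \<bullet> i - w (cl a) \<bullet> i)) {a..b}"
      by (rule has_integral_eq[rotated]) (auto simp: indicator_def)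
  qed
  have "AE t in lebesgue. \<forall>i\<in>Basis. ((\<lambda>s. w (cl s) \<bullet> i) has_real_derivative (indicator {0..T} t *\<^sub>R d t) \<bullet> i) (at t)"
    using comp by (intro AE_finite_allI) auto
  then have "AE t in lebesgue. t \<in> {0..T} \<longrightarrow> (w has_vector_derivative d t) (at t within {0..T})"
  proof eventually_elim
    case (elim t)
    show ?case
    proof
      assume t: "t \<in> {0..T}"
      have "((\<lambda>s. w (cl s)) has_derivative (\<lambda>x. x *\<^sub>R d t)) (at t within {0..T})"
        unfolding has_derivative_componentwise_within[of "\<lambda>s. w (cl s)"]
      proof
        fix i :: 'a assume "i \<in> Basis"
        then have "((\<lambda>s. w (cl s) \<bullet> i) has_real_derivative d t \<bullet> i) (at t within {0..T})"
          using elim t has_field_derivative_at_within by fastforce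
        then show "((\<lambda>s. w (cl s) \<bullet> i) has_derivative (\<lambda>x. x *\<^sub>R d t \<bullet> i)) (at t within {0..T})"
          by (simp add: has_field_derivative_def mult_commute_abs)
      qed
      then have "((\<lambda>s. w (cl s)) has_vector_derivative d t) (at t within {0..T})"
        by (simp add: has_vector_derivative_def)
      then show "(w has_vector_derivative d t) (at t within {0..T})"
        by (rule has_vector_derivative_transform[rotated 2]) (use t in \<open>auto simp: cl_def\<close>)
    qed
  qed
  then show ?thesis by (subst AE_restrict_space_iff) auto
qed

lemma lipschitz_imp_primitive:
  fixes w :: "real \<Rightarrow> 'a::euclidean_space"
  assumes T: "0 \<le> T" and w: "K-lipschitz_on {0..T} w"
  obtains d where "primitive T w d"
proof -
  define cl where "cl t = max 0 (min t T)" for t :: real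
  have K: "0 \<le> K" using w by (rule lipschitz_on_nonneg)
  have "\<exists>d. d \<in> borel_measurable borel \<and> bounded (range d) \<and>
     (\<forall>a b. a \<le> b \<longrightarrow> (d has_integral (w (cl b) \<bullet> i - w (cl a) \<bullet> i)) {a..b})" if i: "i \<in> Basis" for i
  proof -
    have "K-lipschitz_on UNIV (\<lambda>t. w (cl t) \<bullet> i)"
    proof (rule lipschitz_onI)
      fix s t :: real
      have "dist (w (cl s) \<bullet> i) (w (cl t) \<bullet> i) \<le> dist (w (cl s)) (w (cl t))"
        using Basis_le_norm[OF i, of "w (cl s) - w (cl t)"] by (simp add: dist_norm inner_diff_left)
      also have "\<dots> \<le> K * dist (cl s) (cl t)"
        using w by (rule lipschitz_onD) (use T in \<open>auto simp: cl_def\<close>)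
      also have "\<dots> \<le> K * dist s t"
        by (rule mult_left_mono[OF _ K]) (auto simp: cl_def dist_real_def)
      finally show "dist (w (cl s) \<bullet> i) (w (cl t) \<bullet> i) \<le> K * dist s t" .
    qed (rule K)
    from lipschitz_imp_integral[OF this] obtain d B where "d \<in> borel_measurable borel" "\<And>t. \<bar>d t\<bar> \<le> B"
      "\<And>a b. a \<le> b \<Longrightarrow> (d has_integral (w (cl b) \<bullet> i - w (cl a) \<bullet> i)) {a..b}" by metis
    then show ?thesis by (intro exI[of _ d]) (auto simp: bounded_iff)
  qed
  then obtain d where d: "\<And>i. i \<in> Basis \<Longrightarrow> d i \<in> borel_measurable borel"
    "\<And>i. i \<in> Basis \<Longrightarrow> bounded (range (d i))"
    "\<And>i a b. i \<in> Basis \<Longrightarrow> a \<le> b \<Longrightarrow> (d i has_integral (w (cl b) \<bullet> i - w (cl a) \<bullet> i)) {a..b}"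
    by metis
  have "primitive T w (\<lambda>t. \<Sum>i\<in>Basis. d i t *\<^sub>R i)"
    unfolding primitive_def
  proof (intro conjI allI impI)
    show "(\<lambda>t. \<Sum>i\<in>Basis. d i t *\<^sub>R i) \<in> borel_measurable borel" using d(1) by measurable
    obtain B where B: "\<And>i t. i \<in> Basis \<Longrightarrow> \<bar>d i t\<bar> \<le> B i"
      using d(2) unfolding bounded_iff by (metis rangeI real_norm_def)
    show "bounded (range (\<lambda>t. \<Sum>i\<in>Basis. d i t *\<^sub>R i))" unfolding bounded_iff
    proof (intro exI ballI)
      fix x assume "x \<in> range (\<lambda>t. \<Sum>i\<in>Basis. d i t *\<^sub>R i)"
      then obtain t where x: "x = (\<Sum>i\<in>Basis. d i t *\<^sub>R i)" by auto
      have "norm x \<le> (\<Sum>i\<in>Basis. norm (d i t *\<^sub>R (i::'a)))" unfolding x by (rule norm_sum)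
      also have "\<dots> \<le> (\<Sum>i\<in>Basis. B i)" using B by (intro sum_mono) simp
      finally show "norm x \<le> (\<Sum>i\<in>Basis. B i)" .
    qed
    fix a b :: real assume ab: "0 \<le> a" "a \<le> b" "b \<le> T"
    then have cl: "cl a = a" "cl b = b" by (auto simp: cl_def)
    have "((\<lambda>t. \<Sum>i\<in>Basis. d i t *\<^sub>R i) has_integral (\<Sum>i\<in>Basis. (w b \<bullet> i - w a \<bullet> i) *\<^sub>R i)) {a..b}"
      using d(3)[OF _ ab(2)] unfolding cl by (intro has_integral_sum has_integral_scaleR_left) auto
    moreover have "(\<Sum>i\<in>Basis. (w b \<bullet> i - w a \<bullet> i) *\<^sub>R i) = w b - w a"
      by (simp add: inner_diff_left[symmetric] euclidean_representation)
    ultimately show "((\<lambda>t. \<Sum>i\<in>Basis. d i t *\<^sub>R i) has_integral w b - w a) {a..b}" by simp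
  qed
  then show thesis by (rule that)
qed

lemma lipschitz_on_interval_ordered:
  fixes w :: "real \<Rightarrow> 'a::real_normed_vector"
  assumes K: "0 \<le> K" and le: "\<And>s t. a \<le> s \<Longrightarrow> s \<le> t \<Longrightarrow> t \<le> b \<Longrightarrow> norm (w t - w s) \<le> K * (t - s)"
  shows "K-lipschitz_on {a..b} w"
proof (rule lipschitz_onI)
  fix s t assume st: "s \<in> {a..b}" "t \<in> {a..b}"
  show "dist (w s) (w t) \<le> K * dist s t"
  proof (cases "s \<le> t")
    case True then show ?thesis using le[of s t] st by (simp add: dist_norm norm_minus_commute)
  next
    case False then show ?thesis using le[of t s] st by (simp add: dist_norm)
  qed
qed (rule K)

lemma primitive_imp_lipschitz:
  fixes w :: "real \<Rightarrow> 'a::euclidean_space"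
  assumes K: "0 \<le> K" and w: "primitive T w d" and b: "AE t in lebesgue_on {0..T}. norm (d t) \<le> K"
  shows "K-lipschitz_on {0..T} w"
proof -
  have le: "norm (w b - w a) \<le> K * (b - a)" if ab: "0 \<le> a" "a \<le> b" "b \<le> T" for a b
  proof -
    define d' where "d' t = (if norm (d t) \<le> K then d t else 0)" for t
    have "(d has_integral (w b - w a)) {a..b}" using w ab by (auto simp: primitive_def)
    then have "(d' has_integral (w b - w a)) {a..b}"
    proof (rule has_integral_spike[rotated 2])
      show "negligible {t \<in> {0..T}. \<not> norm (d t) \<le> K}" using b by (simp add: AE_lebesgue_on_interval_iff)
    qed (use ab in \<open>auto simp: d'_def\<close>)
    then have "norm (w b - w a) \<le> K * measure lborel (cbox a b)"
      using K by (intro has_integral_bound[of K d']) (auto simp: d'_def)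
    then show ?thesis using ab by simp
  qed
  show ?thesis by (rule lipschitz_on_interval_ordered[OF K le])
qed

lemma lipschitz_imp_abs_continuous:
  assumes w: "K-lipschitz_on {a..b} w"
  shows "abs_continuous_on_interval w a b"
  unfolding abs_continuous_on_interval_def
proof (intro allI impI)
  fix \<epsilon> :: real assume \<epsilon>: "\<epsilon> > 0"
  have K: "0 \<le> K" using w by (rule lipschitz_on_nonneg)
  show "\<exists>\<delta>>0. \<forall>I. finite I \<and> (\<forall>(s, t)\<in>I. a \<le> s \<and> s \<le> t \<and> t \<le> b) \<and>
       pairwise (\<lambda>(s, t) (s', t'). {s<..<t} \<inter> {s'<..<t'} = {}) I \<and> (\<Sum>(s, t)\<in>I. t - s) < \<delta>
       \<longrightarrow> (\<Sum>(s, t)\<in>I. norm (w t - w s)) < \<epsilon>"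
  \<comment> \<open>\<open>K\<close> may be \<open>0\<close>, hence the denominator
    \<open>K + 1\<close>.\<close>
  proof (intro exI[of _ "\<epsilon> / (K + 1)"] conjI allI impI)
    show "0 < \<epsilon> / (K + 1)" using \<epsilon> K by simp
    fix I :: "(real \<times> real) set"
    assume I: "finite I \<and> (\<forall>(s, t)\<in>I. a \<le> s \<and> s \<le> t \<and> t \<le> b) \<and>
       pairwise (\<lambda>(s, t) (s', t'). {s<..<t} \<inter> {s'<..<t'} = {}) I \<and> (\<Sum>(s, t)\<in>I. t - s) < \<epsilon> / (K + 1)"
    have "(\<Sum>(s, t)\<in>I. norm (w t - w s)) \<le> (\<Sum>(s, t)\<in>I. (K + 1) * (t - s))"
    proof (rule sum_mono, clarify)
      fix s t assume "(s, t) \<in> I"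
      then have st: "a \<le> s" "s \<le> t" "t \<le> b" using I by auto
      then have "norm (w t - w s) \<le> K * (t - s)"
        using lipschitz_onD[OF w, of t s] by (simp add: dist_norm)
      also have "\<dots> \<le> (K + 1) * (t - s)" using st by (intro mult_right_mono) auto
      finally show "norm (w t - w s) \<le> (K + 1) * (t - s)" .
    qed
    also have "\<dots> = (K + 1) * (\<Sum>(s, t)\<in>I. t - s)" by (simp add: sum_distrib_left case_prod_unfold)
    also have "\<dots> < (K + 1) * (\<epsilon> / (K + 1))" using I K by (intro mult_strict_left_mono) auto
    also have "\<dots> = \<epsilon>" using K by simp
    finally show "(\<Sum>(s, t)\<in>I. norm (w t - w s)) < \<epsilon>" .
  qed
qed

text \<open>A gauge argument. At tags outside the null set \<open>N\<close> the slopes are at most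
  \<open>K + \<epsilon>\<close>. At tags in \<open>N\<close> the gauge confines the intervals to an
  open set of measure below \<open>\<delta>\<close>, so absolute continuity keeps their total
  increment below \<open>\<epsilon>\<close>. A tagged division that is fine for this gauge bounds
  \<open>w b - w a\<close>.\<close>

lemma abs_continuous_imp_lipschitz:
  fixes w :: "real \<Rightarrow> 'a::real_normed_vector"
  assumes ac: "abs_continuous_on_interval w 0 T" and K: "0 \<le> K"
    and der: "AE t in lebesgue_on {0..T}. \<exists>e. (w has_vector_derivative e) (at t within {0..T}) \<and> norm e \<le> K"
  shows "K-lipschitz_on {0..T} w"
proof -
  define N where "N = {t \<in> {0..T}. \<not> (\<exists>e. (w has_vector_derivative e) (at t within {0..T}) \<and> norm e \<le> K)}"
  have N: "negligible N" using der by (simp add: AE_lebesgue_on_interval_iff N_def)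
  have main: "norm (w b - w a) \<le> (K + \<epsilon>) * (b - a) + \<epsilon>"
    if ab: "0 \<le> a" "a \<le> b" "b \<le> T" and \<epsilon>: "\<epsilon> > 0" for a b \<epsilon>
  proof -
    from ac \<epsilon> obtain \<delta> where \<delta>: "\<delta> > 0" and ac': "\<And>I :: (real \<times> real) set. finite I \<Longrightarrow>
        (\<forall>(s, t)\<in>I. 0 \<le> s \<and> s \<le> t \<and> t \<le> T) \<Longrightarrow>
        pairwise (\<lambda>(s, t) (s', t'). {s<..<t} \<inter> {s'<..<t'} = {}) I \<Longrightarrow>
        (\<Sum>(s, t)\<in>I. t - s) < \<delta> \<Longrightarrow> (\<Sum>(s, t)\<in>I. norm (w t - w s)) < \<epsilon>"
      unfolding abs_continuous_on_interval_def by meson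
    have "N \<in> sets lebesgue" using N by (simp add: negligible_imp_sets)
    then obtain V where V: "open V" "N \<subseteq> V" "V - N \<in> lmeasurable" "emeasure lebesgue (V - N) < ennreal \<delta>"
      using sets_lebesgue_outer_open \<delta> by blast
    have VN: "V = (V - N) \<union> N" using V(2) by blast
    have Vm: "V \<in> lmeasurable"
      using fmeasurable.Un[OF V(3) negligible_imp_measurable[OF N]] unfolding VN[symmetric] .
    have "emeasure lebesgue V = emeasure lebesgue (V - N)"
      using emeasure_Un_null_set[of "V - N" lebesgue N] V(3) N unfolding VN[symmetric]
      by (auto simp: fmeasurableD negligible_iff_null_sets)
    then have Vd: "measure lebesgue V < \<delta>"
      using V(3,4) Vm \<delta> by (simp add: emeasure_eq_measure2 ennreal_less_iff)
    have "\<exists>r>0. (x \<in> N \<longrightarrow> ball x r \<subseteq> V) \<and> (x \<notin> N \<longrightarrow> x \<in> {0..T} \<longrightarrow>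
        (\<forall>y\<in>{0..T}. \<bar>y - x\<bar> < r \<longrightarrow> norm (w y - w x) \<le> (K + \<epsilon>) * \<bar>y - x\<bar>))" for x
    proof (cases "x \<in> N \<or> x \<notin> {0..T}")
      case True
      show ?thesis
      proof (cases "x \<in> N")
        case xN: True
        then obtain r where "r > 0" "ball x r \<subseteq> V" using V(1,2) by (meson openE subsetD)
        then show ?thesis using xN by blast
      next
        case False
        then show ?thesis using True zero_less_one by blast
      qed
    next
      case False
      then obtain e where e: "(w has_vector_derivative e) (at x within {0..T})" "norm e \<le> K"
        by (auto simp: N_def)
      then obtain r where r: "r > 0" "\<And>y. y \<in> {0..T} \<Longrightarrow> norm (y - x) < r \<Longrightarrow>
          norm (w y - w x - (y - x) *\<^sub>R e) \<le> \<epsilon> * norm (y - x)"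
        unfolding has_vector_derivative_def has_derivative_within_alt using \<epsilon> by meson
      have "norm (w y - w x) \<le> (K + \<epsilon>) * \<bar>y - x\<bar>" if "y \<in> {0..T}" "\<bar>y - x\<bar> < r" for y
      proof -
        have "norm (w y - w x) \<le> norm (w y - w x - (y - x) *\<^sub>R e) + norm ((y - x) *\<^sub>R e)"
          by (metis add.commute diff_add_cancel norm_triangle_ineq)
        also have "norm (w y - w x - (y - x) *\<^sub>R e) \<le> \<epsilon> * \<bar>y - x\<bar>" using r(2)[OF that(1)] that(2) by simp
        also have "norm ((y - x) *\<^sub>R e) \<le> \<bar>y - x\<bar> * K" using e(2) by (simp add: mult_left_mono)
        finally show ?thesis by (simp add: algebra_simps)
      qed
      then show ?thesis using False r(1) by blast
    qed
    then obtain r where r: "\<And>x. r x > 0" "\<And>x. x \<in> N \<Longrightarrow> ball x (r x) \<subseteq> V"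
      "\<And>x y. x \<notin> N \<Longrightarrow> x \<in> {0..T} \<Longrightarrow> y \<in> {0..T} \<Longrightarrow> \<bar>y - x\<bar> < r x \<Longrightarrow> norm (w y - w x) \<le> (K + \<epsilon>) * \<bar>y - x\<bar>"
      by metis
    have "gauge (\<lambda>x. ball x (r x))" using r(1) by (simp add: gauge_def)
    then obtain p where p: "p tagged_division_of {a..b}" "(\<lambda>x. ball x (r x)) fine p"
      using fine_division_exists_real by blast
    have fin: "finite p" using p(1) by blast
    have k: "\<exists>c e. k = {c..e} \<and> c \<le> x \<and> x \<le> e \<and> a \<le> c \<and> e \<le> b \<and> k \<subseteq> ball x (r x)" if q: "(x, k) \<in> p" for x k
    proof -
      have "x \<in> k" "k \<subseteq> {a..b}" using tagged_division_ofD(2,3)[OF p(1) that] by auto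
      moreover obtain c e where "k = {c..e}" using tagged_division_ofD(4)[OF p(1) q] unfolding box_real by blast
      moreover have "k \<subseteq> ball x (r x)" using p(2) that by (auto simp: fine_def)
      ultimately show ?thesis by auto
    qed
    let ?g = "\<lambda>(x, k). norm (w (Sup k) - w (Inf k))"
    \<comment> \<open>Degenerate intervals contribute nothing and are left out. The others have
      nonempty, pairwise disjoint interiors, so their end points determine them and \<open>h\<close>
      below is injective.\<close>
    define p2 where "p2 = {(x, k) \<in> p. x \<in> N \<and> Inf k < Sup k}"
    have p2p: "p2 \<subseteq> p" by (auto simp: p2_def)
    have fin2: "finite p2" using fin p2p finite_subset by blast
    have part: "p2 tagged_partial_division_of {a..b}"
      using tagged_partial_division_subset[OF _ p2p] p(1) by (auto simp: tagged_division_of_def)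
    have disj: "k = k' \<and> x = x'"
      if q: "(x, k) \<in> p2" "(x', k') \<in> p2" and ne: "{Inf k<..<Sup k} \<inter> {Inf k'<..<Sup k'} \<noteq> {}" for x k x' k'
    proof -
      obtain c e where ce: "k = {c..e}" "c \<le> x" "x \<le> e" using k q(1) p2p by blast
      obtain c' e' where ce': "k' = {c'..e'}" "c' \<le> x'" "x' \<le> e'" using k q(2) p2p by blast
      have "interior k = {Inf k<..<Sup k}" "interior k' = {Inf k'<..<Sup k'}"
        using ce ce' by auto
      then have "(x, k) = (x', k')"
        using tagged_division_ofD(5)[OF p(1), of x k x' k'] q p2p ne by blast
      then show ?thesis by blast
    qed
    have "w b - w a = (\<Sum>(x, k)\<in>p. w (Sup k) - w (Inf k))"
      using additive_tagged_division_1[OF ab(2) p(1), of w] by simp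
    then have "norm (w b - w a) \<le> (\<Sum>q\<in>p. ?g q)"
      by (simp add: case_prod_unfold norm_sum)
    also have "\<dots> = (\<Sum>q\<in>p - p2. ?g q) + (\<Sum>q\<in>p2. ?g q)"
      using sum.subset_diff[OF p2p fin] .
    also have "(\<Sum>q\<in>p - p2. ?g q) \<le> (\<Sum>(x, k)\<in>p - p2. (K + \<epsilon>) * measure lborel k)"
    proof (rule sum_mono, clarify)
      fix x k' assume q: "(x, k') \<in> p" "(x, k') \<notin> p2"
      from k[OF q(1)] obtain c e where ce: "k' = {c..e}" "c \<le> x" "x \<le> e" "a \<le> c" "e \<le> b" "k' \<subseteq> ball x (r x)" by auto
      then have IS: "Inf k' = c" "Sup k' = e" by auto
      show "norm (w (Sup k') - w (Inf k')) \<le> (K + \<epsilon>) * measure lborel k'"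
      proof (cases "x \<in> N")
        case True
        then have "c = e" using q IS ce by (auto simp: p2_def)
        then show ?thesis using ce IS by simp
      next
        case False
        have "e \<in> k'" "c \<in> k'" using ce(1-3) by auto
        then have "e \<in> ball x (r x)" "c \<in> ball x (r x)" using ce(6) by blast+
        then have d: "\<bar>e - x\<bar> < r x" "\<bar>c - x\<bar> < r x" by (auto simp: dist_real_def)
        have m: "x \<in> {0..T}" "e \<in> {0..T}" "c \<in> {0..T}" using ce(2-5) ab by auto
        have "norm (w e - w x) \<le> (K + \<epsilon>) * \<bar>e - x\<bar>" "norm (w c - w x) \<le> (K + \<epsilon>) * \<bar>c - x\<bar>"
          by (rule r(3)[OF False m(1,2) d(1)], rule r(3)[OF False m(1,3) d(2)])
        moreover have "norm (w e - w c) \<le> norm (w e - w x) + norm (w c - w x)"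
          using norm_triangle_ineq4[of "w e - w x" "w c - w x"] by simp
        ultimately have "norm (w e - w c) \<le> (K + \<epsilon>) * (e - c)"
          using ce by (simp add: algebra_simps)
        then show ?thesis using ce IS by simp
      qed
    qed
    also have "\<dots> \<le> (\<Sum>(x, k)\<in>p. (K + \<epsilon>) * measure lborel k)"
      using fin K \<epsilon> by (intro sum_mono2) auto
    also have "\<dots> = (K + \<epsilon>) * (b - a)"
      using additive_content_tagged_division[of p a b] p(1) ab
      by (simp add: sum_distrib_left[symmetric] case_prod_unfold)
    also have "(\<Sum>q\<in>p2. ?g q) < \<epsilon>"
    proof -
      define h where "h = (\<lambda>q::real \<times> real set. (Inf (snd q), Sup (snd q)))"
      have inj: "inj_on h p2"
      proof (rule inj_onI)
        fix q q' assume q: "q \<in> p2" "q' \<in> p2" "h q = h q'"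
        obtain x k x' k' where e: "q = (x, k)" "q' = (x', k')" by (metis surj_pair)
        have "{Inf k<..<Sup k} \<inter> {Inf k'<..<Sup k'} \<noteq> {}" using q by (auto simp: e h_def p2_def)
        then show "q = q'" using disj q(1,2) unfolding e by blast
      qed
      have "(\<Sum>q\<in>p2. ?g q) = (\<Sum>(s, t)\<in>h ` p2. norm (w t - w s))"
        by (subst sum.reindex[OF inj]) (simp add: h_def case_prod_unfold)
      also have "\<dots> < \<epsilon>"
      proof (rule ac')
        show "finite (h ` p2)" using fin2 by simp
        show "\<forall>(s, t)\<in>h ` p2. 0 \<le> s \<and> s \<le> t \<and> t \<le> T"
        proof clarify
          fix s t x k' assume q: "(s, t) = h (x, k')" "(x, k') \<in> p2"
          then obtain c e where "k' = {c..e}" "c \<le> x" "x \<le> e" "a \<le> c" "e \<le> b" using k p2p by blast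
          then show "0 \<le> s \<and> s \<le> t \<and> t \<le> T" using q ab by (auto simp: h_def)
        qed
        show "pairwise (\<lambda>(s, t) (s', t'). {s<..<t} \<inter> {s'<..<t'} = {}) (h ` p2)"
        proof (rule pairwiseI)
          fix i j assume "i \<in> h ` p2" "j \<in> h ` p2" and ne: "i \<noteq> j"
          then obtain x k x' k' where "(x, k) \<in> p2" "(x', k') \<in> p2" "i = h (x, k)" "j = h (x', k')" by auto
          then show "(\<lambda>(s, t) (s', t'). {s<..<t} \<inter> {s'<..<t'} = {}) i j"
            using disj[of x k x' k'] ne by (auto simp: h_def)
        qed
        have dv: "(snd ` p2) division_of \<Union>(snd ` p2)"
          by (rule partial_division_of_tagged_division[OF part])
        have inj2: "inj_on snd p2" using inj by (auto simp: inj_on_def h_def)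
        have "(\<Sum>(s, t)\<in>h ` p2. t - s) = (\<Sum>q\<in>p2. measure lebesgue (snd q))"
          unfolding sum.reindex[OF inj]
        proof (rule sum.cong)
          fix q assume q: "q \<in> p2"
          obtain x k' where e: "q = (x, k')" by fastforce
          obtain c e where "k' = {c..e}" "c \<le> x" "x \<le> e" using q p2p k[of x k'] unfolding e by blast
          then show "((\<lambda>(s, t). t - s) \<circ> h) q = measure lebesgue (snd q)" by (simp add: e h_def)
        qed simp
        also have "\<dots> = (\<Sum>k\<in>snd ` p2. measure lebesgue k)" by (simp add: sum.reindex[OF inj2])
        also have "\<dots> = measure lebesgue (\<Union>(snd ` p2))" using content_division[OF dv] by simp
        also have "\<dots> \<le> measure lebesgue V"
        proof (rule measure_mono_fmeasurable[OF _ _ Vm])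
          show "\<Union>(snd ` p2) \<subseteq> V"
          proof clarify
            fix s x k' assume q: "(x, k') \<in> p2" and s: "s \<in> snd (x, k')"
            have "k' \<subseteq> ball x (r x)" using k[OF subsetD[OF p2p q]] by blast
            moreover have "x \<in> N" using q by (simp add: p2_def)
            ultimately show "s \<in> V" using r(2)[of x] s by auto
          qed
          show "\<Union>(snd ` p2) \<in> sets lebesgue" using lmeasurable_division[OF dv] by (rule fmeasurableD)
        qed
        finally show "(\<Sum>(s, t)\<in>h ` p2. t - s) < \<delta>" using Vd by simp
      qed
      finally show ?thesis .
    qed
    finally show ?thesis by simp
  qed
  have le: "norm (w b - w a) \<le> K * (b - a)" if ab: "0 \<le> a" "a \<le> b" "b \<le> T" for a b
  proof (rule field_le_epsilon)
    fix e :: real assume e: "e > 0"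
    define \<epsilon> where "\<epsilon> = e / (b - a + 1)"
    have "norm (w b - w a) \<le> (K + \<epsilon>) * (b - a) + \<epsilon>" using e ab by (intro main) (auto simp: \<epsilon>_def)
    also have "\<dots> = K * (b - a) + \<epsilon> * (b - a + 1)" by (simp add: algebra_simps)
    also have "\<epsilon> * (b - a + 1) = e" using ab by (simp add: \<epsilon>_def)
    finally show "norm (w b - w a) \<le> K * (b - a) + e" .
  qed
  show ?thesis by (rule lipschitz_on_interval_ordered[OF K le])
qed

subsection \<open>Measurable selection of zeros\<close>

text \<open>By compactness and nonnegativity a zero exists as soon as the infimum over
  \<open>K\<close> is \<open>0\<close>, and by continuity that infimum can be taken over a countable
  dense subset. Only countably many measurable conditions remain.\<close>

lemma measurable_exists_zero:
  fixes \<Phi> :: "'s \<Rightarrow> 'c::euclidean_space \<Rightarrow> real"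
  assumes K: "compact K"
    and cont: "\<And>t. t \<in> space M \<Longrightarrow> continuous_on K (\<Phi> t)"
    and meas: "\<And>u. u \<in> K \<Longrightarrow> (\<lambda>t. \<Phi> t u) \<in> borel_measurable M"
    and nonneg: "\<And>t u. t \<in> space M \<Longrightarrow> u \<in> K \<Longrightarrow> 0 \<le> \<Phi> t u"
  shows "{t \<in> space M. \<exists>u\<in>K. \<Phi> t u = 0} \<in> sets M"
proof -
  obtain Q where Q: "countable Q" "Q \<subseteq> K" "K \<subseteq> closure Q" using separable by blast
  have eq: "(\<exists>u\<in>K. \<Phi> t u = 0) \<longleftrightarrow> (\<forall>n. \<exists>q\<in>Q. \<Phi> t q < 1 / real (Suc n))" if t: "t \<in> space M" for t
  proof
    assume "\<exists>u\<in>K. \<Phi> t u = 0"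
    then obtain u where u: "u \<in> K" "\<Phi> t u = 0" by blast
    show "\<forall>n. \<exists>q\<in>Q. \<Phi> t q < 1 / real (Suc n)"
    proof
      fix n
      have pos: "0 < 1 / real (Suc n)" by simp
      from cont[OF t] u(1) have "\<forall>e>0. \<exists>d>0. \<forall>v\<in>K. dist v u < d \<longrightarrow> dist (\<Phi> t v) (\<Phi> t u) < e"
        unfolding continuous_on_iff by (rule bspec)
      with pos obtain \<delta> where \<delta>: "\<delta> > 0" "\<And>v. v \<in> K \<Longrightarrow> dist v u < \<delta> \<Longrightarrow> dist (\<Phi> t v) (\<Phi> t u) < 1 / real (Suc n)"
        by metis
      obtain q where q: "q \<in> Q" "dist q u < \<delta>"
        using Q(3) u(1) \<delta>(1) by (meson closure_approachable subsetD)
      then have "dist (\<Phi> t q) (\<Phi> t u) < 1 / real (Suc n)" using \<delta>(2) Q(2) by blast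
      then have "\<Phi> t q < 1 / real (Suc n)" unfolding u(2) dist_real_def by linarith
      then show "\<exists>q\<in>Q. \<Phi> t q < 1 / real (Suc n)" using q(1) by (rule bexI)
    qed
  next
    assume q: "\<forall>n. \<exists>q\<in>Q. \<Phi> t q < 1 / real (Suc n)"
    then have "K \<noteq> {}" using Q(2) by blast
    then obtain u where u: "u \<in> K" "\<And>v. v \<in> K \<Longrightarrow> \<Phi> t u \<le> \<Phi> t v"
      using continuous_attains_inf[OF K _ cont[OF t]] by blast
    have "\<Phi> t u \<le> 0"
    proof (rule ccontr)
      assume "\<not> \<Phi> t u \<le> 0"
      then obtain n where n: "1 / real (Suc n) < \<Phi> t u" using nat_approx_posE[of "\<Phi> t u"] by auto
      obtain q' where "q' \<in> Q" "\<Phi> t q' < 1 / real (Suc n)" using q by blast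
      then show False using u(2)[of q'] Q(2) n by auto
    qed
    then show "\<exists>u\<in>K. \<Phi> t u = 0" using u(1) nonneg[OF t u(1)] by (auto intro!: bexI[of _ u])
  qed
  have "{t \<in> space M. \<exists>u\<in>K. \<Phi> t u = 0} = {t \<in> space M. \<forall>n. \<exists>q\<in>Q. \<Phi> t q < 1 / real (Suc n)}"
    by (intro Collect_cong conj_cong refl eq)
  also have "\<dots> \<in> sets M"
  proof (rule sets.sets_Collect_countable_All)
    fix n :: nat
    have "{t \<in> space M. \<exists>q\<in>Q. \<Phi> t q < 1 / real (Suc n)} = (\<Union>q\<in>Q. {t \<in> space M. \<Phi> t q < 1 / real (Suc n)})"
      by auto
    also have "\<dots> \<in> sets M"
    proof (rule sets.countable_UN'[OF Q(1)], rule image_subsetI)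
      fix q assume "q \<in> Q"
      then have [measurable]: "(\<lambda>t. \<Phi> t q) \<in> borel_measurable M" using meas Q(2) by blast
      show "{t \<in> space M. \<Phi> t q < 1 / real (Suc n)} \<in> sets M" by measurable
    qed
    finally show "{t \<in> space M. \<exists>q\<in>Q. \<Phi> t q < 1 / real (Suc n)} \<in> sets M" .
  qed
  finally show ?thesis .
qed

text \<open>Over a compact \<open>U\<close> this encodes a measurable family of nonempty compact
  sets, as zero sets of nonnegative functions. Nonnegativity lets a further constraint be imposed by
  adding a penalty.\<close>

definition caratheodory_zeros :: "'s measure \<Rightarrow> 'c::topological_space set \<Rightarrow> ('s \<Rightarrow> 'c \<Rightarrow> real) \<Rightarrow> bool"
  where "caratheodory_zeros M U \<Phi> \<longleftrightarrow> (\<forall>t\<in>space M. continuous_on U (\<Phi> t)) \<and>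
    (\<forall>u\<in>U. (\<lambda>t. \<Phi> t u) \<in> borel_measurable M) \<and> (\<forall>t\<in>space M. \<forall>u\<in>U. 0 \<le> \<Phi> t u) \<and>
    (\<forall>t\<in>space M. \<exists>u\<in>U. \<Phi> t u = 0)"

text \<open>Minimising one coordinate after the other over the zero set pins down a single zero, and keeps
  every choice measurable.\<close>

lemma measurable_lexicographic_zero:
  fixes \<Phi> :: "'s \<Rightarrow> 'c::euclidean_space \<Rightarrow> real"
  assumes U: "compact U" and B: "finite B" "B \<subseteq> Basis" and \<Phi>: "caratheodory_zeros M U \<Phi>"
  shows "\<exists>\<Psi> m. caratheodory_zeros M U \<Psi> \<and> (\<forall>b\<in>B. m b \<in> borel_measurable M) \<and>
    (\<forall>t\<in>space M. \<forall>u\<in>U. \<Psi> t u = 0 \<longrightarrow> \<Phi> t u = 0 \<and> (\<forall>b\<in>B. u \<bullet> b = m b t))"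
  using B
proof (induction B rule: finite_induct)
  case empty
  show ?case by (intro exI[of _ \<Phi>]) (use \<Phi> in auto)
next
  case (insert b B)
  then obtain \<Psi> m where \<Psi>: "caratheodory_zeros M U \<Psi>" and m: "\<And>b. b \<in> B \<Longrightarrow> m b \<in> borel_measurable M"
    and imp: "\<And>t u. t \<in> space M \<Longrightarrow> u \<in> U \<Longrightarrow> \<Psi> t u = 0 \<Longrightarrow> \<Phi> t u = 0 \<and> (\<forall>b\<in>B. u \<bullet> b = m b t)"
    by blast
  from \<Psi> have cont': "\<And>t. t \<in> space M \<Longrightarrow> continuous_on U (\<Psi> t)"
    and meas': "\<And>u. u \<in> U \<Longrightarrow> (\<lambda>t. \<Psi> t u) \<in> borel_measurable M"
    and nonneg': "\<And>t u. t \<in> space M \<Longrightarrow> u \<in> U \<Longrightarrow> 0 \<le> \<Psi> t u"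
    and zero': "\<And>t. t \<in> space M \<Longrightarrow> \<exists>u\<in>U. \<Psi> t u = 0"
    unfolding caratheodory_zeros_def by blast+
  have "\<exists>u. u \<in> U \<and> \<Psi> t u = 0 \<and> (\<forall>v\<in>U. \<Psi> t v = 0 \<longrightarrow> u \<bullet> b \<le> v \<bullet> b)" if t: "t \<in> space M" for t
  proof -
    let ?Z = "{u \<in> U. \<Psi> t u = 0}"
    have "closedin (top_of_set U) ?Z"
      using cont'[OF t] by (rule continuous_closedin_preimage_constant)
    then have Z: "compact ?Z" using U closedin_compact by blast
    have ne: "?Z \<noteq> {}" using zero'[OF t] by blast
    have "continuous_on ?Z (\<lambda>u. u \<bullet> b)" by (intro continuous_intros)
    from continuous_attains_inf[OF Z ne this] show ?thesis by auto
  qed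
  then obtain \<mu> where \<mu>: "\<And>t. t \<in> space M \<Longrightarrow> \<mu> t \<in> U" "\<And>t. t \<in> space M \<Longrightarrow> \<Psi> t (\<mu> t) = 0"
    "\<And>t v. t \<in> space M \<Longrightarrow> v \<in> U \<Longrightarrow> \<Psi> t v = 0 \<Longrightarrow> \<mu> t \<bullet> b \<le> v \<bullet> b"
    by metis
  \<comment> \<open>The minimal \<open>b\<close>-coordinate is at most \<open>c\<close> exactly if
    some zero lies in the compact set of controls with \<open>b\<close>-coordinate at most
    \<open>c\<close>. The minimiser \<open>\<mu>\<close> itself is not claimed to be
    measurable.\<close>
  have mm: "(\<lambda>t. \<mu> t \<bullet> b) \<in> borel_measurable M"
    unfolding borel_measurable_iff_le
  proof
    fix c :: real
    let ?K = "U \<inter> {u. u \<bullet> b \<le> c}"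
    have "closed {u. u \<bullet> b \<le> c}" by (intro closed_Collect_le continuous_intros)
    then have "compact ?K" using U by (rule compact_Int_closed[rotated])
    then have "{t \<in> space M. \<exists>u\<in>?K. \<Psi> t u = 0} \<in> sets M"
      by (rule measurable_exists_zero) (use cont' meas' nonneg' in \<open>auto intro: continuous_on_subset\<close>)
    moreover have "{t \<in> space M. \<mu> t \<bullet> b \<le> c} = {t \<in> space M. \<exists>u\<in>?K. \<Psi> t u = 0}"
    proof (intro Collect_cong conj_cong refl iffI)
      fix t assume t: "t \<in> space M"
      show "\<exists>u\<in>?K. \<Psi> t u = 0" if "\<mu> t \<bullet> b \<le> c" using \<mu>(1,2)[OF t] that by blast
      assume "\<exists>u\<in>?K. \<Psi> t u = 0"
      then obtain u where "u \<in> U" "u \<bullet> b \<le> c" "\<Psi> t u = 0" by blast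
      then show "\<mu> t \<bullet> b \<le> c" using \<mu>(3)[OF t, of u] by simp
    qed
    ultimately show "{t \<in> space M. \<mu> t \<bullet> b \<le> c} \<in> sets M" by simp
  qed
  \<comment> \<open>Both terms are nonnegative, so the penalised function vanishes exactly at the
    zeros whose \<open>b\<close>-coordinate is minimal.\<close>
  define \<Psi>' where "\<Psi>' t u = \<Psi> t u + \<bar>u \<bullet> b - \<mu> t \<bullet> b\<bar>" for t u
  have z: "\<Psi>' t u = 0 \<longleftrightarrow> \<Psi> t u = 0 \<and> u \<bullet> b = \<mu> t \<bullet> b" if "t \<in> space M" "u \<in> U" for t u
    using nonneg'[OF that] by (auto simp: \<Psi>'_def add_nonneg_eq_0_iff)
  show ?case
  proof (intro exI[of _ \<Psi>'] exI[of _ "m(b := \<lambda>t. \<mu> t \<bullet> b)"] conjI ballI impI,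
      unfold caratheodory_zeros_def, intro conjI ballI)
    show "continuous_on U (\<Psi>' t)" if "t \<in> space M" for t
      unfolding \<Psi>'_def by (intro continuous_intros cont' that)
    show "(\<lambda>t. \<Psi>' t u) \<in> borel_measurable M" if "u \<in> U" for u
      unfolding \<Psi>'_def using meas'[OF that] mm by measurable
    show "0 \<le> \<Psi>' t u" if "t \<in> space M" "u \<in> U" for t u
      using nonneg'[OF that] by (simp add: \<Psi>'_def)
    show "\<exists>u\<in>U. \<Psi>' t u = 0" if "t \<in> space M" for t
      using \<mu>(1,2)[OF that] z[OF that] by (intro bexI[of _ "\<mu> t"]) auto
    show "(m(b := \<lambda>t. \<mu> t \<bullet> b)) b' \<in> borel_measurable M" if "b' \<in> insert b B" for b'
      using m mm that by auto
    fix t u assume tu: "t \<in> space M" "u \<in> U" "\<Psi>' t u = 0"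
    then have 1: "\<Psi> t u = 0" "u \<bullet> b = \<mu> t \<bullet> b" using z by auto
    then show "\<Phi> t u = 0" using imp tu by blast
    show "u \<bullet> b' = (m(b := \<lambda>t. \<mu> t \<bullet> b)) b' t" if "b' \<in> insert b B" for b'
      using 1 imp[OF tu(1,2) 1(1)] that by auto
  qed
qed

lemma measurable_zero_selection:
  fixes \<Phi> :: "'s \<Rightarrow> 'c::euclidean_space \<Rightarrow> real"
  assumes U: "compact U" and \<Phi>: "caratheodory_zeros M U \<Phi>"
  obtains u where "u \<in> borel_measurable M" "\<And>t. t \<in> space M \<Longrightarrow> u t \<in> U \<and> \<Phi> t (u t) = 0"
proof -
  obtain \<Psi> m where \<Psi>: "caratheodory_zeros M U \<Psi>" and m: "\<forall>b\<in>Basis. m b \<in> borel_measurable M"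
    and imp: "\<And>t u. t \<in> space M \<Longrightarrow> u \<in> U \<Longrightarrow> \<Psi> t u = 0 \<Longrightarrow> \<Phi> t u = 0 \<and> (\<forall>b\<in>Basis. u \<bullet> b = m b t)"
    using measurable_lexicographic_zero[OF U finite_Basis order_refl \<Phi>] by blast
  from \<Psi> have zero': "\<forall>t\<in>space M. \<exists>u\<in>U. \<Psi> t u = 0" by (simp add: caratheodory_zeros_def)
  show thesis
  proof
    \<comment> \<open>Every coordinate of a zero of \<open>\<Psi> t\<close> is prescribed by
      \<open>m\<close>, so this sum is that zero.\<close>
    show "(\<lambda>t. \<Sum>b\<in>Basis. m b t *\<^sub>R b) \<in> borel_measurable M"
      using m by (intro borel_measurable_sum borel_measurable_scaleR borel_measurable_const) auto
    fix t assume t: "t \<in> space M"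
    then obtain u where u: "u \<in> U" "\<Psi> t u = 0" using zero' by blast
    have "(\<Sum>b\<in>Basis. m b t *\<^sub>R b) = u"
      using imp[OF t u] euclidean_representation[of u] by simp
    then show "(\<Sum>b\<in>Basis. m b t *\<^sub>R b) \<in> U \<and> \<Phi> t (\<Sum>b\<in>Basis. m b t *\<^sub>R b) = 0"
      using u imp[OF t u] by simp
  qed
qed

subsection \<open>Inequalities and limits of primitives\<close>

lemma primitive_integral:
  fixes d :: "real \<Rightarrow> 'a::euclidean_space"
  assumes dm: "d \<in> borel_measurable borel" and b: "\<And>t. norm (d t) \<le> B"
  shows "d integrable_on {a..b}" and "primitive T (\<lambda>t. w0 + integral {0..t} d) d"
proof -
  show int: "d integrable_on {a..b}" for a b
  proof (rule measurable_bounded_by_integrable_imp_integrable)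
    show "d \<in> borel_measurable (lebesgue_on {a..b})"
      using dm by (intro measurable_restrict_space1 measurable_completion) simp
    show "(\<lambda>_. B) integrable_on {a..b}" by (rule integrable_const_ivl)
  qed (use b in auto)
  have "(d has_integral (w0 + integral {0..v} d - (w0 + integral {0..u} d))) {u..v}" if "0 \<le> u" "u \<le> v" for u v
  proof -
    have "integral {0..v} d = integral {0..u} d + integral {u..v} d"
      using Henstock_Kurzweil_Integration.integral_combine[OF that int[of 0 v]] by simp
    then show ?thesis using int[of u v] by (simp add: has_integral_integral)
  qed
  moreover have "bounded (range d)" using b by (auto simp: bounded_iff)
  ultimately show "primitive T (\<lambda>t. w0 + integral {0..t} d) d"
    using dm by (auto simp: primitive_def)
qed

lemma primitive_lipschitz:
  assumes "primitive T w d"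
  obtains K where "K-lipschitz_on {0..T} w"
proof -
  obtain K where K: "\<And>t. norm (d t) \<le> K" using assms by (auto simp: primitive_def bounded_iff)
  have "0 \<le> K" using K[of 0] norm_ge_zero order_trans by blast
  then have "K-lipschitz_on {0..T} w"
    using assms K by (intro primitive_imp_lipschitz) auto
  then show thesis by (rule that)
qed

lemma primitive_continuous_on: "primitive T w d \<Longrightarrow> continuous_on {0..T} w"
  using primitive_lipschitz lipschitz_on_continuous_on by blast

lemma primitive_linear:
  assumes w: "primitive T w d" and h: "bounded_linear h"
  shows "primitive T (\<lambda>t. h (w t)) (\<lambda>t. h (d t))"
  unfolding primitive_def
proof (intro conjI allI impI)
  have dm: "d \<in> borel_measurable borel" and "bounded (range d)" using w by (auto simp: primitive_def)
  have hm: "h \<in> borel_measurable borel"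
    using h by (intro borel_measurable_continuous_onI linear_continuous_on)
  show "(\<lambda>t. h (d t)) \<in> borel_measurable borel" by (rule measurable_compose[OF dm hm])
  show "bounded (range (\<lambda>t. h (d t)))"
    using bounded_linear_image[OF \<open>bounded (range d)\<close> h] by (simp add: image_image)
  fix a b :: real assume "0 \<le> a" "a \<le> b" "b \<le> T"
  then have "(d has_integral (w b - w a)) {a..b}" using w by (auto simp: primitive_def)
  from has_integral_linear[OF this h]
  show "((\<lambda>t. h (d t)) has_integral (h (w b) - h (w a))) {a..b}"
    by (simp add: o_def linear_diff[OF bounded_linear.linear[OF h]])
qed

lemma primitive_diff:
  assumes "primitive T v c" "primitive T w d"
  shows "primitive T (\<lambda>t. v t - w t) (\<lambda>t. c t - d t)"
  unfolding primitive_def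
proof (intro conjI allI impI)
  show "(\<lambda>t. c t - d t) \<in> borel_measurable borel"
    using assms by (intro borel_measurable_diff) (auto simp: primitive_def)
  show "bounded (range (\<lambda>t. c t - d t))"
    using assms by (intro bounded_minus_comp) (auto simp: primitive_def)
  fix a b :: real assume "0 \<le> a" "a \<le> b" "b \<le> T"
  then have "(c has_integral (v b - v a)) {a..b}" "(d has_integral (w b - w a)) {a..b}"
    using assms by (auto simp: primitive_def)
  from has_integral_diff[OF this]
  show "((\<lambda>t. c t - d t) has_integral (v b - w b - (v a - w a))) {a..b}" by (simp add: algebra_simps)
qed

lemma primitive_AE_le:
  fixes \<phi> :: "real \<Rightarrow> real"
  assumes \<phi>: "primitive T \<phi> p" and ab: "0 \<le> a" "a \<le> b" "b \<le> T"
    and le: "AE t in lebesgue_on {0..T}. a < t \<longrightarrow> t < b \<longrightarrow> p t \<le> c"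
  shows "\<phi> b - \<phi> a \<le> c * (b - a)"
proof -
  \<comment> \<open>The minimum agrees with \<open>p\<close> on \<open>{a..b}\<close> up to a null
    set. The two end points belong to that set, because the hypothesis is silent about them.\<close>
  define p' where "p' t = min (p t) c" for t
  have "(p has_integral (\<phi> b - \<phi> a)) {a..b}" using \<phi> ab by (auto simp: primitive_def)
  then have "(p' has_integral (\<phi> b - \<phi> a)) {a..b}"
  proof (rule has_integral_spike[rotated 2])
    show "negligible ({a, b} \<union> {t \<in> {0..T}. \<not> (a < t \<longrightarrow> t < b \<longrightarrow> p t \<le> c)})"
      using le unfolding AE_lebesgue_on_interval_iff by simp
  qed (use ab in \<open>auto simp: p'_def\<close>)
  moreover have "((\<lambda>_. c) has_integral (c * (b - a))) {a..b}"
    using has_integral_const_real[of c a b] ab by (simp add: mult.commute)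
  ultimately show ?thesis by (rule has_integral_le) (simp add: p'_def)
qed

text \<open>The barrier principle behind the comparisons for the level equation. After the last time
  \<open>s\<close> before \<open>t\<close> with \<open>\<phi> s \<le> 0\<close> the function is
  positive, hence nonincreasing, so it cannot have risen. Information is asked for only where
  \<open>\<phi>\<close> is positive, which suits right-hand sides that are monotone in the
  state.\<close>

lemma primitive_nonpos:
  fixes \<phi> :: "real \<Rightarrow> real"
  assumes \<phi>: "primitive T \<phi> p" and init: "\<phi> 0 \<le> 0"
    and le: "AE t in lebesgue_on {0..T}. 0 < \<phi> t \<longrightarrow> p t \<le> 0"
    and t: "0 \<le> t" "t \<le> T"
  shows "\<phi> t \<le> 0"
proof (rule ccontr)
  assume pos: "\<not> \<phi> t \<le> 0"
  have cont: "continuous_on {0..T} \<phi>" by (rule primitive_continuous_on[OF \<phi>])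
  define S where "S = {0..t} \<inter> \<phi> -` {..0}"
  have "closed S" unfolding S_def
    using cont t by (intro continuous_closed_preimage) (auto intro: continuous_on_subset)
  moreover have "0 \<in> S" using init t by (simp add: S_def)
  moreover have bdd: "bdd_above S" by (auto simp: S_def bdd_above_def)
  ultimately have Sup: "Sup S \<in> S" using closed_contains_Sup by blast
  define s where "s = Sup S"
  have s: "0 \<le> s" "s \<le> t" "\<phi> s \<le> 0" using Sup by (auto simp: s_def S_def)
  have gt: "0 < \<phi> r" if "s < r" "r < t" for r
  proof (rule ccontr)
    assume "\<not> 0 < \<phi> r"
    then have "r \<in> S" using that s by (simp add: S_def)
    then show False using cSup_upper[OF _ bdd] that by (force simp: s_def)
  qed
  have "\<phi> t - \<phi> s \<le> 0 * (t - s)"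
    using le by (intro primitive_AE_le[OF \<phi> s(1,2) t(2)]) (auto elim!: eventually_mono simp: gt)
  then show False using pos s(3) by simp
qed

lemma gronwall:
  fixes \<phi> :: "real \<Rightarrow> real"
  assumes cont: "continuous_on {0..T} \<phi>" and C: "0 \<le> C"
    and le: "\<And>t. 0 \<le> t \<Longrightarrow> t \<le> T \<Longrightarrow> \<phi> t \<le> A + C * integral {0..t} \<phi>"
    and t: "0 \<le> t" "t \<le> T"
  shows "\<phi> t \<le> A * exp (C * t)"
proof -
  \<comment> \<open>The integrating factor makes \<open>v\<close> nonincreasing, since the
    hypothesis bounds \<open>\<phi>\<close> by the first factor of \<open>v\<close>.\<close>
  define v where "v t = (A + C * integral {0..t} \<phi>) * exp (- C * t)" for t
  have der: "(v has_real_derivative (C * \<phi> s - C * (A + C * integral {0..s} \<phi>)) * exp (- C * s)) (at s within {0..T})"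
    if "s \<in> {0..T}" for s
  proof -
    have "((\<lambda>t. integral {0..t} \<phi>) has_real_derivative \<phi> s) (at s within {0..T})"
      using integral_has_real_derivative[OF cont that] .
    then show ?thesis unfolding v_def
      by (auto intro!: derivative_eq_intros simp: algebra_simps)
  qed
  have "v t \<le> v 0"
  proof (rule DERIV_nonpos_imp_decreasing_open[OF t(1)])
    fix s assume s: "0 < s" "s < t"
    then have "s \<in> {0..T}" using t by auto
    moreover have "at s within {0..T} = at s" using s t by (intro at_within_interior) auto
    ultimately have "(v has_real_derivative (C * \<phi> s - C * (A + C * integral {0..s} \<phi>)) * exp (- C * s)) (at s)"
      using der by metis
    moreover have "(C * \<phi> s - C * (A + C * integral {0..s} \<phi>)) * exp (- C * s) \<le> 0"
    proof (rule mult_nonpos_nonneg)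
      show "C * \<phi> s - C * (A + C * integral {0..s} \<phi>) \<le> 0"
        using mult_left_mono[OF le[of s] C] s t by simp
    qed simp
    ultimately show "\<exists>y. (v has_real_derivative y) (at s) \<and> y \<le> 0" by blast
  next
    have "continuous_on {0..T} v"
      using der by (intro DERIV_continuous_on[of _ v]) auto
    then show "continuous_on {0..t} v" using t by (auto intro: continuous_on_subset)
  qed
  then have "(A + C * integral {0..t} \<phi>) \<le> A * exp (C * t)"
    by (simp add: v_def exp_minus field_simps)
  then show ?thesis using le[OF t] by simp
qed

text \<open>Integration turns the bound on velocities into one on increments of \<open>W k\<close>;
  this survives pointwise convergence, and difference quotients of the limit carry it to the
  derivative. The window \<open>\<delta>\<close> is the same for all large \<open>k\<close>, so the
  increments can be taken over fixed intervals.\<close>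

lemma limit_derivative_ge:
  fixes w :: "real \<Rightarrow> 'a::euclidean_space"
  assumes T: "0 < T" and W: "\<And>k. primitive T (W k) (d k)"
    and lim: "\<And>s. s \<in> {0..T} \<Longrightarrow> (\<lambda>k. W k s) \<longlonglongrightarrow> w s"
    and t: "t \<in> {0..T}" and e: "(w has_vector_derivative e) (at t within {0..T})"
    and \<delta>: "0 < \<delta>"
    and ge: "\<forall>\<^sub>F k in sequentially. AE s in lebesgue_on {0..T}. \<bar>s - t\<bar> < \<delta> \<longrightarrow> c \<le> a \<bullet> d k s"
  shows "c \<le> a \<bullet> e"
proof -
  have mono: "c * (v - u) \<le> a \<bullet> w v - a \<bullet> w u"
    if uv: "0 \<le> u" "u \<le> v" "v \<le> T" "\<bar>u - t\<bar> < \<delta>" "\<bar>v - t\<bar> < \<delta>" for u v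
  proof (rule tendsto_lowerbound)
    show "(\<lambda>k. a \<bullet> W k v - a \<bullet> W k u) \<longlonglongrightarrow> a \<bullet> w v - a \<bullet> w u"
      using uv by (intro tendsto_intros lim) auto
    show "\<forall>\<^sub>F k in sequentially. c * (v - u) \<le> a \<bullet> W k v - a \<bullet> W k u"
      using ge
    proof eventually_elim
      case (elim k)
      have "primitive T (\<lambda>s. - (a \<bullet> W k s)) (\<lambda>s. - (a \<bullet> d k s))"
        using primitive_linear[OF W, of "\<lambda>x. - (a \<bullet> x)"]
        by (simp add: bounded_linear_minus bounded_linear_inner_right)
      moreover have "AE s in lebesgue_on {0..T}. u < s \<longrightarrow> s < v \<longrightarrow> - (a \<bullet> d k s) \<le> - c"
        using elim by eventually_elim (use uv in auto)
      ultimately have "- (a \<bullet> W k v) - - (a \<bullet> W k u) \<le> - c * (v - u)"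
        by (rule primitive_AE_le[OF _ uv(1-3)])
      then show ?case by simp
    qed
  qed simp
  have "((\<lambda>s. a \<bullet> w s) has_real_derivative a \<bullet> e) (at t within {0..T})"
    using bounded_linear.has_vector_derivative[OF bounded_linear_inner_right e, of a]
    by (simp add: has_real_derivative_iff_has_vector_derivative)
  then have "((\<lambda>s. (a \<bullet> w s - a \<bullet> w t) / (s - t)) \<longlongrightarrow> a \<bullet> e) (at t within {0..T})"
    by (simp add: has_field_derivative_iff)
  moreover have "\<forall>\<^sub>F s in at t within {0..T}. c \<le> (a \<bullet> w s - a \<bullet> w t) / (s - t)"
    unfolding eventually_at
  proof (intro exI[of _ \<delta>] conjI ballI impI \<delta>)
    fix s assume s: "s \<in> {0..T}" "s \<noteq> t \<and> dist s t < \<delta>"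
    show "c \<le> (a \<bullet> w s - a \<bullet> w t) / (s - t)"
    proof (cases "s < t")
      case True
      then show ?thesis using mono[of s t] s t \<delta> by (simp add: dist_real_def neg_le_divide_eq algebra_simps)
    next
      case False
      then show ?thesis using mono[of t s] s t \<delta> by (simp add: dist_real_def pos_le_divide_eq)
    qed
  qed
  moreover have "at t within {0..T} \<noteq> bot"
    using T t by (simp add: trivial_limit_within islimpt_Icc)
  ultimately show ?thesis by (intro tendsto_lowerbound)
qed

text \<open>Otherwise a hyperplane strictly separates \<open>e\<close> from \<open>G\<close>.
  Velocities close to \<open>G\<close> stay beyond it up to a small error, and
  \<open>limit_derivative_ge\<close> forces \<open>e\<close> to do the same.\<close>

lemma limit_derivative_in_closed_convex:
  fixes w :: "real \<Rightarrow> 'a::euclidean_space"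
  assumes T: "0 < T" and W: "\<And>k. primitive T (W k) (d k)"
    and lim: "\<And>s. s \<in> {0..T} \<Longrightarrow> (\<lambda>k. W k s) \<longlonglongrightarrow> w s"
    and t: "t \<in> {0..T}" and e: "(w has_vector_derivative e) (at t within {0..T})"
    and G: "closed G" "convex G"
    and near: "\<And>\<epsilon>. 0 < \<epsilon> \<Longrightarrow> \<exists>\<delta>>0. \<forall>\<^sub>F k in sequentially. AE s in lebesgue_on {0..T}.
        \<bar>s - t\<bar> < \<delta> \<longrightarrow> (\<exists>x\<in>G. dist (d k s) x \<le> \<epsilon>)"
  shows "e \<in> G"
proof (rule ccontr)
  assume "e \<notin> G"
  then obtain a b where ab: "a \<bullet> e < b" "\<And>x. x \<in> G \<Longrightarrow> b < a \<bullet> x"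
    using separating_hyperplane_closed_point[OF G(2,1)] by blast
  \<comment> \<open>Moving a point of \<open>G\<close> by \<open>\<epsilon>\<close> uses up at most
    half of the separating gap; the summand \<open>1\<close> avoids a division by zero.\<close>
  define \<epsilon> where "\<epsilon> = (b - a \<bullet> e) / (2 * (norm a + 1))"
  have \<epsilon>: "0 < \<epsilon>" using ab(1) by (simp add: \<epsilon>_def add_nonneg_pos)
  obtain \<delta> where \<delta>: "0 < \<delta>" and ev: "\<forall>\<^sub>F k in sequentially. AE s in lebesgue_on {0..T}.
      \<bar>s - t\<bar> < \<delta> \<longrightarrow> (\<exists>x\<in>G. dist (d k s) x \<le> \<epsilon>)"
    using near[OF \<epsilon>] by blast
  have "b - norm a * \<epsilon> \<le> a \<bullet> e"
  proof (rule limit_derivative_ge[OF T W lim t e \<delta>])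
    show "\<forall>\<^sub>F k in sequentially. AE s in lebesgue_on {0..T}. \<bar>s - t\<bar> < \<delta> \<longrightarrow> b - norm a * \<epsilon> \<le> a \<bullet> d k s"
      using ev
    proof eventually_elim
      case (elim k)
      then show ?case
      proof eventually_elim
        case (elim s)
        show ?case
        proof
          assume "\<bar>s - t\<bar> < \<delta>"
          then obtain x where x: "x \<in> G" "norm (x - d k s) \<le> \<epsilon>"
            using elim by (auto simp: dist_norm norm_minus_commute)
          have "a \<bullet> (x - d k s) \<le> norm a * norm (x - d k s)" by (rule norm_cauchy_schwarz)
          also have "\<dots> \<le> norm a * \<epsilon>" using x(2) by (intro mult_left_mono) auto
          finally show "b - norm a * \<epsilon> \<le> a \<bullet> d k s" using ab(2)[OF x(1)] by (simp add: inner_diff_right)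
        qed
      qed
    qed
  qed
  moreover have "norm a * \<epsilon> < b - a \<bullet> e"
  proof -
    have "norm a * \<epsilon> \<le> (norm a + 1) * \<epsilon>" using \<epsilon> by (intro mult_right_mono) auto
    also have "\<dots> = (b - a \<bullet> e) / 2"
      using norm_ge_zero[of a] by (simp add: \<epsilon>_def field_simps add_nonneg_eq_0_iff)
    finally show ?thesis using ab(1) by simp
  qed
  ultimately show False by simp
qed

lemma lipschitz_uniform_limit_subsequence:
  fixes W :: "nat \<Rightarrow> real \<Rightarrow> 'a::euclidean_space"
  assumes T: "0 \<le> T" and lip: "\<And>n. K-lipschitz_on {0..T} (W n)" and init: "\<And>n. W n 0 = w0"
  obtains w r where "strict_mono r" "K-lipschitz_on {0..T} w"
    "uniform_limit {0..T} (\<lambda>k. W (r k)) w sequentially" "w 0 = w0"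
proof -
  have K: "0 \<le> K" using lip[of 0] by (rule lipschitz_on_nonneg)
  obtain w r where cont: "continuous_on {0..T} w" and r: "strict_mono (r :: nat \<Rightarrow> nat)"
    and u: "\<And>e. 0 < e \<Longrightarrow> \<exists>N. \<forall>n x. n \<ge> N \<and> x \<in> {0..T} \<longrightarrow> norm (W (r n) x - w x) < e"
  proof (rule Arzela_Ascoli[of "{0..T}" W "norm w0 + K * T"])
    fix n x assume x: "x \<in> {0..T}"
    have "dist (W n x) (W n 0) \<le> K * dist x 0" using x T by (intro lipschitz_onD[OF lip]) auto
    also have "\<dots> \<le> K * T" using x K by (intro mult_left_mono) auto
    finally have "norm (W n x - w0) \<le> K * T" by (simp add: dist_norm init)
    then show "norm (W n x) \<le> norm w0 + K * T"
      using norm_triangle_ineq2[of "W n x" w0] by linarith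
  next
    fix x e :: real assume x: "x \<in> {0..T}" and e: "0 < e"
    show "\<exists>d>0. \<forall>n y. y \<in> {0..T} \<and> norm (x - y) < d \<longrightarrow> norm (W n x - W n y) < e"
    proof (intro exI[of _ "e / (K + 1)"] conjI allI impI)
      show "0 < e / (K + 1)" using e K by simp
      fix n y assume y: "y \<in> {0..T} \<and> norm (x - y) < e / (K + 1)"
      have "norm (W n x - W n y) \<le> K * norm (x - y)"
        using lipschitz_onD[OF lip x, of y] y by (simp add: dist_norm)
      also have "\<dots> \<le> (K + 1) * norm (x - y)" by (intro mult_right_mono) auto
      also have "\<dots> < (K + 1) * (e / (K + 1))" using y K by (intro mult_strict_left_mono) auto
      also have "\<dots> = e" using K by simp
      finally show "norm (W n x - W n y) < e" .
    qed
  qed auto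
  have ul: "uniform_limit {0..T} (\<lambda>k. W (r k)) w sequentially"
    unfolding uniform_limit_iff
  proof (intro allI impI)
    fix e :: real assume "0 < e"
    from u[OF this] show "\<forall>\<^sub>F n in sequentially. \<forall>x\<in>{0..T}. dist (W (r n) x) (w x) < e"
      unfolding eventually_sequentially dist_norm by blast
  qed
  have lim: "(\<lambda>k. W (r k) t) \<longlonglongrightarrow> w t" if "t \<in> {0..T}" for t
    using ul that by (rule tendsto_uniform_limitI)
  have "K-lipschitz_on {0..T} w"
  proof (rule lipschitz_onI)
    fix s t assume st: "s \<in> {0..T}" "t \<in> {0..T}"
    show "dist (w s) (w t) \<le> K * dist s t"
    proof (rule tendsto_upperbound)
      show "(\<lambda>k. dist (W (r k) s) (W (r k) t)) \<longlonglongrightarrow> dist (w s) (w t)"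
        by (intro tendsto_dist lim st)
      show "\<forall>\<^sub>F k in sequentially. dist (W (r k) s) (W (r k) t) \<le> K * dist s t"
        using st by (intro always_eventually allI lipschitz_onD[OF lip])
    qed simp
  qed (rule K)
  moreover have "w 0 = w0"
    using lim[of 0] T by (simp add: init LIMSEQ_const_iff)
  ultimately show thesis using that r ul by blast
qed

subsection \<open>Euler polygons\<close>

text \<open>The velocity is frozen at the last node \<open>Q t\<close>, so on each step
  \<open>W\<close> is an explicit integral with the state as a parameter, and measurability in time
  for each fixed state suffices. \<open>Q\<close> is exported because the velocity belongs to
  \<open>Q\<close> and not to \<open>W\<close>.\<close>

lemma euler_polygon:
  fixes f :: "real \<Rightarrow> 'a::euclidean_space \<Rightarrow> 'a"
  assumes meas: "\<And>p. (\<lambda>t. f t p) \<in> borel_measurable borel"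
    and bd: "\<And>t p. norm (f t p) \<le> K" and h: "0 < h"
  obtains W Q d where "primitive T W d" "\<And>t. d t = f t (Q t)" "W 0 = w0"
    "\<And>t. 0 \<le> t \<Longrightarrow> norm (Q t - W t) \<le> K * h"
proof -
  have K: "0 \<le> K" using bd[of 0 0] norm_ge_zero order_trans by blast
  define p where "p = rec_nat w0 (\<lambda>i q. q + integral {real i * h..real (Suc i) * h} (\<lambda>s. f s q))"
  have p: "p 0 = w0" "p (Suc i) = p i + integral {real i * h..real (Suc i) * h} (\<lambda>s. f s (p i))" for i
    by (simp_all add: p_def)
  define N where "N t = nat \<lfloor>t / h\<rfloor>" for t
  define Q where "Q t = p (N t)" for t
  define d where "d t = f t (Q t)" for t
  define W where "W t = w0 + integral {0..t} d" for t
  have dm: "d \<in> borel_measurable borel"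
  proof -
    have "N \<in> borel \<rightarrow>\<^sub>M count_space UNIV" unfolding N_def by measurable
    then show ?thesis unfolding d_def Q_def
      by (intro measurable_compose_countable[where f = "\<lambda>i t. f t (p i)" and g = N]) (rule meas)
  qed
  have dK: "norm (d t) \<le> K" for t by (simp add: d_def bd)
  note int = primitive_integral(1)[OF dm dK]
  have node: "W (real i * h) = p i" for i
  proof (induction i)
    case 0 show ?case by (simp add: W_def p)
  next
    case (Suc i)
    have le: "0 \<le> real i * h" "real i * h \<le> real (Suc i) * h" using h by (auto simp: algebra_simps)
    have "integral {0..real (Suc i) * h} d = integral {0..real i * h} d + integral {real i * h..real (Suc i) * h} d"
      using Henstock_Kurzweil_Integration.integral_combine[OF le int] by simp
    also have "integral {real i * h..real (Suc i) * h} d = integral {real i * h..real (Suc i) * h} (\<lambda>s. f s (p i))"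
    \<comment> \<open>At the right end point the index \<open>N\<close> has already advanced, so
      that point is removed as a null set.\<close>
    proof (rule integral_spike[of "{real (Suc i) * h}"])
      fix s assume s: "s \<in> {real i * h..real (Suc i) * h} - {real (Suc i) * h}"
      then have "real i \<le> s / h" "s / h < real i + 1" using h by (auto simp: field_simps)
      then have "\<lfloor>s / h\<rfloor> = int i" by (intro floor_unique) auto
      then show "f s (p i) = d s" by (simp add: d_def Q_def N_def)
    qed simp
    finally show ?case using Suc by (simp add: W_def p)
  qed
  have prim: "primitive T' W d" for T'
    unfolding W_def by (rule primitive_integral(2)[OF dm dK])
  have lip: "K-lipschitz_on {0..T'} W" for T'
    using dK by (intro primitive_imp_lipschitz[OF K prim]) auto
  have "norm (Q t - W t) \<le> K * h" if t: "0 \<le> t" for t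
  proof -
    define s where "s = real (N t) * h"
    have "0 \<le> t / h" using t h by simp
    then have "real (N t) \<le> t / h" "t / h < real (N t) + 1"
      unfolding N_def by linarith+
    then have s: "0 \<le> s" "s \<le> t" "t - s \<le> h" using h by (auto simp: s_def field_simps)
    have "norm (Q t - W t) = dist (W s) (W t)" by (simp add: Q_def s_def node dist_norm)
    also have "\<dots> \<le> K * dist s t" using s t by (intro lipschitz_onD[OF lip[of t]]) auto
    also have "\<dots> \<le> K * h" using s K by (intro mult_left_mono) (auto simp: dist_real_def)
    finally show ?thesis .
  qed
  moreover have "W 0 = w0" by (simp add: W_def)
  ultimately show thesis using that[of W d Q] prim[of T] by (simp add: d_def)
qed

text \<open>No continuity in the state is assumed, so the limit is not claimed to solve an equation.
  \<open>caratheodory_existence\<close> adds continuity; \<open>trajectory_exists\<close> applies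
  this to a cut-off field with a jump and asks only that the limit velocities be admissible.\<close>

lemma euler_sequence:
  fixes f :: "real \<Rightarrow> 'a::euclidean_space \<Rightarrow> 'a"
  assumes T: "0 \<le> T" and meas: "\<And>p. (\<lambda>t. f t p) \<in> borel_measurable borel"
    and bd: "\<And>t p. norm (f t p) \<le> K"
  obtains W Q d w where "\<And>k. primitive T (W k) (d k)" "\<And>k t. d k t = f t (Q k t)"
    "\<And>k. W k 0 = w0" "w 0 = w0"
    "K-lipschitz_on {0..T} w"
    "uniform_limit {0..T} W w sequentially" "uniform_limit {0..T} Q w sequentially"
proof -
  have K: "0 \<le> K" using bd[of 0 0] norm_ge_zero order_trans by blast
  have "\<exists>W Q d. primitive T W d \<and> (\<forall>t. d t = f t (Q t)) \<and> W 0 = w0 \<and>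
      (\<forall>t\<ge>0. norm (Q t - W t) \<le> K * (inverse (real (Suc n))))" for n
  proof -
    have "0 < inverse (real (Suc n))" by simp
    from euler_polygon[where f = f and T = T and ?w0.0 = w0, OF meas bd this]
    obtain W Q d where "primitive T W d" "\<And>t. d t = f t (Q t)" "W 0 = w0"
      "\<And>t. 0 \<le> t \<Longrightarrow> norm (Q t - W t) \<le> K * (inverse (real (Suc n)))"
      by blast
    then show ?thesis by blast
  qed
  then obtain W Q d where "\<forall>n. primitive T (W n) (d n) \<and> (\<forall>t. d n t = f t (Q n t)) \<and> W n 0 = w0 \<and>
      (\<forall>t\<ge>0. norm (Q n t - W n t) \<le> K * (inverse (real (Suc n))))" by metis
  then have W: "\<And>n. primitive T (W n) (d n)" "\<And>n. W n 0 = w0" and d: "\<And>n t. d n t = f t (Q n t)"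
    and Q: "\<And>n t. 0 \<le> t \<Longrightarrow> norm (Q n t - W n t) \<le> K * (inverse (real (Suc n)))" by auto
  have lip: "K-lipschitz_on {0..T} (W n)" for n
    using bd by (intro primitive_imp_lipschitz[OF K W(1)]) (simp add: d)
  obtain w r where r: "strict_mono r" and lw: "K-lipschitz_on {0..T} w" and w0: "w 0 = w0"
    and u: "uniform_limit {0..T} (\<lambda>k. W (r k)) w sequentially"
    by (rule lipschitz_uniform_limit_subsequence[OF T lip W(2)])
  have "uniform_limit {0..T} (\<lambda>k t. Q (r k) t - W (r k) t) (\<lambda>t. 0) sequentially"
  proof (rule uniform_limit_null_comparison)
    show "\<forall>\<^sub>F k in sequentially. \<forall>t\<in>{0..T}. norm (Q (r k) t - W (r k) t) \<le> K * inverse (real (Suc (r k)))"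
      using Q by auto
    have "(\<lambda>k. K * inverse (real (Suc k))) \<longlonglongrightarrow> 0"
      by (rule tendsto_mult_right_zero[OF LIMSEQ_inverse_real_of_nat])
    from LIMSEQ_subseq_LIMSEQ[OF this r]
    have "(\<lambda>k. K * inverse (real (Suc (r k)))) \<longlonglongrightarrow> 0" by (simp add: o_def)
    then show "uniform_limit {0..T} (\<lambda>k t. K * inverse (real (Suc (r k)))) (\<lambda>t. 0) sequentially"
      unfolding uniform_limit_iff tendsto_iff by (auto elim!: eventually_mono)
  qed
  from uniform_limit_add[OF this u] have "uniform_limit {0..T} (\<lambda>k. Q (r k)) w sequentially"
    by simp
  then show thesis using that[of "\<lambda>k. W (r k)" "\<lambda>k. d (r k)" "\<lambda>k. Q (r k)" w] W d lw w0 u by blast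
qed

text \<open>By continuity in the state the bounded velocities of the polygons converge pointwise,
  and dominated convergence passes the integral equation to the limit.\<close>

lemma caratheodory_existence:
  fixes f :: "real \<Rightarrow> 'a::euclidean_space \<Rightarrow> 'a"
  assumes T: "0 \<le> T" and meas: "\<And>p. (\<lambda>t. f t p) \<in> borel_measurable borel"
    and bd: "\<And>t p. norm (f t p) \<le> K" and cont: "\<And>t. continuous_on UNIV (f t)"
  obtains w d where "primitive T w d" "w 0 = w0" "\<And>t. t \<in> {0..T} \<Longrightarrow> d t = f t (w t)"
proof -
  obtain W Q e w where prim: "\<And>k. primitive T (W k) (e k)" and e: "\<And>k t. e k t = f t (Q k t)"
    and init: "\<And>k. W k 0 = w0" "w 0 = w0" and "K-lipschitz_on {0..T} w"
    and ul: "uniform_limit {0..T} W w sequentially" "uniform_limit {0..T} Q w sequentially"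
    by (rule euler_sequence[where f = f and ?w0.0 = w0 and T = T and K = K, OF T meas bd]) blast
  define d where "d t = (if t \<in> {0..T} then f t (w t) else 0)" for t
  have K: "0 \<le> K" using bd[of 0 0] norm_ge_zero order_trans by blast
  have lim: "(\<lambda>k. f t (Q k t)) \<longlonglongrightarrow> f t (w t)" if "t \<in> {0..T}" for t
  proof -
    have "isCont (f t) (w t)" using cont[of t] continuous_on_eq_continuous_at[OF open_UNIV] by blast
    moreover have "(\<lambda>k. Q k t) \<longlonglongrightarrow> w t" using ul(2) that by (rule tendsto_uniform_limitI)
    ultimately show ?thesis by (rule isCont_tendsto_compose)
  qed
  \<comment> \<open>The composition \<open>f t (w t)\<close> is measurable as a pointwise limit of
    polygon velocities, which are measurable by construction.\<close>
  have dm: "d \<in> borel_measurable borel"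
  proof (rule borel_measurable_LIMSEQ_metric)
    show "(\<lambda>t. if t \<in> {0..T} then f t (Q k t) else 0) \<in> borel_measurable borel" for k
      using prim[of k] unfolding primitive_def e[symmetric] by auto
    show "(\<lambda>k. if t \<in> {0..T} then f t (Q k t) else 0) \<longlonglongrightarrow> d t" for t
      using lim by (auto simp: d_def)
  qed
  have dK: "norm (d t) \<le> K" for t using bd K by (simp add: d_def)
  have "w t = w0 + integral {0..t} d" if t: "t \<in> {0..T}" for t
  proof (rule LIMSEQ_unique)
    show "(\<lambda>k. W k t) \<longlonglongrightarrow> w t" using ul(1) t by (rule tendsto_uniform_limitI)
    have hi: "((\<lambda>s. f s (Q k s)) has_integral (W k t - w0)) {0..t}" for k
      using prim[of k] init(1)[of k] t unfolding primitive_def e[symmetric] by auto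
    have "(\<lambda>k. integral {0..t} (\<lambda>s. f s (Q k s))) \<longlonglongrightarrow> integral {0..t} d"
    proof (rule dominated_convergence(2))
      show "(\<lambda>s. f s (Q k s)) integrable_on {0..t}" for k using hi by blast
      show "(\<lambda>_. K) integrable_on {0..t}" by (rule integrable_const_ivl)
      show "norm (f s (Q k s)) \<le> K" for k s by (rule bd)
      show "(\<lambda>k. f s (Q k s)) \<longlonglongrightarrow> d s" if "s \<in> {0..t}" for s
        using lim[of s] that t by (auto simp: d_def)
    qed
    then have "(\<lambda>k. W k t - w0) \<longlonglongrightarrow> integral {0..t} d"
      using integral_unique[OF hi] by simp
    from tendsto_add[OF tendsto_const[of w0] this]
    show "(\<lambda>k. W k t) \<longlonglongrightarrow> w0 + integral {0..t} d" by simp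
  qed
  then have "primitive T w d"
    using primitive_integral(2)[OF dm dK, of T w0] by (simp add: primitive_def)
  then show thesis using init(2) by (intro that[of w d]) (auto simp: d_def)
qed

text \<open>Uniform continuity on a compact neighbourhood of \<open>x\<close> times \<open>U\<close>
  makes \<open>\<eta>\<close> independent of the control.\<close>

lemma uniformly_near_image:
  fixes F :: "'a::euclidean_space \<Rightarrow> 'c::metric_space \<Rightarrow> 'b::metric_space"
  assumes D: "open D" and U: "compact U" and cont: "continuous_on (D \<times> U) (\<lambda>(w, u). F w u)"
    and x: "x \<in> D" and \<epsilon>: "0 < \<epsilon>"
  shows "\<exists>\<eta>>0. \<forall>v. dist v x < \<eta> \<longrightarrow> v \<in> D \<and> (\<forall>u\<in>U. dist (F v u) (F x u) \<le> \<epsilon>)"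
proof -
  obtain \<rho> where \<rho>: "0 < \<rho>" "cball x \<rho> \<subseteq> D" using D x open_contains_cball by blast
  have "compact (cball x \<rho> \<times> U)" using U by (intro compact_Times) auto
  then have "uniformly_continuous_on (cball x \<rho> \<times> U) (\<lambda>(w, u). F w u)"
    using \<rho>(2) by (intro compact_uniformly_continuous continuous_on_subset[OF cont]) auto
  then obtain \<delta> where \<delta>: "0 < \<delta>" "\<And>z z'. z \<in> cball x \<rho> \<times> U \<Longrightarrow> z' \<in> cball x \<rho> \<times> U \<Longrightarrow> dist z' z < \<delta> \<Longrightarrow>
      dist (case z' of (w, u) \<Rightarrow> F w u) (case z of (w, u) \<Rightarrow> F w u) < \<epsilon>"
    using \<epsilon> unfolding uniformly_continuous_on_def by metis
  show ?thesis
  proof (intro exI[of _ "min \<rho> \<delta>"] conjI allI impI ballI)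
    fix v assume v: "dist v x < min \<rho> \<delta>"
    then have vc: "v \<in> cball x \<rho>" by (simp add: dist_commute)
    then show "v \<in> D" using \<rho>(2) by blast
    fix u assume "u \<in> U"
    then show "dist (F v u) (F x u) \<le> \<epsilon>"
      using \<delta>(2)[of "(x, u)" "(v, u)"] vc v \<rho>(1) by (simp add: dist_Pair_Pair less_imp_le)
  qed (use \<rho> \<delta> in auto)
qed

subsection \<open>Limits of trajectories\<close>

lemma primitive_mono:
  "primitive T w d \<Longrightarrow> \<tau> \<le> T \<Longrightarrow> primitive \<tau> w d"
  by (auto simp: primitive_def)

text \<open>The domain is a parameter of its own because the existence proof applies these results
  to \<open>D\<close> intersected with a ball. Invariance enters only in
  \<open>trajectory_limit\<close>, for the one limit function at hand.\<close>

locale compact_convex_control =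
  fixes F :: "'a::euclidean_space \<Rightarrow> 'c::euclidean_space \<Rightarrow> 'a" and D :: "'a set" and U :: "'c set"
  assumes open_D: "open D" and compact_U: "compact U" and U_ne: "U \<noteq> {}"
    and cont: "continuous_on (D \<times> U) (\<lambda>(w, u). F w u)"
    and convex_F: "\<And>w. w \<in> D \<Longrightarrow> convex (F w ` U)"
begin

lemma continuous_on_control: "w \<in> D \<Longrightarrow> continuous_on U (F w)"
proof -
  assume w: "w \<in> D"
  have "continuous_on U (\<lambda>u. (\<lambda>(w, u). F w u) (w, u))"
    by (rule continuous_on_compose2[OF cont]) (use w in \<open>auto intro!: continuous_intros\<close>)
  then show ?thesis by simp
qed

text \<open>Near \<open>t\<close> the states \<open>Q k s\<close> are close to \<open>w t\<close>,
  so the velocity \<open>F (Q k s) u\<close> is close to the point \<open>F (w t) u\<close> of the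
  velocity set at \<open>w t\<close>. Closedness and convexity of that set do the rest.\<close>

lemma limit_velocity_admissible:
  assumes T: "0 < T" and W: "\<And>k. primitive T (W k) (d k)"
    and W_lim: "uniform_limit {0..T} W w sequentially" and Q_lim: "uniform_limit {0..T} Q w sequentially"
    and cw: "continuous_on {0..T} w"
    and vel: "\<And>k. AE s in lebesgue_on {0..T}. Q k s \<in> D \<longrightarrow> d k s \<in> F (Q k s) ` U"
    and t: "t \<in> {0..T}" "w t \<in> D" and e: "(w has_vector_derivative e) (at t within {0..T})"
  shows "e \<in> F (w t) ` U"
proof (rule limit_derivative_in_closed_convex[OF T W _ t(1) e])
  show "(\<lambda>k. W k s) \<longlonglongrightarrow> w s" if "s \<in> {0..T}" for s
    using W_lim that by (rule tendsto_uniform_limitI)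
  show "closed (F (w t) ` U)"
    using compact_continuous_image[OF continuous_on_control[OF t(2)] compact_U] by (rule compact_imp_closed)
  show "convex (F (w t) ` U)" by (rule convex_F[OF t(2)])
  fix \<epsilon> :: real assume "0 < \<epsilon>"
  then obtain \<eta> where \<eta>: "0 < \<eta>" "\<And>v. dist v (w t) < \<eta> \<Longrightarrow> v \<in> D"
    "\<And>v u. dist v (w t) < \<eta> \<Longrightarrow> u \<in> U \<Longrightarrow> dist (F v u) (F (w t) u) \<le> \<epsilon>"
    using uniformly_near_image[OF open_D compact_U cont t(2)] by metis
  have "0 < \<eta> / 2" using \<eta>(1) by simp
  then obtain \<delta> where \<delta>: "0 < \<delta>" "\<And>s. s \<in> {0..T} \<Longrightarrow> dist s t < \<delta> \<Longrightarrow> dist (w s) (w t) < \<eta> / 2"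
    using cw t(1) unfolding continuous_on_iff by metis
  have "\<forall>\<^sub>F k in sequentially. \<forall>s\<in>{0..T}. dist (Q k s) (w s) < \<eta> / 2"
    using Q_lim \<open>0 < \<eta> / 2\<close> unfolding uniform_limit_iff by blast
  then have "\<forall>\<^sub>F k in sequentially. AE s in lebesgue_on {0..T}. \<bar>s - t\<bar> < \<delta> \<longrightarrow>
      (\<exists>x\<in>F (w t) ` U. dist (d k s) x \<le> \<epsilon>)"
  proof eventually_elim
    case (elim k)
    note AE_in_interval[of 0 T]
    with vel[of k] show ?case
    proof eventually_elim
      case inner: (elim s)
      show ?case
      proof
        assume "\<bar>s - t\<bar> < \<delta>"
        then have "dist (w s) (w t) < \<eta> / 2" using \<delta>(2) inner by (simp add: dist_real_def)
        moreover have "dist (Q k s) (w s) < \<eta> / 2" using elim inner by blast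
        ultimately have Qs: "dist (Q k s) (w t) < \<eta>"
          using dist_triangle_half_r[of "w s" "Q k s" \<eta> "w t"] by (simp add: dist_commute)
        then obtain u where "u \<in> U" "d k s = F (Q k s) u" using \<eta>(2) inner by blast
        then show "\<exists>x\<in>F (w t) ` U. dist (d k s) x \<le> \<epsilon>" using \<eta>(3)[OF Qs]
            by (intro bexI[of _ "F (w t) u"]) auto
      qed
    qed
  qed
  then show "\<exists>\<delta>>0. \<forall>\<^sub>F k in sequentially. AE s in lebesgue_on {0..T}. \<bar>s - t\<bar> < \<delta> \<longrightarrow>
      (\<exists>x\<in>F (w t) ` U. dist (d k s) x \<le> \<epsilon>)"
    using \<delta>(1) by blast
qed

text \<open>Filippov selection: the control at time \<open>t\<close> is chosen measurably among the
  zeros of the distance between \<open>F (w t) u\<close> and the velocity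
  \<open>d t\<close>.\<close>

lemma measurable_control_exists:
  assumes \<tau>: "0 < \<tau>" and w: "primitive \<tau> w d"
    and D: "\<And>t. 0 \<le> t \<Longrightarrow> t < \<tau> \<Longrightarrow> w t \<in> D"
    and vel: "AE t in lebesgue_on {0..\<tau>}. t < \<tau> \<longrightarrow> d t \<in> F (w t) ` U"
  shows "\<exists>u\<in>measurable_controls \<tau> U. ae_solution \<tau> (\<lambda>t w. F w (u t)) w"
proof -
  obtain K where lip: "K-lipschitz_on {0..\<tau>} w" using primitive_lipschitz[OF w] by blast
  \<comment> \<open>The end time is excluded since \<open>w \<tau>\<close> is not known to lie in
    \<open>D\<close>.\<close>
  define A where "A = {t \<in> {0..\<tau>}. t < \<tau> \<and> d t \<in> F (w t) ` U}"
  have "negligible ({0..\<tau>} - A)"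
  proof (rule negligible_subset)
    show "negligible ({\<tau>} \<union> {t \<in> {0..\<tau>}. \<not> (t < \<tau> \<longrightarrow> d t \<in> F (w t) ` U)})"
      using vel unfolding AE_lebesgue_on_interval_iff by simp
  qed (auto simp: A_def)
  then have "{0..\<tau>} - A \<in> sets lebesgue" by (rule negligible_imp_sets)
  then have "{0..\<tau>} - ({0..\<tau>} - A) \<in> sets lebesgue" by (rule sets.Diff[rotated]) simp
  moreover have A_sub: "A \<subseteq> {0..\<tau>}" unfolding A_def by (rule Collect_restrict)
  ultimately have A: "A \<in> sets lebesgue" by (simp only: double_diff[OF _ order_refl])
  \<comment> \<open>Off the set \<open>A\<close>, which has full measure, every control counts as a
    zero. So zeros exist at all times, and \<open>F\<close> is never evaluated outside
    \<open>D\<close>.\<close>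
  define \<Phi> where "\<Phi> t u = (if t \<in> A then dist (F (w t) u) (d t) else 0)" for t u
  obtain u where u: "u \<in> borel_measurable (lebesgue_on {0..\<tau>})"
    "\<And>t. t \<in> space (lebesgue_on {0..\<tau>}) \<Longrightarrow> u t \<in> U \<and> \<Phi> t (u t) = 0"
  proof (rule measurable_zero_selection[OF compact_U, where M = "lebesgue_on {0..\<tau>}" and \<Phi> = \<Phi>],
      unfold caratheodory_zeros_def, intro conjI ballI)
    show "continuous_on U (\<Phi> t)" for t
      unfolding \<Phi>_def using D
      by (cases "t \<in> A") (auto simp: A_def intro!: continuous_intros continuous_on_control)
    show "0 \<le> \<Phi> t u" for t u by (simp add: \<Phi>_def)
    show "\<exists>u\<in>U. \<Phi> t u = 0" for t
    proof (cases "t \<in> A")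
      case True
      then obtain u where "u \<in> U" "d t = F (w t) u" by (auto simp: A_def)
      then show ?thesis by (intro bexI[of _ u]) (simp_all add: \<Phi>_def)
    next
      case False
      then show ?thesis using U_ne by (auto simp: \<Phi>_def)
    qed
    fix u assume u: "u \<in> U"
    have "continuous_on A (\<lambda>t. (\<lambda>(w, u). F w u) (w t, u))"
      by (rule continuous_on_compose2[OF cont])
        (use u D A_sub lipschitz_on_continuous_on[OF lip] in
          \<open>auto simp: A_def intro!: continuous_intros intro: continuous_on_subset\<close>)
    then have "(\<lambda>t. F (w t) u) \<in> borel_measurable (lebesgue_on A)"
      using A by (intro continuous_imp_measurable_on_sets_lebesgue) auto
    moreover have "d \<in> borel_measurable (lebesgue_on A)"
      using w by (intro measurable_restrict_space1 measurable_completion) (simp add: primitive_def)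
    ultimately have "(\<lambda>t. dist (F (w t) u) (d t)) \<in> borel_measurable (lebesgue_on A)"
      by (rule borel_measurable_dist)
    then have "(\<lambda>t. if t \<in> A then dist (F (w t) u) (d t) else 0) \<in> borel_measurable lebesgue"
      by (rule borel_measurable_if[OF A, THEN iffD2])
    then show "(\<lambda>t. \<Phi> t u) \<in> borel_measurable (lebesgue_on {0..\<tau>})"
      unfolding \<Phi>_def by (rule measurable_restrict_space1)
  qed blast
  have "u \<in> measurable_controls \<tau> U" using u by (auto simp: measurable_controls_def)
  moreover have "ae_solution \<tau> (\<lambda>t w. F w (u t)) w"
    unfolding ae_solution_def
  proof
    show "abs_continuous_on_interval w 0 \<tau>" by (rule lipschitz_imp_abs_continuous[OF lip])
    have "AE t in lebesgue_on {0..\<tau>}. t \<in> A"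
      unfolding AE_lebesgue_on_interval_iff using \<open>negligible ({0..\<tau>} - A)\<close> by (simp add: set_diff_eq)
    with primitive_has_derivative[OF less_imp_le[OF \<tau>] w]
    show "AE t in lebesgue_on {0..\<tau>}. (w has_vector_derivative F (w t) (u t)) (at t within {0..\<tau>})"
    proof eventually_elim
      case (elim t)
      then have "F (w t) (u t) = d t" using u(2)[of t] A_sub by (auto simp: \<Phi>_def)
      then show ?case using elim by simp
    qed
  qed
  ultimately show ?thesis by blast
qed

text \<open>There is a circle to break: a control can be selected only while \<open>w\<close> is in
  \<open>D\<close>, and \<open>w\<close> is known to stay in \<open>D\<close> only if it has a
  control. Up to the first exit time \<open>\<tau>\<close> the limit is in \<open>D\<close>, so a
  control exists on \<open>[0, \<tau>]\<close>, and \<open>inv\<close> then puts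
  \<open>w \<tau>\<close> in \<open>D\<close>, a contradiction.\<close>

theorem trajectory_limit:
  assumes T: "0 < T" and W: "\<And>k. primitive T (W k) (d k)"
    and lip: "K-lipschitz_on {0..T} w"
    and W_lim: "uniform_limit {0..T} W w sequentially" and Q_lim: "uniform_limit {0..T} Q w sequentially"
    and vel: "\<And>k. AE s in lebesgue_on {0..T}. Q k s \<in> D \<longrightarrow> d k s \<in> F (Q k s) ` U"
    and init: "w 0 \<in> D"
    and inv: "\<And>\<tau> u. 0 < \<tau> \<Longrightarrow> \<tau> \<le> T \<Longrightarrow> u \<in> measurable_controls \<tau> U \<Longrightarrow>
      ae_solution \<tau> (\<lambda>t w. F w (u t)) w \<Longrightarrow> (\<forall>t\<in>{0..<\<tau>}. w t \<in> D) \<Longrightarrow> w \<tau> \<in> D"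
  shows "\<exists>u\<in>measurable_controls T U. ae_solution T (\<lambda>t w. F w (u t)) w \<and> (\<forall>t\<in>{0..T}. w t \<in> D)"
proof -
  have cw: "continuous_on {0..T} w" using lip by (rule lipschitz_on_continuous_on)
  obtain dw where w: "primitive T w dw"
    using lipschitz_imp_primitive[OF less_imp_le[OF T] lip] by blast
  have adm: "AE t in lebesgue_on {0..T}. w t \<in> D \<longrightarrow> dw t \<in> F (w t) ` U"
  proof -
    note AE_in_interval[of 0 T]
    with primitive_has_derivative[OF less_imp_le[OF T] w] show ?thesis
    proof eventually_elim
      case (elim t)
      then show ?case using limit_velocity_admissible[OF T W W_lim Q_lim cw vel] by blast
    qed
  qed
  have ctrl: "\<exists>u\<in>measurable_controls \<tau> U. ae_solution \<tau> (\<lambda>t w. F w (u t)) w"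
    if \<tau>: "0 < \<tau>" "\<tau> \<le> T" and D: "\<forall>t\<in>{0..<\<tau>}. w t \<in> D" for \<tau>
  proof (rule measurable_control_exists[OF \<tau>(1) primitive_mono[OF w \<tau>(2)]])
    show "w t \<in> D" if "0 \<le> t" "t < \<tau>" for t using D that by simp
    have "negligible {t \<in> {0..\<tau>}. \<not> (t < \<tau> \<longrightarrow> dw t \<in> F (w t) ` U)}"
    proof (rule negligible_subset)
      show "negligible {t \<in> {0..T}. \<not> (w t \<in> D \<longrightarrow> dw t \<in> F (w t) ` U)}"
        using adm unfolding AE_lebesgue_on_interval_iff .
    qed (use D \<tau> in auto)
    then show "AE t in lebesgue_on {0..\<tau>}. t < \<tau> \<longrightarrow> dw t \<in> F (w t) ` U"
      unfolding AE_lebesgue_on_interval_iff .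
  qed
  have stay: "\<forall>t\<in>{0..T}. w t \<in> D"
  proof (rule ccontr)
    define S where "S = {0..T} \<inter> w -` (- D)"
    assume "\<not> ?thesis"
    then have ne: "S \<noteq> {}" by (auto simp: S_def)
    have "closed S" unfolding S_def
      using cw open_D by (intro continuous_closed_preimage) (auto simp: closed_Compl)
    moreover have bdd: "bdd_below S" by (auto simp: S_def bdd_below_def)
    ultimately have Inf: "Inf S \<in> S" using closed_contains_Inf[OF ne] by blast
    define \<tau> where "\<tau> = Inf S"
    have \<tau>: "0 \<le> \<tau>" "\<tau> \<le> T" "w \<tau> \<notin> D" using Inf by (auto simp: \<tau>_def S_def)
    moreover have "\<tau> \<noteq> 0" using init \<tau>(3) by auto
    ultimately have \<tau>0: "0 < \<tau>" by simp
    have D: "\<forall>t\<in>{0..<\<tau>}. w t \<in> D"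
    proof (rule ccontr)
      assume "\<not> ?thesis"
      then obtain t where t: "0 \<le> t" "t < \<tau>" "w t \<notin> D" by auto
      then have "t \<in> S" using \<tau> by (simp add: S_def)
      then show False using cInf_lower[OF _ bdd] t(2) by (force simp: \<tau>_def)
    qed
    from ctrl[OF \<tau>0 \<tau>(2) D] inv[OF \<tau>0 \<tau>(2) _ _ D] \<tau>(3) show False by blast
  qed
  then have "\<forall>t\<in>{0..<T}. w t \<in> D" by simp
  from ctrl[OF T order_refl this] stay show ?thesis by blast
qed

end

subsection \<open>Weak convergence of derivatives\<close>

text \<open>Pairings with \<open>q k\<close> are controlled by \<open>K\<close> times the L1 norm of
  the test function, uniformly in \<open>k\<close>, so the good test functions are closed under
  dominated limits. They include indicators of half-lines, whose pairings are increments of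
  \<open>V k\<close>. A Dynkin argument yields all Borel sets, and approximation by simple functions
  all integrable functions.\<close>

lemma bounded_derivatives_test_integrable:
  fixes q :: "nat \<Rightarrow> real \<Rightarrow> real"
  assumes T: "0 < T" and V: "\<And>k. primitive T (V k) (q k)"
    and bd: "\<And>k. AE t in lebesgue_on {0..T}. \<bar>q k t\<bar> \<le> K"
    and lim: "\<And>t. t \<in> {0..T} \<Longrightarrow> (\<lambda>k. V k t) \<longlonglongrightarrow> 0"
    and \<psi>: "integrable (lebesgue_on {0..T}) \<psi>"
  shows "(\<lambda>k. \<integral>t. q k t * \<psi> t \<partial>lebesgue_on {0..T}) \<longlonglongrightarrow> 0"
proof -
  define M where "M = lebesgue_on {0..T}"
  have space_M: "space M = {0..T}" by (simp add: M_def)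
  interpret finite_measure M unfolding M_def by (rule finite_measure_lebesgue_on) simp
  have qm[measurable]: "q k \<in> borel_measurable M" for k
    unfolding M_def using V[of k]
    by (intro measurable_restrict_space1 measurable_completion) (simp add: primitive_def)
  have qh: "integrable M (\<lambda>t. q k t * h t)" if h: "integrable M h" for k h
  proof (rule Bochner_Integration.integrable_bound)
    show "integrable M (\<lambda>t. K * h t)" using h by simp
    show "(\<lambda>t. q k t * h t) \<in> borel_measurable M" using h by measurable
    show "AE t in M. norm (q k t * h t) \<le> norm (K * h t)"
      using bd[of k] unfolding M_def
      by eventually_elim (auto simp: abs_mult intro!: mult_right_mono)
  qed
  define P where "P f \<longleftrightarrow> (\<lambda>k. \<integral>t. q k t * f t \<partial>M) \<longlonglongrightarrow> 0" for f
  have P_add: "P (\<lambda>t. f t + g t)" if "integrable M f" "integrable M g" "P f" "P g" for f g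
  proof -
    have "(\<integral>t. q k t * (f t + g t) \<partial>M) = (\<integral>t. q k t * f t \<partial>M) + (\<integral>t. q k t * g t \<partial>M)" for k
      using qh that by (simp add: distrib_left)
    then show ?thesis using tendsto_add[OF that(3,4)[unfolded P_def]] by (simp add: P_def)
  qed
  have P_scale: "P (\<lambda>t. c * f t)" if "P f" for f c
  proof -
    have "(\<integral>t. q k t * (c * f t) \<partial>M) = c * (\<integral>t. q k t * f t \<partial>M)" for k
      by (simp add: mult.left_commute[of _ c])
    then show ?thesis using tendsto_mult_right_zero[OF that[unfolded P_def]] by (simp add: P_def)
  qed
  \<comment> \<open>The index \<open>i\<close> is fixed first, by L1 convergence and uniformly in
    \<open>k\<close>; only then is \<open>k\<close> taken large for this \<open>i\<close>.\<close>
  have P_lim: "P f" if g: "integrable M g" and s[measurable]: "\<And>i. s i \<in> borel_measurable M"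
    and f[measurable]: "f \<in> borel_measurable M"
    and sg: "\<And>i t. t \<in> space M \<Longrightarrow> \<bar>s i t\<bar> \<le> g t"
    and sf: "\<And>t. t \<in> space M \<Longrightarrow> (\<lambda>i. s i t) \<longlonglongrightarrow> f t" and Ps: "\<And>i. P (s i)" for f g and s :: "nat \<Rightarrow> real \<Rightarrow> real"
    unfolding P_def
  proof (rule LIMSEQ_I)
    fix \<epsilon> :: real assume \<epsilon>: "0 < \<epsilon>"
    have fg: "\<bar>f t\<bar> \<le> g t" if t: "t \<in> space M" for t
    proof (rule tendsto_upperbound)
      show "(\<lambda>i. \<bar>s i t\<bar>) \<longlonglongrightarrow> \<bar>f t\<bar>" using sf[OF t] by (rule tendsto_rabs)
    qed (use sg t in auto)
    have sint: "integrable M (s i)" for i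
    proof (rule Bochner_Integration.integrable_bound[OF g])
      show "AE t in M. norm (s i t) \<le> norm (g t)"
      proof (rule AE_I2)
        fix t assume "t \<in> space M"
        then show "norm (s i t) \<le> norm (g t)" using sg[of t i] by simp
      qed
    qed measurable
    have fint: "integrable M f"
    proof (rule Bochner_Integration.integrable_bound[OF g])
      show "AE t in M. norm (f t) \<le> norm (g t)"
      proof (rule AE_I2)
        fix t assume "t \<in> space M"
        then show "norm (f t) \<le> norm (g t)" using fg[of t] by simp
      qed
    qed measurable
    have "(\<lambda>i. \<integral>t. \<bar>s i t - f t\<bar> \<partial>M) \<longlonglongrightarrow> (\<integral>t. 0 \<partial>M)"
    proof (rule integral_dominated_convergence[where w = "\<lambda>t. 2 * g t"])
      show "integrable M (\<lambda>t. 2 * g t)" using g by simp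
      show "AE t in M. (\<lambda>i. \<bar>s i t - f t\<bar>) \<longlonglongrightarrow> 0"
        using sf by (intro AE_I2 tendsto_rabs_zero) (simp add: LIM_zero)
      show "AE t in M. norm \<bar>s i t - f t\<bar> \<le> 2 * g t" for i
      proof (rule AE_I2)
        fix t assume "t \<in> space M"
        then show "norm \<bar>s i t - f t\<bar> \<le> 2 * g t" using sg[of t i] fg[of t] by simp
      qed
    qed measurable
    then have "(\<lambda>i. K * (\<integral>t. \<bar>s i t - f t\<bar> \<partial>M)) \<longlonglongrightarrow> 0"
      by (simp add: tendsto_mult_right_zero)
    then have "\<forall>\<^sub>F i in sequentially. K * (\<integral>t. \<bar>s i t - f t\<bar> \<partial>M) < \<epsilon> / 2"
      by (rule order_tendstoD) (use \<epsilon> in simp)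
    from eventually_happens'[OF sequentially_bot this]
    obtain i where i: "K * (\<integral>t. \<bar>s i t - f t\<bar> \<partial>M) < \<epsilon> / 2" by blast
    obtain N where N: "\<And>k. N \<le> k \<Longrightarrow> norm ((\<integral>t. q k t * s i t \<partial>M) - 0) < \<epsilon> / 2"
      using LIMSEQ_D[OF Ps[of i, unfolded P_def], of "\<epsilon> / 2"] \<epsilon> by auto
    have "norm ((\<integral>t. q k t * f t \<partial>M) - 0) < \<epsilon>" if k: "N \<le> k" for k
    proof -
      have d: "integrable M (\<lambda>t. f t - s i t)" using fint sint by simp
      have "(\<integral>t. q k t * f t \<partial>M) = (\<integral>t. q k t * s i t \<partial>M) + (\<integral>t. q k t * (f t - s i t) \<partial>M)"
        using qh[OF sint] qh[OF d] by (subst Bochner_Integration.integral_add[symmetric]) (auto simp: algebra_simps)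
      moreover have "\<bar>\<integral>t. q k t * (f t - s i t) \<partial>M\<bar> \<le> (\<integral>t. K * \<bar>s i t - f t\<bar> \<partial>M)"
      proof (rule order_trans[OF integral_abs_bound integral_mono_AE])
        show "integrable M (\<lambda>t. \<bar>q k t * (f t - s i t)\<bar>)" using qh[OF d] by simp
        show "integrable M (\<lambda>t. K * \<bar>s i t - f t\<bar>)" using fint sint by simp
        show "AE t in M. \<bar>q k t * (f t - s i t)\<bar> \<le> K * \<bar>s i t - f t\<bar>"
          using bd[of k] unfolding M_def
          by eventually_elim (auto simp: abs_mult abs_minus_commute intro!: mult_right_mono)
      qed
      ultimately show ?thesis using N[OF k] i by simp
    qed
    then show "\<exists>no. \<forall>k\<ge>no. norm ((\<integral>t. q k t * f t \<partial>M) - 0) < \<epsilon>" by blast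
  qed
  have ind: "integrable M (indicat_real A)" if "A \<in> sets borel" for A
  proof -
    have "A \<inter> {0..T} \<in> sets M" using that unfolding M_def
      by (auto simp: sets_restrict_space intro!: image_eqI[of _ _ A])
    then show ?thesis by (simp add: integrable_indicator_iff space_M emeasure_eq_measure)
  qed
  have im: "indicat_real A \<in> borel_measurable M" if "A \<in> sets borel" for A
    using ind[OF that] by measurable
  have P_atMost: "P (indicat_real {..t})" for t
  proof (cases "0 \<le> t")
    case True
    define r where "r = min t T"
    have r: "0 \<le> r" "r \<le> T" using True T by (auto simp: r_def)
    have "(\<integral>s. q k s * indicat_real {..t} s \<partial>M) = V k r - V k 0" for k
    proof -
      have "(\<integral>s. q k s * indicat_real {..t} s \<partial>M) = integral {0..T} (\<lambda>s. q k s * indicat_real {..t} s)"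
        unfolding M_def by (rule lebesgue_integral_eq_integral) (use qh[OF ind, of "{..t}" k] in \<open>auto simp: M_def\<close>)
      also have "((\<lambda>s. if s \<in> {0..r} then q k s else 0) has_integral V k r - V k 0) {0..T}"
        using V[of k] r by (subst has_integral_restrict) (auto simp: primitive_def)
      then have "((\<lambda>s. q k s * indicat_real {..t} s) has_integral V k r - V k 0) {0..T}"
        by (rule has_integral_eq[rotated]) (auto simp: r_def)
      then have "integral {0..T} (\<lambda>s. q k s * indicat_real {..t} s) = V k r - V k 0"
        by (rule integral_unique)
      finally show ?thesis .
    qed
    moreover have "(\<lambda>k. V k r - V k 0) \<longlonglongrightarrow> 0 - 0"
      using r T by (intro tendsto_diff lim) auto
    ultimately show ?thesis by (simp add: P_def)
  next
    case False
    have "(\<integral>s. q k s * indicat_real {..t} s \<partial>M) = (\<integral>s. 0 \<partial>M)" for k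
      using False by (intro Bochner_Integration.integral_cong) (auto simp: space_M)
    then show ?thesis by (simp add: P_def)
  qed
  have P_cong: "P f" if "P g" "\<And>t. t \<in> space M \<Longrightarrow> f t = g t" for f g
  proof -
    have "(\<integral>t. q k t * f t \<partial>M) = (\<integral>t. q k t * g t \<partial>M)" for k
      using that(2) by (intro Bochner_Integration.integral_cong) auto
    then show ?thesis using that(1) by (simp add: P_def)
  qed
  have sig: "sets borel = sigma_sets UNIV (range (\<lambda>a::real. {..a}))"
    by (subst borel_eq_atMost) (rule sets_measure_of, simp)
  have stable: "Int_stable (range (\<lambda>a::real. {..a}))" by (auto simp: Int_stable_def)
  have P_ind: "P (indicat_real A)" if "A \<in> sets borel" for A :: "real set"
  proof -
    have "range (\<lambda>a::real. {..a}) \<subseteq> Pow UNIV" by simp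
    from stable this that[unfolded sig] show ?thesis
    proof (induction A rule: sigma_sets_induct_disjoint)
      case (basic A) then show ?case using P_atMost by auto
    next
      case empty show ?case by (simp add: P_def)
    next
      case (compl A)
      then have A: "A \<in> sets borel" by (simp add: sig)
      have "P (\<lambda>t. indicat_real {..T} t + (-1) * indicat_real A t)"
        using A compl by (intro P_add P_atMost P_scale ind integrable_mult_right) auto
      then show ?case by (rule P_cong) (auto simp: space_M indicator_def)
    next
      case (union A)
      then have A: "A i \<in> sets borel" for i by (auto simp: sig)
      show ?case
      proof (rule P_lim[where g = "\<lambda>_. 1" and s = "\<lambda>n t. \<Sum>i<n. indicat_real (A i) t"])
        have eq: "(\<Sum>i<n. indicat_real (A i) t) = indicat_real (\<Union>i<n. A i) t" for n t
          using union(1) by (subst indicator_UN_disjoint) (auto simp: disjoint_family_on_def)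
        show "\<bar>\<Sum>i<n. indicat_real (A i) t\<bar> \<le> 1" for n t
          unfolding eq by (simp add: indicator_def)
        show "(\<lambda>n. \<Sum>i<n. indicat_real (A i) t) \<longlonglongrightarrow> indicat_real (\<Union>i. A i) t" for t
          unfolding eq by (rule LIMSEQ_indicator_UN)
        show "(\<lambda>t. \<Sum>i<n. indicat_real (A i) t) \<in> borel_measurable M" for n
          using im[OF A] by (intro borel_measurable_sum) auto
        show "indicat_real (\<Union>i. A i) \<in> borel_measurable M"
          using A by (intro im) auto
        show "P (\<lambda>t. \<Sum>i<n. indicat_real (A i) t)" for n
        proof (induction n)
          case 0 show ?case by (simp add: P_def)
        next
          case (Suc n)
          then have "P (\<lambda>t. (\<Sum>i<n. indicat_real (A i) t) + indicat_real (A n) t)"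
            using union ind[OF A] by (intro P_add) auto
          then show ?case by simp
        qed
      qed auto
    qed
  qed
  have "P \<psi>" using \<psi>[folded M_def]
  proof (induction \<psi> rule: integrable_induct)
    case (base A c)
    \<comment> \<open>Measurable sets of \<open>M\<close> are traces of Lebesgue sets, and each of
      these is a Borel set up to a null set, which the integrals ignore.\<close>
    then obtain A' where A': "A = A' \<inter> {0..T}" "A' \<in> sets lebesgue"
      by (auto simp: M_def sets_restrict_space)
    obtain B N where B: "B \<in> sets borel" "negligible N" "B \<union> N = A'"
      using sets_lebesgue_almost_borel[OF A'(2)] by blast
    have "AE t in M. t \<notin> N"
      unfolding M_def AE_lebesgue_on_interval_iff by (rule negligible_subset[OF B(2)]) auto
    with AE_space have ae: "AE t in M. indicat_real A t = indicat_real B t"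
      by eventually_elim (use A' B(3) in \<open>auto simp: space_M indicator_def\<close>)
    have [measurable]: "indicat_real A \<in> borel_measurable M" "indicat_real B \<in> borel_measurable M"
      using base(1) im[OF B(1)] by auto
    have "(\<integral>t. q k t * indicat_real A t \<partial>M) = (\<integral>t. q k t * indicat_real B t \<partial>M)" for k
    proof (rule integral_cong_AE)
      show "AE t in M. q k t * indicat_real A t = q k t * indicat_real B t"
        using ae by eventually_elim simp
    qed measurable
    then have "P (indicat_real A)" using P_ind[OF B(1)] by (simp add: P_def)
    from P_scale[OF this, of c] show ?case by (simp add: mult.commute)
  next
    case (add f g) then show ?case by (intro P_add) auto
  next
    case (lim f s)
    show ?case
    proof (rule P_lim[where g = "\<lambda>t. 2 * \<bar>f t\<bar>" and s = s])
      show "integrable M (\<lambda>t. 2 * \<bar>f t\<bar>)" using lim by simp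
    qed (use lim in auto)
  qed
  then show ?thesis by (simp add: P_def M_def)
qed

section \<open>Almost everywhere derivatives as elements of L2\<close>

lemma time_deriv_AE:
  fixes w :: "real \<Rightarrow> 'a::euclidean_space"
  assumes T: "0 < T" and w: "primitive T w d"
  shows "AE t in lebesgue_on {0..T}. time_deriv T w t = d t"
proof -
  note AE_in_interval[of 0 T]
  with primitive_has_derivative[OF less_imp_le[OF T] w] show ?thesis
  proof eventually_elim
    case (elim t)
    then show ?case unfolding time_deriv_def
      using vector_derivative_within_cbox[of 0 T t w "d t"] T by simp
  qed
qed

text \<open>Lebesgue measure is complete, so equality almost everywhere preserves measurability once
  both functions are extended by \<open>0\<close> to the line.\<close>

lemma borel_measurable_lebesgue_on_AE:
  fixes f g :: "real \<Rightarrow> 'a::euclidean_space"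
  assumes f: "f \<in> borel_measurable (lebesgue_on {a..b})" and ae: "AE t in lebesgue_on {a..b}. f t = g t"
  shows "g \<in> borel_measurable (lebesgue_on {a..b})"
proof -
  have "(\<lambda>t. if t \<in> {a..b} then g t else 0) \<in> borel_measurable lebesgue"
  proof (rule borel_measurable_AE)
    show "(\<lambda>t. if t \<in> {a..b} then f t else 0) \<in> borel_measurable lebesgue"
      by (rule borel_measurable_if[THEN iffD2, OF _ f]) simp
    show "AE t in lebesgue. (if t \<in> {a..b} then f t else 0) = (if t \<in> {a..b} then g t else 0)"
      using ae by (subst (asm) AE_restrict_space_iff) (auto elim!: eventually_mono)
  qed
  then show ?thesis by (rule borel_measurable_if[THEN iffD1, rotated]) simp
qed

lemma primitive_measurable:
  "primitive T w d \<Longrightarrow> d \<in> borel_measurable (lebesgue_on S)"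
  by (intro measurable_restrict_space1 measurable_completion) (simp add: primitive_def)

lemma time_deriv_L2:
  fixes w :: "real \<Rightarrow> 'a::euclidean_space"
  assumes T: "0 < T" and w: "primitive T w d"
  shows "time_deriv T w \<in> L2_on T"
proof -
  interpret finite_measure "lebesgue_on {0..T}" by (rule finite_measure_lebesgue_on) simp
  have ae: "AE t in lebesgue_on {0..T}. d t = time_deriv T w t"
    using time_deriv_AE[OF T w] by eventually_elim simp
  have m: "time_deriv T w \<in> borel_measurable (lebesgue_on {0..T})"
    by (rule borel_measurable_lebesgue_on_AE[OF primitive_measurable[OF w] ae])
  obtain B where B: "\<And>t. norm (d t) \<le> B" using w by (auto simp: primitive_def bounded_iff)
  have "integrable (lebesgue_on {0..T}) (\<lambda>t. (norm (time_deriv T w t))\<^sup>2)"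
  proof (rule integrable_const_bound)
    show "AE t in lebesgue_on {0..T}. norm ((norm (time_deriv T w t))\<^sup>2) \<le> B\<^sup>2"
      using ae by eventually_elim (metis B norm_ge_zero norm_power power_mono real_norm_def abs_norm_cancel)
  qed (use m in measurable)
  with m show ?thesis by (simp add: L2_on_def)
qed

lemma L2_on_imp_integrable:
  assumes "\<phi> \<in> L2_on T"
  shows "integrable (lebesgue_on {0..T}) \<phi>"
proof -
  interpret finite_measure "lebesgue_on {0..T}" by (rule finite_measure_lebesgue_on) simp
  have m: "\<phi> \<in> borel_measurable (lebesgue_on {0..T})"
    and i: "integrable (lebesgue_on {0..T}) (\<lambda>t. (norm (\<phi> t))\<^sup>2)"
    using assms by (auto simp: L2_on_def)
  show ?thesis
  proof (rule Bochner_Integration.integrable_bound)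
    show "integrable (lebesgue_on {0..T}) (\<lambda>t. 1 + (norm (\<phi> t))\<^sup>2)" using i by simp
    have "norm x \<le> norm (1 + (norm x)\<^sup>2)" for x :: 'a
    proof -
      \<comment> \<open>With r the norm of \<open>x\<close>, expanding the square gives r <= 1 +
        r^2.\<close>
      have "0 \<le> (norm x - 1)\<^sup>2 + norm x" by simp
      then show ?thesis by (simp add: power2_eq_square algebra_simps)
    qed
    then show "AE t in lebesgue_on {0..T}. norm (\<phi> t) \<le> norm (1 + (norm (\<phi> t))\<^sup>2)" by (intro AE_I2)
  qed (rule m)
qed

text \<open>Each coordinate of \<open>W k - w\<close> tends to \<open>0\<close> and has uniformly
  bounded velocities, which is the situation of the scalar test lemma. Test functions in L2 are
  integrable because \<open>[0, T]\<close> has finite measure.\<close>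

lemma weakly_converges_time_deriv:
  fixes w :: "real \<Rightarrow> 'a::euclidean_space"
  assumes T: "0 < T" and W: "\<And>k. primitive T (W k) (d k)" and w: "primitive T w e"
    and bd: "\<And>k. AE t in lebesgue_on {0..T}. norm (d k t) \<le> K"
    and lim: "\<And>t. t \<in> {0..T} \<Longrightarrow> (\<lambda>k. W k t) \<longlonglongrightarrow> w t"
  shows "weakly_converges_L2 T (\<lambda>k. time_deriv T (W k)) (time_deriv T w)"
  unfolding weakly_converges_L2_def
proof (intro conjI allI ballI time_deriv_L2[OF T W] time_deriv_L2[OF T w])
  fix \<phi> :: "real \<Rightarrow> 'a" assume \<phi>: "\<phi> \<in> L2_on T"
  define M where "M = lebesgue_on {0..T}"
  have \<phi>i: "integrable M (\<lambda>t. \<phi> t \<bullet> i)" for i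
    using L2_on_imp_integrable[OF \<phi>] unfolding M_def by simp
  obtain B where B: "\<And>t. norm (e t) \<le> B" using w by (auto simp: primitive_def bounded_iff)
  have bdi: "AE t in lebesgue_on {0..T}. \<bar>(d k t - e t) \<bullet> i\<bar> \<le> K + B" if i: "i \<in> Basis" for i k
    using bd[of k]
  proof eventually_elim
    case (elim t)
    have "\<bar>(d k t - e t) \<bullet> i\<bar> \<le> norm (d k t - e t)" using i by (rule Basis_le_norm)
    also have "\<dots> \<le> norm (d k t) + norm (e t)" by (rule norm_triangle_ineq4)
    finally show ?case using elim B[of t] by simp
  qed
  have comp: "(\<lambda>k. \<integral>t. ((d k t - e t) \<bullet> i) * (\<phi> t \<bullet> i) \<partial>M) \<longlonglongrightarrow> 0" if i: "i \<in> Basis" for i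
    unfolding M_def
  proof (rule bounded_derivatives_test_integrable[OF T, where V = "\<lambda>k t. (W k t - w t) \<bullet> i" and K = "K + B"])
    show "primitive T (\<lambda>t. (W k t - w t) \<bullet> i) (\<lambda>t. (d k t - e t) \<bullet> i)" for k
      by (rule primitive_linear[OF primitive_diff[OF W w] bounded_linear_inner_left])
    show "AE t in lebesgue_on {0..T}. \<bar>(d k t - e t) \<bullet> i\<bar> \<le> K + B" for k by (rule bdi[OF i])
    show "(\<lambda>k. (W k t - w t) \<bullet> i) \<longlonglongrightarrow> 0" if "t \<in> {0..T}" for t
      using tendsto_inner[OF LIM_zero[OF lim[OF that]] tendsto_const[of i]] by simp
    show "integrable (lebesgue_on {0..T}) (\<lambda>t. \<phi> t \<bullet> i)" using \<phi>i by (simp add: M_def)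
  qed
  have int: "integrable M (\<lambda>t. c t \<bullet> \<phi> t)" if c: "c \<in> borel_measurable M" "AE t in M. norm (c t) \<le> R" for c R
  proof (rule Bochner_Integration.integrable_bound)
    show "integrable M (\<lambda>t. R * norm (\<phi> t))" using L2_on_imp_integrable[OF \<phi>] by (simp add: M_def)
    show "(\<lambda>t. c t \<bullet> \<phi> t) \<in> borel_measurable M"
      using c(1) L2_on_imp_integrable[OF \<phi>] by (intro borel_measurable_inner) (auto simp: M_def)
    show "AE t in M. norm (c t \<bullet> \<phi> t) \<le> norm (R * norm (\<phi> t))"
      using c(2)
    proof eventually_elim
      case (elim t)
      have "norm (c t \<bullet> \<phi> t) \<le> norm (c t) * norm (\<phi> t)" using Cauchy_Schwarz_ineq2 by simp
      also have "\<dots> \<le> \<bar>R\<bar> * norm (\<phi> t)" using elim by (intro mult_right_mono) auto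
      finally show ?case by (simp add: abs_mult)
    qed
  qed
  have dk: "integrable M (\<lambda>t. d k t \<bullet> \<phi> t)" for k
    using int[OF _ bd[of k, folded M_def]] primitive_measurable[OF W] by (simp add: M_def)
  have ek: "integrable M (\<lambda>t. e t \<bullet> \<phi> t)"
    using int[of e B] B primitive_measurable[OF w] by (simp add: M_def)
  have compi: "integrable M (\<lambda>t. ((d k t - e t) \<bullet> i) * (\<phi> t \<bullet> i))" if i: "i \<in> Basis" for k i
  proof (rule Bochner_Integration.integrable_bound)
    show "integrable M (\<lambda>t. (K + B) * (\<phi> t \<bullet> i))" using \<phi>i by simp
    show "(\<lambda>t. ((d k t - e t) \<bullet> i) * (\<phi> t \<bullet> i)) \<in> borel_measurable M"
      using \<phi>i[of i] primitive_measurable[OF W] primitive_measurable[OF w]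
      unfolding M_def by measurable
    show "AE t in M. norm (((d k t - e t) \<bullet> i) * (\<phi> t \<bullet> i)) \<le> norm ((K + B) * (\<phi> t \<bullet> i))"
      using bdi[OF i, of k] unfolding M_def
      by eventually_elim (auto simp: abs_mult intro!: mult_right_mono)
  qed
  have "(\<integral>t. d k t \<bullet> \<phi> t \<partial>M) = (\<Sum>i\<in>Basis. \<integral>t. ((d k t - e t) \<bullet> i) * (\<phi> t \<bullet> i) \<partial>M) + (\<integral>t. e t \<bullet> \<phi> t \<partial>M)" for k
  proof -
    have "(\<integral>t. d k t \<bullet> \<phi> t \<partial>M) = (\<integral>t. (d k t - e t) \<bullet> \<phi> t + e t \<bullet> \<phi> t \<partial>M)"
      by (simp add: inner_diff_left)
    also have "\<dots> = (\<integral>t. (d k t - e t) \<bullet> \<phi> t \<partial>M) + (\<integral>t. e t \<bullet> \<phi> t \<partial>M)"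
      using dk ek by (intro Bochner_Integration.integral_add) (auto simp: inner_diff_left)
    also have "(\<integral>t. (d k t - e t) \<bullet> \<phi> t \<partial>M) = (\<integral>t. (\<Sum>i\<in>Basis. ((d k t - e t) \<bullet> i) * (\<phi> t \<bullet> i)) \<partial>M)"
      by (subst euclidean_inner) simp
    also have "\<dots> = (\<Sum>i\<in>Basis. \<integral>t. ((d k t - e t) \<bullet> i) * (\<phi> t \<bullet> i) \<partial>M)"
      by (rule Bochner_Integration.integral_sum) (rule compi)
    finally show ?thesis .
  qed
  moreover have "(\<lambda>k. (\<Sum>i\<in>Basis. \<integral>t. ((d k t - e t) \<bullet> i) * (\<phi> t \<bullet> i) \<partial>M) + (\<integral>t. e t \<bullet> \<phi> t \<partial>M))
      \<longlonglongrightarrow> (\<Sum>i\<in>(Basis :: 'a set). 0) + (\<integral>t. e t \<bullet> \<phi> t \<partial>M)"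
    by (intro tendsto_add tendsto_sum comp tendsto_const) auto
  ultimately have main: "(\<lambda>k. \<integral>t. d k t \<bullet> \<phi> t \<partial>M) \<longlonglongrightarrow> (\<integral>t. e t \<bullet> \<phi> t \<partial>M)" by simp
  have eq: "(\<integral>t. time_deriv T v t \<bullet> \<phi> t \<partial>M) = (\<integral>t. c t \<bullet> \<phi> t \<partial>M)" if v: "primitive T v c" for v c
  proof (rule integral_cong_AE)
    have "time_deriv T v \<in> borel_measurable M" using time_deriv_L2[OF T v] by (simp add: L2_on_def M_def)
    then show "(\<lambda>t. time_deriv T v t \<bullet> \<phi> t) \<in> borel_measurable M"
      using L2_on_imp_integrable[OF \<phi>] by (intro borel_measurable_inner) (auto simp: M_def)
    show "(\<lambda>t. c t \<bullet> \<phi> t) \<in> borel_measurable M"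
      using L2_on_imp_integrable[OF \<phi>] primitive_measurable[OF v]
      by (intro borel_measurable_inner) (auto simp: M_def)
    show "AE t in M. time_deriv T v t \<bullet> \<phi> t = c t \<bullet> \<phi> t"
      using time_deriv_AE[OF T v] unfolding M_def by eventually_elim simp
  qed
  show "(\<lambda>k. \<integral>t. time_deriv T (W k) t \<bullet> \<phi> t \<partial>lebesgue_on {0..T})
      \<longlonglongrightarrow> (\<integral>t. time_deriv T w t \<bullet> \<phi> t \<partial>lebesgue_on {0..T})"
    using main unfolding eq[OF W, unfolded M_def] eq[OF w, unfolded M_def] M_def .
qed

subsection \<open>Controlled systems\<close>

lemma abs_continuous_imp_continuous:
  assumes "abs_continuous_on_interval w a b"
  shows "continuous_on {a..b} w"
  unfolding continuous_on_iff
proof (intro ballI allI impI)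
  fix t \<epsilon> :: real assume t: "t \<in> {a..b}" and \<epsilon>: "0 < \<epsilon>"
  obtain \<delta> where \<delta>: "0 < \<delta>" and ac: "\<And>I :: (real \<times> real) set. finite I \<Longrightarrow>
      (\<forall>(s, t)\<in>I. a \<le> s \<and> s \<le> t \<and> t \<le> b) \<Longrightarrow>
      pairwise (\<lambda>(s, t) (s', t'). {s<..<t} \<inter> {s'<..<t'} = {}) I \<Longrightarrow>
      (\<Sum>(s, t)\<in>I. t - s) < \<delta> \<Longrightarrow> (\<Sum>(s, t)\<in>I. norm (w t - w s)) < \<epsilon>"
    using assms \<epsilon> unfolding abs_continuous_on_interval_def by meson
  have one: "norm (w v - w u) < \<epsilon>" if "a \<le> u" "u \<le> v" "v \<le> b" "v - u < \<delta>" for u v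
    using ac[of "{(u, v)}"] that by simp
  have "dist (w s) (w t) < \<epsilon>" if s: "s \<in> {a..b}" "dist s t < \<delta>" for s
  proof (cases "s \<le> t")
    case True then show ?thesis using one[of s t] s t by (simp add: dist_norm norm_minus_commute)
  next
    case False then show ?thesis using one[of t s] s t by (simp add: dist_norm)
  qed
  then show "\<exists>d>0. \<forall>s\<in>{a..b}. dist s t < d \<longrightarrow> dist (w s) (w t) < \<epsilon>" using \<delta> by blast
qed

lemma primitive_derivative_unique:
  fixes w :: "real \<Rightarrow> 'a::euclidean_space"
  assumes T: "0 < T" and w: "primitive T w d"
    and e: "AE t in lebesgue_on {0..T}. (w has_vector_derivative e t) (at t within {0..T})"
  shows "AE t in lebesgue_on {0..T}. d t = e t"
proof -
  note AE_in_interval[of 0 T]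
  with primitive_has_derivative[OF less_imp_le[OF T] w] e show ?thesis
  proof eventually_elim
    case (elim t)
    then show ?case
      using vector_derivative_within_cbox[of 0 T t w "d t"] vector_derivative_within_cbox[of 0 T t w "e t"] T by simp
  qed
qed

lemma primitive_linear_growth:
  fixes w :: "real \<Rightarrow> 'a::euclidean_space"
  assumes w: "primitive T w d" and C: "0 \<le> C"
    and growth: "AE t in lebesgue_on {0..T}. norm (d t) \<le> C * (1 + norm (w t))"
    and t: "0 \<le> t" "t \<le> T"
  shows "1 + norm (w t) \<le> (1 + norm (w 0)) * exp (C * t)"
proof -
  have cw: "continuous_on {0..T} w" by (rule primitive_continuous_on[OF w])
  have "1 + norm (w s) \<le> (1 + norm (w 0)) + C * integral {0..s} (\<lambda>r. 1 + norm (w r))"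
    if s: "0 \<le> s" "s \<le> T" for s
  proof -
    define d' where "d' r = (if norm (d r) \<le> C * (1 + norm (w r)) then d r else 0)" for r
    have "(d has_integral (w s - w 0)) {0..s}" using w s by (auto simp: primitive_def)
    then have d': "(d' has_integral (w s - w 0)) {0..s}"
    proof (rule has_integral_spike[rotated 2])
      show "negligible {t \<in> {0..T}. \<not> norm (d t) \<le> C * (1 + norm (w t))}"
        using growth unfolding AE_lebesgue_on_interval_iff .
    qed (use s in \<open>auto simp: d'_def\<close>)
    have i: "(\<lambda>r. 1 + norm (w r)) integrable_on {0..s}"
      using cw s by (intro integrable_continuous_interval continuous_intros) (auto intro: continuous_on_subset)
    have "norm (integral {0..s} d') \<le> integral {0..s} (\<lambda>r. C * (1 + norm (w r)))"
      using d' i C by (intro integral_norm_bound_integral integrable_on_mult_right) (auto simp: d'_def)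
    then have "norm (w s - w 0) \<le> C * integral {0..s} (\<lambda>r. 1 + norm (w r))"
      using integral_unique[OF d'] by simp
    then show ?thesis using norm_triangle_ineq2[of "w s" "w 0"] by linarith
  qed
  then show ?thesis
    using cw by (intro gronwall[of T "\<lambda>r. 1 + norm (w r)", OF _ C _ t] continuous_intros) auto
qed

section \<open>The given system: a priori bounds and existence of trajectories\<close>

locale controlled_system =
  fixes f :: "'x::euclidean_space \<Rightarrow> real \<Rightarrow> 'c::euclidean_space \<Rightarrow> 'x"
    and g :: "'x \<Rightarrow> real \<Rightarrow> 'c \<Rightarrow> real"
    and D :: "('x \<times> real) set" and U :: "'c set" and C T :: real and x0 :: 'x and y0 :: real
  assumes open_D: "open D" and U_ne: "U \<noteq> {}" and compact_U: "compact U"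
    and invariant: "invariant_domain f g D U"
    and cont_f: "continuous_on (D \<times> U) (\<lambda>((x, y), u). f x y u)"
    and cont_g: "continuous_on (D \<times> U) (\<lambda>((x, y), u). g x y u)"
    and C_pos: "0 < C"
    and growth: "\<And>x y u. (x, y) \<in> D \<Longrightarrow> u \<in> U \<Longrightarrow> norm (f x y u) + \<bar>g x y u\<bar> \<le> C * (1 + norm x + \<bar>y\<bar>)"
    and convex_velocities: "\<And>x y. (x, y) \<in> D \<Longrightarrow> convex (\<Union>u\<in>U. {(f x y u, g x y u)})"
    and T_pos: "0 < T" and init: "(x0, y0) \<in> D"
begin

definition F :: "'x \<times> real \<Rightarrow> 'c \<Rightarrow> 'x \<times> real"
  where "F w u = (f (fst w) (snd w) u, g (fst w) (snd w) u)"

lemma T_nonneg: "0 \<le> T"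
  using T_pos by simp

lemma velocity_eq_F: "(\<lambda>t (x, y). (f x y (u t), g x y (u t))) = (\<lambda>t w. F w (u t))"
  by (auto simp: fun_eq_iff F_def)

sublocale compact_convex_control F D U
proof
  show "continuous_on (D \<times> U) (\<lambda>(w, u). F w u)"
    using continuous_on_Pair[OF cont_f cont_g] by (simp add: F_def case_prod_unfold)
  show "convex (F w ` U)" if "w \<in> D" for w
    using convex_velocities[of "fst w" "snd w"] that by (simp add: F_def UNION_singleton_eq_range)
qed (fact open_D compact_U U_ne)+

lemma norm_F_le:
  assumes "w \<in> D" "u \<in> U"
  shows "norm (F w u) \<le> 2 * C * (1 + norm w)"
proof -
  have "norm (F w u) \<le> norm (f (fst w) (snd w) u) + \<bar>g (fst w) (snd w) u\<bar>"
    using norm_Pair_le[of "f (fst w) (snd w) u" "g (fst w) (snd w) u"] by (simp add: F_def)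
  also have "\<dots> \<le> C * (1 + norm (fst w) + \<bar>snd w\<bar>)" using assms by (intro growth) auto
  \<comment> \<open>Both components are bounded by the norm of the pair; this is the origin of the
    factor \<open>2\<close>.\<close>
  also have "\<dots> \<le> C * (1 + norm w + norm w)"
    using norm_fst_le[of "fst w" "snd w"] norm_snd_le[of "snd w" "fst w"] C_pos by (intro mult_left_mono) auto
  also have "\<dots> \<le> 2 * C * (1 + norm w)" using C_pos by (simp add: algebra_simps)
  finally show ?thesis .
qed

text \<open>A bootstrap, since the growth condition bounds the speed only in terms of the solution.
  Continuity on \<open>[0, \<tau>]\<close> gives a crude bound \<open>B\<close> that depends on
  \<open>w\<close> but makes it Lipschitz and hence a primitive. Only then does Gronwall apply and
  give a bound in terms of \<open>w 0\<close> and the time.\<close>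

lemma solution_primitive:
  assumes \<tau>: "0 < \<tau>" and u: "u \<in> measurable_controls \<tau> U" and sol: "ae_solution \<tau> (\<lambda>t w. F w (u t)) w"
    and D: "\<forall>t\<in>{0..<\<tau>}. w t \<in> D"
  obtains d where "primitive \<tau> w d" "AE t in lebesgue_on {0..\<tau>}. d t \<in> F (w t) ` U \<and> norm (d t) \<le> 2 * C * (1 + norm (w t))"
    "\<And>t. 0 \<le> t \<Longrightarrow> t \<le> \<tau> \<Longrightarrow> 1 + norm (w t) \<le> (1 + norm (w 0)) * exp (2 * C * t)"
proof -
  from sol have ac: "abs_continuous_on_interval w 0 \<tau>"
    and der: "AE t in lebesgue_on {0..\<tau>}. (w has_vector_derivative F (w t) (u t)) (at t within {0..\<tau>})"
    by (auto simp: ae_solution_def)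
  have cw: "continuous_on {0..\<tau>} w" by (rule abs_continuous_imp_continuous[OF ac])
  obtain B where B: "\<And>t. t \<in> {0..\<tau>} \<Longrightarrow> norm (w t) \<le> B"
    using compact_imp_bounded[OF compact_continuous_image[OF cw compact_Icc]] unfolding bounded_iff by blast
  have "0 \<le> B" by (rule order_trans[OF norm_ge_zero B[of 0]]) (use \<tau> in simp)
  \<comment> \<open>Membership in \<open>D\<close> is given on \<open>[0, \<tau>)\<close> only, so
    the point \<open>\<tau>\<close> is treated as an exceptional null set.\<close>
  have F_le: "AE t in lebesgue_on {0..\<tau>}. t \<in> {0..\<tau>} \<and> u t \<in> U \<and> norm (F (w t) (u t)) \<le> 2 * C * (1 + norm (w t))"
    unfolding AE_lebesgue_on_interval_iff
  proof (rule negligible_subset[of "{\<tau>}"])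
    show "{t \<in> {0..\<tau>}. \<not> (t \<in> {0..\<tau>} \<and> u t \<in> U \<and> norm (F (w t) (u t)) \<le> 2 * C * (1 + norm (w t)))} \<subseteq> {\<tau>}"
    proof (rule ccontr)
      assume "\<not> ?thesis"
      then obtain t where t: "t \<in> {0..\<tau>}" "t \<noteq> \<tau>"
        "\<not> (t \<in> {0..\<tau>} \<and> u t \<in> U \<and> norm (F (w t) (u t)) \<le> 2 * C * (1 + norm (w t)))" by blast
      then have "w t \<in> D" "u t \<in> U" using D u by (auto simp: measurable_controls_def)
      then show False using norm_F_le t by blast
    qed
  qed simp
  have "(2 * C * (1 + B))-lipschitz_on {0..\<tau>} w"
  proof (rule abs_continuous_imp_lipschitz[OF ac])
    show "0 \<le> 2 * C * (1 + B)" using C_pos \<open>0 \<le> B\<close> by simp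
    show "AE t in lebesgue_on {0..\<tau>}. \<exists>e. (w has_vector_derivative e) (at t within {0..\<tau>}) \<and> norm e \<le> 2 * C * (1 + B)"
      using der F_le
    proof eventually_elim
      case (elim t)
      then have "2 * C * (1 + norm (w t)) \<le> 2 * C * (1 + B)"
        using B C_pos by (intro mult_left_mono) auto
      then show ?case using elim by (intro exI[of _ "F (w t) (u t)"]) auto
    qed
  qed
  then obtain d where d: "primitive \<tau> w d"
    using lipschitz_imp_primitive[OF less_imp_le[OF \<tau>]] by blast
  have ae: "AE t in lebesgue_on {0..\<tau>}. d t \<in> F (w t) ` U \<and> norm (d t) \<le> 2 * C * (1 + norm (w t))"
    using primitive_derivative_unique[OF \<tau> d der] F_le by eventually_elim auto
  moreover have "1 + norm (w t) \<le> (1 + norm (w 0)) * exp (2 * C * t)" if "0 \<le> t" "t \<le> \<tau>" for t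
  proof (rule primitive_linear_growth[OF d _ _ that])
    show "AE t in lebesgue_on {0..\<tau>}. norm (d t) \<le> 2 * C * (1 + norm (w t))"
      using ae by eventually_elim simp
  qed (use C_pos in simp)
  ultimately show thesis using d that by blast
qed

text \<open>\<open>R\<close> is the Gronwall bound for \<open>1 + norm (w t)\<close> on
  \<open>[0, T]\<close>, common to all solutions from \<open>(x0, y0)\<close>, and \<open>K\<close>
  is the resulting bound for their speeds.\<close>

definition R :: real where "R = (1 + norm (x0, y0)) * exp (2 * C * T)"
definition K :: real where "K = 2 * C * R"

lemma R_ge_1: "1 \<le> R"
proof -
  have "1 * 1 \<le> (1 + norm (x0, y0)) * exp (2 * C * T)"
    using C_pos T_pos by (intro mult_mono) auto
  then show ?thesis by (simp add: R_def)
qed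

lemma K_nonneg: "0 \<le> K"
  using R_ge_1 C_pos by (simp add: K_def)

lemma solution_bound:
  assumes "0 < \<tau>" "\<tau> \<le> T" "u \<in> measurable_controls \<tau> U" "ae_solution \<tau> (\<lambda>t w. F w (u t)) w"
    "\<forall>t\<in>{0..<\<tau>}. w t \<in> D" "w 0 = (x0, y0)" "0 \<le> t" "t \<le> \<tau>"
  shows "1 + norm (w t) \<le> R"
proof -
  have "1 + norm (w t) \<le> (1 + norm (w 0)) * exp (2 * C * t)"
    by (rule solution_primitive[OF assms(1,3,4,5)]) (use assms(7,8) in blast)
  also have "\<dots> \<le> R"
    unfolding R_def assms(6) using C_pos assms by (intro mult_left_mono) auto
  finally show ?thesis .
qed

lemma solution_stays:
  assumes "0 < \<tau>" "u \<in> measurable_controls \<tau> U" "ae_solution \<tau> (\<lambda>t w. F w (u t)) w"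
    "\<forall>t\<in>{0..<\<tau>}. w t \<in> D"
  shows "w \<tau> \<in> D"
  using invariant[unfolded invariant_domain_def velocity_eq_F, rule_format, of \<tau> u "\<lambda>t. fst (w t)" "\<lambda>t. snd (w t)"] assms
  by simp

definition trajectory :: "(real \<Rightarrow> 'x \<times> real) \<Rightarrow> bool"
  where "trajectory w \<longleftrightarrow> (\<lambda>t. fst (w t), \<lambda>t. snd (w t)) \<in> trajectories f g D U T x0 y0"

lemma trajectory_iff:
  "trajectory w \<longleftrightarrow> (\<exists>u\<in>measurable_controls T U. ae_solution T (\<lambda>t w. F w (u t)) w \<and>
    (\<forall>t\<in>{0..T}. w t \<in> D) \<and> w 0 = (x0, y0))"
  by (simp add: trajectory_def trajectories_def velocity_eq_F prod_eq_iff)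

lemma trajectory_primitive:
  assumes "trajectory w"
  obtains d where "primitive T w d" "AE t in lebesgue_on {0..T}. d t \<in> F (w t) ` U"
    "AE t in lebesgue_on {0..T}. norm (d t) \<le> K" "K-lipschitz_on {0..T} w"
proof -
  obtain u where u: "u \<in> measurable_controls T U" "ae_solution T (\<lambda>t w. F w (u t)) w"
    and D: "\<forall>t\<in>{0..T}. w t \<in> D" and w0: "w 0 = (x0, y0)"
    using assms by (auto simp: trajectory_iff)
  then have D': "\<forall>t\<in>{0..<T}. w t \<in> D" by simp
  obtain d where d: "primitive T w d"
    and ae: "AE t in lebesgue_on {0..T}. d t \<in> F (w t) ` U \<and> norm (d t) \<le> 2 * C * (1 + norm (w t))"
    by (rule solution_primitive[OF T_pos u D'])
  note AE_in_interval[of 0 T]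
  with ae have K: "AE t in lebesgue_on {0..T}. norm (d t) \<le> K"
  proof eventually_elim
    case (elim t)
    then have "2 * C * (1 + norm (w t)) \<le> K"
      unfolding K_def using solution_bound[OF T_pos order_refl u D' w0] C_pos by (intro mult_left_mono) auto
    then show ?case using elim by simp
  qed
  moreover have "AE t in lebesgue_on {0..T}. d t \<in> F (w t) ` U" using ae by eventually_elim simp
  ultimately show thesis using d primitive_imp_lipschitz[OF K_nonneg d K] that by blast
qed

text \<open>Euler polygons with a constant control, for the field cut off to \<open>0\<close>
  outside \<open>D'\<close>. The cut-off jumps, but \<open>trajectory_limit\<close> asks only that
  the velocities be admissible while \<open>Q\<close> is in \<open>D'\<close>. The limit is a
  trajectory for some control, not necessarily for \<open>u0\<close>.\<close>

lemma trajectory_exists: "\<exists>w. trajectory w"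
proof -
  obtain u0 where u0: "u0 \<in> U" using U_ne by blast
  \<comment> \<open>Solutions satisfy \<open>1 + norm (w t) \<le> R\<close>, so they stay strictly
    inside this ball and could leave \<open>D'\<close> only by leaving \<open>D\<close>, which
    invariance forbids.\<close>
  define D' where "D' = D \<inter> ball 0 (R + 1)"
  have "compact_convex_control F D' U"
  proof
    show "open D'" using open_D by (auto simp: D'_def)
    show "continuous_on (D' \<times> U) (\<lambda>(w, u). F w u)"
      by (rule continuous_on_subset[OF cont]) (auto simp: D'_def)
  qed (use compact_U U_ne convex_F in \<open>auto simp: D'_def\<close>)
  then interpret D': compact_convex_control F D' U .
  define h where "h t p = (if p \<in> D' then F p u0 else 0)" for t :: real and p
  have hb: "norm (h t p) \<le> 2 * C * (R + 2)" for t p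
  proof (cases "p \<in> D'")
    case True
    then have "norm (F p u0) \<le> 2 * C * (1 + norm p)" using u0 by (intro norm_F_le) (auto simp: D'_def)
    also have "\<dots> \<le> 2 * C * (R + 2)" using True C_pos by (intro mult_left_mono) (auto simp: D'_def)
    finally show ?thesis using True by (simp add: h_def)
  next
    case False then show ?thesis using C_pos R_ge_1 by (simp add: h_def)
  qed
  obtain W Q d w where prim: "\<And>k. primitive T (W k) (d k)" and d: "\<And>k t. d k t = h t (Q k t)"
    and i: "\<And>k. W k 0 = (x0, y0)" "w 0 = (x0, y0)"
    and lipw: "(2 * C * (R + 2))-lipschitz_on {0..T} w"
    and ul: "uniform_limit {0..T} W w sequentially" "uniform_limit {0..T} Q w sequentially"
    by (rule euler_sequence[where f = h and ?w0.0 = "(x0, y0)" and T = T and K = "2 * C * (R + 2)"])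
      (use T_pos hb in \<open>auto simp: h_def\<close>)
  have w0D: "w 0 \<in> D'"
  proof -
    have "1 * (1 + norm (x0, y0)) \<le> exp (2 * C * T) * (1 + norm (x0, y0))"
      using C_pos T_pos by (intro mult_right_mono) auto
    then have "norm (x0, y0) < R + 1" by (simp add: R_def mult.commute)
    then show ?thesis using init i(2) by (simp add: D'_def)
  qed
  have inv: "w \<tau> \<in> D'" if "0 < \<tau>" "\<tau> \<le> T" "u \<in> measurable_controls \<tau> U"
      "ae_solution \<tau> (\<lambda>t w. F w (u t)) w" "\<forall>t\<in>{0..<\<tau>}. w t \<in> D'" for \<tau> u
  proof -
    have D: "\<forall>t\<in>{0..<\<tau>}. w t \<in> D" using that(5) by (simp add: D'_def)
    have "w \<tau> \<in> D" by (rule solution_stays[OF that(1,3,4) D])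
    moreover have "1 + norm (w \<tau>) \<le> R"
      using solution_bound[OF that(1-4) D i(2), of \<tau>] that(1) by simp
    ultimately show ?thesis by (simp add: D'_def)
  qed
  have vel: "AE s in lebesgue_on {0..T}. Q k s \<in> D' \<longrightarrow> d k s \<in> F (Q k s) ` U" for k
    using u0 by (intro AE_I2) (simp add: d h_def)
  have "\<exists>u\<in>measurable_controls T U. ae_solution T (\<lambda>t w. F w (u t)) w \<and> (\<forall>t\<in>{0..T}. w t \<in> D')"
    by (rule D'.trajectory_limit[OF T_pos prim lipw ul vel w0D inv])
  then have "trajectory w" using i(2) by (auto simp: trajectory_iff D'_def)
  then show ?thesis by blast
qed

text \<open>The velocities belong to the states themselves, so \<open>W\<close> plays the part of
  both approximating sequences of \<open>trajectory_limit\<close>.\<close>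

lemma trajectory_uniform_limit:
  assumes traj: "\<And>n. trajectory (W n)" and ul: "uniform_limit {0..T} W w sequentially"
    and lip: "L-lipschitz_on {0..T} w" and w0: "w 0 = (x0, y0)"
  shows "trajectory w"
proof -
  have "\<exists>d. primitive T (W n) d \<and> (AE t in lebesgue_on {0..T}. d t \<in> F (W n t) ` U)" for n
    by (rule trajectory_primitive[OF traj[of n]]) blast
  then have "\<forall>n. \<exists>d. primitive T (W n) d \<and> (AE t in lebesgue_on {0..T}. d t \<in> F (W n t) ` U)" ..
  from choice[OF this] obtain d where "\<forall>n. primitive T (W n) (d n) \<and>
      (AE t in lebesgue_on {0..T}. d n t \<in> F (W n t) ` U)" ..
  then have d: "\<And>n. primitive T (W n) (d n)"
    "\<And>n. AE t in lebesgue_on {0..T}. d n t \<in> F (W n t) ` U" by blast+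
  have "\<exists>u\<in>measurable_controls T U. ae_solution T (\<lambda>t w. F w (u t)) w \<and> (\<forall>t\<in>{0..T}. w t \<in> D)"
  proof (rule trajectory_limit[OF T_pos d(1) lip ul ul])
    show "AE s in lebesgue_on {0..T}. W k s \<in> D \<longrightarrow> d k s \<in> F (W k s) ` U" for k
      using d(2)[of k] by eventually_elim simp
    show "w 0 \<in> D" using init w0 by simp
  qed (rule solution_stays)
  then show ?thesis using w0 by (auto simp: trajectory_iff)
qed

end

subsection \<open>The equation for the level\<close>

lemma primitive_scaled_time: "primitive T (\<lambda>t. a + c * t) (\<lambda>_. c)" for a c :: real
  unfolding primitive_def
proof (intro conjI allI impI)
  fix u v :: real assume "0 \<le> u" "u \<le> v"
  then show "((\<lambda>_. c) has_integral (a + c * v - (a + c * u))) {u..v}"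
    using has_integral_const_real[of c u v] by (simp add: algebra_simps)
qed auto

lemma max_on_upper:
  assumes "continuous_on {0..T} y" "t \<in> {0..T}"
  shows "y t \<le> max_on T y"
  unfolding max_on_def
proof (rule cSUP_upper[OF assms(2)])
  show "bdd_above (y ` {0..T})"
    using compact_imp_bounded[OF compact_continuous_image[OF assms(1) compact_Icc]] by (rule bounded_imp_bdd_above)
qed

text \<open>The equation for \<open>z\<close> with \<open>v = 1\<close>, in which the velocity
  \<open>p\<close> of \<open>y\<close> replaces \<open>g\<close>.\<close>

definition level_solution :: "real \<Rightarrow> real \<Rightarrow> (real \<Rightarrow> real) \<Rightarrow> (real \<Rightarrow> real) \<Rightarrow> (real \<Rightarrow> real) \<Rightarrow> (real \<Rightarrow> real) \<Rightarrow> bool"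
  where "level_solution T \<theta> y p z q \<longleftrightarrow> primitive T z q \<and> z 0 = y 0 \<and>
    (\<forall>t\<in>{0..T}. q t = max (p t) 0 * (1 - exp (- \<theta> * max (y t - z t) 0)))"

lemma level_solution_exists:
  assumes T: "0 \<le> T" and \<theta>: "0 \<le> \<theta>" and y: "primitive T y p"
  obtains z q where "level_solution T \<theta> y p z q"
proof -
  have pm: "p \<in> borel_measurable borel" and "bounded (range p)" using y by (auto simp: primitive_def)
  then obtain B where B: "\<And>t. \<bar>p t\<bar> \<le> B" by (auto simp: bounded_iff)
  have cy: "continuous_on {0..T} y" by (rule primitive_continuous_on[OF y])
  \<comment> \<open>\<open>caratheodory_existence\<close> wants coefficients on the whole line;
    clamping the time makes the continuous function \<open>y\<close> Borel there.\<close>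
  define cl where "cl t = max 0 (min t T)" for t :: real
  have "continuous_on UNIV (\<lambda>t. y (cl t))"
    by (rule continuous_on_compose2[OF cy]) (use T in \<open>auto simp: cl_def intro!: continuous_intros\<close>)
  then have ym: "(\<lambda>t. y (cl t)) \<in> borel_measurable borel" by (rule borel_measurable_continuous_onI)
  define h where "h t \<zeta> = max (p t) 0 * (1 - exp (- \<theta> * max (y (cl t) - \<zeta>) 0))" for t \<zeta>
  have hB: "norm (h t \<zeta>) \<le> B" for t \<zeta>
  proof -
    have "0 \<le> \<theta> * max (y (cl t) - \<zeta>) 0" using \<theta> by simp
    then have e: "0 \<le> 1 - exp (- \<theta> * max (y (cl t) - \<zeta>) 0)" "1 - exp (- \<theta> * max (y (cl t) - \<zeta>) 0) \<le> 1"
      by auto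
    have "norm (h t \<zeta>) = max (p t) 0 * (1 - exp (- \<theta> * max (y (cl t) - \<zeta>) 0))"
      using e by (simp add: h_def abs_mult)
    also have "\<dots> \<le> max (p t) 0 * 1" using e by (intro mult_left_mono) auto
    also have "\<dots> \<le> B"
      using order_trans[OF abs_ge_zero B[of t]] order_trans[OF abs_ge_self B[of t]] by simp
    finally show ?thesis .
  qed
  have hm: "(\<lambda>t. h t \<zeta>) \<in> borel_measurable borel" for \<zeta>
    unfolding h_def using pm ym by measurable
  have hc: "continuous_on UNIV (h t)" for t
    unfolding h_def by (intro continuous_intros)
  from caratheodory_existence[where f = h and K = B and T = T and ?w0.0 = "y 0", OF T hm hB hc]
  obtain z q where zq: "primitive T z q" "z 0 = y 0" "\<And>t. t \<in> {0..T} \<Longrightarrow> q t = h t (z t)"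
    by blast
  have "level_solution T \<theta> y p z q" unfolding level_solution_def
  proof (intro conjI ballI zq(1,2))
    fix t assume t: "t \<in> {0..T}"
    then have "cl t = t" by (auto simp: cl_def)
    then show "q t = max (p t) 0 * (1 - exp (- \<theta> * max (y t - z t) 0))" using zq(3)[OF t] by (simp add: h_def)
  qed
  then show thesis by (rule that)
qed

text \<open>Where \<open>z\<close> exceeds \<open>\<zeta>\<close>, the gap \<open>y - z\<close> is
  below \<open>y - \<zeta>\<close>, so \<open>z\<close> moves no faster than \<open>\<zeta>\<close>.
  Equal parameters serve for limits of minimising sequences, different ones for the monotonicity of
  the optimal values in \<open>\<theta>\<close>.\<close>

lemma level_solution_le_supersolution:
  assumes z: "level_solution T \<theta> y p z q" and \<zeta>: "primitive T \<zeta> r" "y 0 \<le> \<zeta> 0"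
    and \<theta>: "0 \<le> \<theta>" "\<theta> \<le> \<theta>'"
    and super: "AE t in lebesgue_on {0..T}. max (p t) 0 * (1 - exp (- \<theta>' * max (y t - \<zeta> t) 0)) \<le> r t"
    and t: "0 \<le> t" "t \<le> T"
  shows "z t \<le> \<zeta> t"
proof -
  note AE_in_interval[of 0 T]
  with super have le: "AE t in lebesgue_on {0..T}. 0 < z t - \<zeta> t \<longrightarrow> q t - r t \<le> 0"
  proof eventually_elim
    case (elim t)
    show ?case
    proof
      assume "0 < z t - \<zeta> t"
      then have "\<theta> * max (y t - z t) 0 \<le> \<theta>' * max (y t - \<zeta> t) 0"
        using \<theta> by (intro mult_mono) auto
      then have "1 - exp (- \<theta> * max (y t - z t) 0) \<le> 1 - exp (- \<theta>' * max (y t - \<zeta> t) 0)" by simp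
      then have "max (p t) 0 * (1 - exp (- \<theta> * max (y t - z t) 0)) \<le> max (p t) 0 * (1 - exp (- \<theta>' * max (y t - \<zeta> t) 0))"
        by (rule mult_left_mono) simp
      moreover have "q t = max (p t) 0 * (1 - exp (- \<theta> * max (y t - z t) 0))"
        using z elim(2) unfolding level_solution_def by blast
      ultimately show "q t - r t \<le> 0" using elim(1) by linarith
    qed
  qed
  have "primitive T z q" "z 0 = y 0" using z by (simp_all only: level_solution_def)
  then have "primitive T (\<lambda>t. z t - \<zeta> t) (\<lambda>t. q t - r t)" "z 0 - \<zeta> 0 \<le> 0"
    using \<zeta> by (simp_all add: primitive_diff)
  from primitive_nonpos[OF this le t] have "z t - \<zeta> t \<le> 0" .
  then show ?thesis by simp
qed

lemma level_solution_le_max_on: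
  assumes z: "level_solution T \<theta> y p z q" and cy: "continuous_on {0..T} y" and T: "0 \<le> T"
  shows "z T \<le> max_on T y"
proof -
  let ?m = "max_on T y"
  \<comment> \<open>The constant barrier is written as an affine function of slope \<open>0\<close>
    so that \<open>primitive_scaled_time\<close> applies.\<close>
  have "primitive T (\<lambda>t. z t - (?m + 0 * t)) (\<lambda>t. q t - 0)"
    using z by (intro primitive_diff primitive_scaled_time) (simp add: level_solution_def)
  then have "z T - (?m + 0 * T) \<le> 0"
  proof (rule primitive_nonpos[where \<phi> = "\<lambda>t. z t - (?m + 0 * t)", OF _ _ _ T order_refl])
    show "z 0 - (?m + 0 * 0) \<le> 0"
      using z max_on_upper[OF cy, of 0] T by (simp add: level_solution_def)
    show "AE t in lebesgue_on {0..T}. 0 < z t - (?m + 0 * t) \<longrightarrow> q t - 0 \<le> 0"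
    proof (rule AE_I2, rule impI)
      fix t assume t: "t \<in> space (lebesgue_on {0..T})" and pos: "0 < z t - (?m + 0 * t)"
      then have "y t < z t" using max_on_upper[OF cy, of t] by simp
      then show "q t - 0 \<le> 0" using z t by (simp add: level_solution_def max_def)
    qed
  qed
  then show ?thesis by simp
qed

text \<open>The barrier for \<open>y - z\<close> starts at \<open>\<epsilon>\<close> and rises at
  rate \<open>K * exp (- \<theta> * \<epsilon>)\<close>. Above it the gap is at least
  \<open>\<epsilon>\<close>, so it grows no faster than the barrier. The hypothesis
  \<open>gap\<close> is met for every \<open>v\<close> with values in \<open>[0, 1]\<close>. The
  free parameter \<open>\<epsilon>\<close> is meant to go to \<open>0\<close> only after
  \<open>\<theta>\<close> has gone to infinity.\<close>

lemma level_gap_le: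
  assumes y: "primitive T y p" and z: "primitive T z q" "z 0 = y 0"
    and \<theta>: "0 \<le> \<theta>" and \<epsilon>: "0 \<le> \<epsilon>" and K: "0 \<le> K"
    and gap: "AE t in lebesgue_on {0..T}. p t - q t \<le> K * exp (- \<theta> * max (y t - z t) 0)"
    and t: "0 \<le> t" "t \<le> T"
  shows "y t \<le> z t + (\<epsilon> + K * exp (- \<theta> * \<epsilon>) * t)"
proof -
  let ?c = "K * exp (- \<theta> * \<epsilon>)"
  have "primitive T (\<lambda>t. y t - z t - (\<epsilon> + ?c * t)) (\<lambda>t. p t - q t - ?c)"
    by (intro primitive_diff primitive_scaled_time y z)
  then have "y t - z t - (\<epsilon> + ?c * t) \<le> 0"
  proof (rule primitive_nonpos[where \<phi> = "\<lambda>t. y t - z t - (\<epsilon> + ?c * t)", OF _ _ _ t])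
    show "y 0 - z 0 - (\<epsilon> + ?c * 0) \<le> 0" using z(2) \<epsilon> by simp
    note AE_in_interval[of 0 T]
    with gap show "AE t in lebesgue_on {0..T}. 0 < y t - z t - (\<epsilon> + ?c * t) \<longrightarrow> p t - q t - ?c \<le> 0"
    proof eventually_elim
      case (elim t)
      show ?case
      proof
        assume "0 < y t - z t - (\<epsilon> + ?c * t)"
        moreover have "0 \<le> ?c * t" using K elim by simp
        ultimately have "\<epsilon> \<le> max (y t - z t) 0" by simp
        then have "\<theta> * \<epsilon> \<le> \<theta> * max (y t - z t) 0" using \<theta> by (rule mult_left_mono)
        then have "K * exp (- \<theta> * max (y t - z t) 0) \<le> ?c" using K by (intro mult_left_mono) auto
        then show "p t - q t - ?c \<le> 0" using elim by simp
      qed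
    qed
  qed
  then show ?thesis by simp
qed

lemma bounded_linear_triple:
  "bounded_linear (\<lambda>s :: 'a::real_normed_vector \<times> 'b::real_normed_vector \<times> 'c::real_normed_vector. (fst s, fst (snd s)))"
  "bounded_linear (\<lambda>s :: 'a \<times> 'b \<times> 'c. snd (snd s))"
  by (intro bounded_linear_Pair bounded_linear_fst bounded_linear_compose[OF bounded_linear_fst bounded_linear_snd]
      bounded_linear_compose[OF bounded_linear_snd bounded_linear_snd])+

section \<open>Trajectories of the extended system\<close>

context controlled_system
begin

text \<open>What is kept of an extended trajectory once its controls are forgotten. The last clause
  records the consequences of \<open>0 \<le> v \<le> 1\<close>: \<open>z\<close> is a nondecreasing
  supersolution of the equation with \<open>v = 1\<close>, and the growth rate of
  \<open>y - z\<close> is bounded. The constant \<open>2 * K\<close> arises because \<open>z\<close>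
  moves no faster than \<open>(x, y)\<close>.\<close>

definition extended_velocity ::
    "real \<Rightarrow> (real \<Rightarrow> 'x) \<Rightarrow> (real \<Rightarrow> real) \<Rightarrow> (real \<Rightarrow> real) \<Rightarrow> (real \<Rightarrow> 'x \<times> real \<times> real) \<Rightarrow> bool"
  where "extended_velocity \<theta> x y z d \<longleftrightarrow>
    trajectory (\<lambda>t. (x t, y t)) \<and>
    z 0 = y0 \<and>
    y 0 = y0 \<and>
    primitive T (\<lambda>t. (x t, y t, z t)) d \<and>
    (2 * K)-lipschitz_on {0..T} (\<lambda>t. (x t, y t, z t)) \<and>
    primitive T z (\<lambda>t. snd (snd (d t))) \<and>
    primitive T (\<lambda>t. (x t, y t)) (\<lambda>t. (fst (d t), fst (snd (d t)))) \<and>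
    (AE t in lebesgue_on {0..T}. \<bar>fst (snd (d t))\<bar> \<le> K \<and> 0 \<le> snd (snd (d t)) \<and>
      max (fst (snd (d t))) 0 * (1 - exp (- \<theta> * max (y t - z t) 0)) \<le> snd (snd (d t)) \<and>
      fst (snd (d t)) - snd (snd (d t)) \<le> K * exp (- \<theta> * max (y t - z t) 0))"

lemma extended_velocityD:
  assumes "extended_velocity \<theta> x y z d"
  shows "trajectory (\<lambda>t. (x t, y t))" "z 0 = y0" "y 0 = y0"
    "primitive T (\<lambda>t. (x t, y t, z t)) d" "(2 * K)-lipschitz_on {0..T} (\<lambda>t. (x t, y t, z t))"
    "primitive T z (\<lambda>t. snd (snd (d t)))" "primitive T (\<lambda>t. (x t, y t)) (\<lambda>t. (fst (d t), fst (snd (d t))))"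
    "AE t in lebesgue_on {0..T}. \<bar>fst (snd (d t))\<bar> \<le> K \<and> 0 \<le> snd (snd (d t)) \<and>
      max (fst (snd (d t))) 0 * (1 - exp (- \<theta> * max (y t - z t) 0)) \<le> snd (snd (d t)) \<and>
      fst (snd (d t)) - snd (snd (d t)) \<le> K * exp (- \<theta> * max (y t - z t) 0)"
  using assms unfolding extended_velocity_def by blast+

text \<open>The bootstrap of \<open>solution_primitive\<close> again: a crude bound from continuity
  makes the triple a primitive. Its first two components then form a trajectory, for which the speed
  bound \<open>K\<close> is available, and almost everywhere uniqueness of derivatives transfers
  this bound to \<open>d\<close>.\<close>

lemma trajectories3_supersolution:
  assumes xyz: "(x, y, z) \<in> trajectories3 \<theta> f g D U T x0 y0" and \<theta>: "0 \<le> \<theta>"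
  obtains d where "extended_velocity \<theta> x y z d"
proof -
  define w3 where "w3 t = (x t, y t, z t)" for t
  obtain u v where u: "u \<in> measurable_controls T U" and v: "v \<in> measurable_controls T {0..1::real}"
    and sol: "ae_solution T (\<lambda>t (x, y, z). (f x y (u t), g x y (u t),
            max (g x y (u t)) 0 * (1 - v t * exp (- \<theta> * max (y - z) 0)))) w3"
    and D: "\<forall>t\<in>{0..T}. (x t, y t) \<in> D" and i: "x 0 = x0" "y 0 = y0" "z 0 = y0"
    using xyz unfolding trajectories3_def w3_def by auto
  define e where "e t = (f (x t) (y t) (u t), g (x t) (y t) (u t),
      max (g (x t) (y t) (u t)) 0 * (1 - v t * exp (- \<theta> * max (y t - z t) 0)))" for t
  have ac: "abs_continuous_on_interval w3 0 T"
    and der: "AE t in lebesgue_on {0..T}. (w3 has_vector_derivative e t) (at t within {0..T})"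
    using sol by (auto simp: ae_solution_def w3_def e_def)
  have e_F: "(fst (e t), fst (snd (e t))) = F (x t, y t) (u t)" for t by (simp add: e_def F_def)
  have ez: "\<bar>snd (snd (e t))\<bar> \<le> norm (F (x t, y t) (u t))" if t: "t \<in> {0..T}" for t
  proof -
    let ?E = "exp (- \<theta> * max (y t - z t) 0)"
    have "0 \<le> \<theta> * max (y t - z t) 0" using \<theta> by simp
    then have E: "0 \<le> ?E" "?E \<le> 1" by auto
    have "0 \<le> v t" "v t \<le> 1" using v t by (auto simp: measurable_controls_def)
    then have vE: "0 \<le> v t * ?E" "v t * ?E \<le> 1" using E by (auto intro: mult_le_one)
    have "\<bar>snd (snd (e t))\<bar> = max (g (x t) (y t) (u t)) 0 * (1 - v t * ?E)"
      using vE by (simp add: e_def abs_mult)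
    also have "\<dots> \<le> max (g (x t) (y t) (u t)) 0 * 1" using vE by (intro mult_left_mono) auto
    also have "\<dots> \<le> \<bar>snd (F (x t, y t) (u t))\<bar>" by (simp add: F_def)
    also have "\<dots> \<le> norm (F (x t, y t) (u t))"
      using norm_snd_le[of "snd (F (x t, y t) (u t))" "fst (F (x t, y t) (u t))"] by simp
    finally show ?thesis .
  qed
  have norm_e: "norm (e t) \<le> norm (F (x t, y t) (u t)) + \<bar>snd (snd (e t))\<bar>" for t
  proof -
    have "norm (e t) = norm (F (x t, y t) (u t), snd (snd (e t)))"
      unfolding e_F[symmetric] by (simp add: norm_prod_def add.assoc)
    then show ?thesis using norm_Pair_le[of "F (x t, y t) (u t)" "snd (snd (e t))"] by simp
  qed
  have cw: "continuous_on {0..T} w3" by (rule abs_continuous_imp_continuous[OF ac])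
  then have "continuous_on {0..T} (\<lambda>t. (fst (w3 t), fst (snd (w3 t))))" by (intro continuous_intros)
  then have cxy: "continuous_on {0..T} (\<lambda>t. (x t, y t))" by (simp add: w3_def)
  obtain B where B: "\<And>t. t \<in> {0..T} \<Longrightarrow> norm (x t, y t) \<le> B"
    using compact_imp_bounded[OF compact_continuous_image[OF cxy compact_Icc]] unfolding bounded_iff by blast
  have "0 \<le> B" by (rule order_trans[OF norm_ge_zero B[of 0]]) (use T_pos in simp)
  have "(2 * (2 * C * (1 + B)))-lipschitz_on {0..T} w3"
  proof (rule abs_continuous_imp_lipschitz[OF ac])
    show "0 \<le> 2 * (2 * C * (1 + B))" using C_pos \<open>0 \<le> B\<close> by simp
    note AE_in_interval[of 0 T]
    with der show "AE t in lebesgue_on {0..T}. \<exists>e. (w3 has_vector_derivative e) (at t within {0..T}) \<and> norm e \<le> 2 * (2 * C * (1 + B))"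
    proof eventually_elim
      case (elim t)
      have "norm (F (x t, y t) (u t)) \<le> 2 * C * (1 + norm (x t, y t))"
        using D u elim by (intro norm_F_le) (auto simp: measurable_controls_def)
      also have "\<dots> \<le> 2 * C * (1 + B)" using B elim C_pos by (intro mult_left_mono) auto
      finally have "norm (e t) \<le> 2 * (2 * C * (1 + B))" using norm_e[of t] ez elim by fastforce
      then show ?case using elim by blast
    qed
  qed
  then obtain d where d: "primitive T w3 d"
    using lipschitz_imp_primitive[OF T_nonneg] by blast
  have d_e: "AE t in lebesgue_on {0..T}. d t = e t"
    by (rule primitive_derivative_unique[OF T_pos d der])
  define h where "h s = (fst s, fst (snd s))" for s :: "'x \<times> real \<times> real"
  have lin: "bounded_linear h" unfolding h_def by (rule bounded_linear_triple)
  have pair: "primitive T (\<lambda>t. (x t, y t)) (\<lambda>t. h (d t))"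
    using primitive_linear[OF d lin] by (simp add: h_def w3_def)
  have traj: "trajectory (\<lambda>t. (x t, y t))"
    unfolding trajectory_iff
  proof (intro bexI[OF _ u] conjI D)
    show "ae_solution T (\<lambda>t w. F w (u t)) (\<lambda>t. (x t, y t))"
      unfolding ae_solution_def
    proof
      obtain L where "L-lipschitz_on {0..T} (\<lambda>t. (x t, y t))" using primitive_lipschitz[OF pair] by blast
      then show "abs_continuous_on_interval (\<lambda>t. (x t, y t)) 0 T" by (rule lipschitz_imp_abs_continuous)
      show "AE t in lebesgue_on {0..T}. ((\<lambda>t. (x t, y t)) has_vector_derivative F (x t, y t) (u t)) (at t within {0..T})"
        using primitive_has_derivative[OF T_nonneg pair] d_e
        by eventually_elim (simp add: h_def e_F)
    qed
  qed (use i in simp)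
  obtain c where c: "primitive T (\<lambda>t. (x t, y t)) c" "AE t in lebesgue_on {0..T}. norm (c t) \<le> K"
    by (rule trajectory_primitive[OF traj])
  have hK: "AE t in lebesgue_on {0..T}. norm (h (d t)) \<le> K"
    using primitive_derivative_unique[OF T_pos pair
      primitive_has_derivative[OF T_nonneg c(1)]] c(2)
    by eventually_elim simp
  note in_T = AE_in_interval[of 0 T]
  have dK: "AE t in lebesgue_on {0..T}. norm (d t) \<le> 2 * K"
    using hK d_e in_T
  proof eventually_elim
    case (elim t)
    then show ?case using norm_e[of t] ez[of t] by (simp add: h_def e_F)
  qed
  have lip: "(2 * K)-lipschitz_on {0..T} w3"
    using K_nonneg by (intro primitive_imp_lipschitz[OF _ d dK]) simp
  from primitive_linear[OF d bounded_linear_triple(2)]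
  have zq: "primitive T z (\<lambda>t. snd (snd (d t)))" by (simp add: w3_def)
  show thesis
  proof (rule that, unfold extended_velocity_def, intro conjI)
    show "AE t in lebesgue_on {0..T}. \<bar>fst (snd (d t))\<bar> \<le> K \<and> 0 \<le> snd (snd (d t)) \<and>
        max (fst (snd (d t))) 0 * (1 - exp (- \<theta> * max (y t - z t) 0)) \<le> snd (snd (d t)) \<and>
        fst (snd (d t)) - snd (snd (d t)) \<le> K * exp (- \<theta> * max (y t - z t) 0)"
      using hK d_e in_T
    proof eventually_elim
      case (elim t)
      define p where "p = fst (snd (d t))"
      define q where "q = snd (snd (d t))"
      define E where "E = exp (- \<theta> * max (y t - z t) 0)"
      have v: "0 \<le> v t" "v t \<le> 1" "q = max p 0 * (1 - v t * E)"
        using v elim by (auto simp: measurable_controls_def p_def q_def E_def e_def)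
      have "0 \<le> \<theta> * max (y t - z t) 0" using \<theta> by simp
      then have E: "0 \<le> E" "E \<le> 1" by (auto simp: E_def)
      have vE: "v t * E \<le> E" using v E mult_right_mono[of "v t" 1 E] by simp
      have p: "\<bar>p\<bar> \<le> K"
        using order_trans[OF norm_snd_le elim(1)[unfolded h_def]] by (simp add: p_def)
      then have pK: "max p 0 \<le> K" using K_nonneg by simp
      have "max p 0 * (1 - E) \<le> q" unfolding v(3) using vE by (intro mult_left_mono) auto
      moreover have "0 \<le> q" unfolding v(3) using vE E by (intro mult_nonneg_nonneg) auto
      moreover have "p - q \<le> K * E"
      proof -
        have "p - q \<le> max p 0 - max p 0 * (1 - v t * E)" unfolding v(3) by simp
        also have "\<dots> = max p 0 * (v t * E)" by (simp add: algebra_simps)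
        also have "\<dots> \<le> K * E" using vE E v pK K_nonneg by (intro mult_mono) auto
        finally show ?thesis .
      qed
      ultimately show ?case using p unfolding p_def q_def E_def by blast
    qed
  qed (use traj i d[unfolded w3_def] lip[unfolded w3_def] zq pair[unfolded h_def] in simp_all)
qed

text \<open>The control \<open>v = 1\<close> is optimal, by \<open>level_solution_le_supersolution\<close>.\<close>

lemma trajectories3I:
  assumes traj: "trajectory (\<lambda>t. (x t, y t))" and xy: "primitive T (\<lambda>t. (x t, y t)) d"
    and z: "level_solution T \<theta> y (\<lambda>t. snd (d t)) z q"
  shows "(x, y, z) \<in> trajectories3 \<theta> f g D U T x0 y0"
proof -
  obtain u where u: "u \<in> measurable_controls T U" and sol: "ae_solution T (\<lambda>t w. F w (u t)) (\<lambda>t. (x t, y t))"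
    and D: "\<forall>t\<in>{0..T}. (x t, y t) \<in> D" and i: "x 0 = x0" "y 0 = y0"
    using traj by (auto simp: trajectory_iff)
  have zq: "primitive T z q" using z by (simp add: level_solution_def)
  have d_F: "AE t in lebesgue_on {0..T}. d t = F (x t, y t) (u t)"
    using sol by (intro primitive_derivative_unique[OF T_pos xy]) (simp add: ae_solution_def)
  obtain L1 L2 where "L1-lipschitz_on {0..T} (\<lambda>t. (x t, y t))" "L2-lipschitz_on {0..T} z"
    using primitive_lipschitz[OF xy] primitive_lipschitz[OF zq] by metis
  then have "(sqrt (L1\<^sup>2 + L2\<^sup>2))-lipschitz_on {0..T} (\<lambda>t. ((x t, y t), z t))" by (rule lipschitz_on_Pair)
  \<comment> \<open>Reassociating the nested pairs leaves the Euclidean distance unchanged.\<close>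
  then have "(sqrt (L1\<^sup>2 + L2\<^sup>2))-lipschitz_on {0..T} (\<lambda>t. (x t, y t, z t))"
    by (simp add: lipschitz_on_def dist_Pair_Pair add.assoc)
  then have ac: "abs_continuous_on_interval (\<lambda>t. (x t, y t, z t)) 0 T" by (rule lipschitz_imp_abs_continuous)
  note AE_in_interval[of 0 T]
  with primitive_has_derivative[OF T_nonneg xy]
    primitive_has_derivative[OF T_nonneg zq] d_F
  have "AE t in lebesgue_on {0..T}. ((\<lambda>t. (x t, y t, z t)) has_vector_derivative
      (f (x t) (y t) (u t), g (x t) (y t) (u t),
        max (g (x t) (y t) (u t)) 0 * (1 - 1 * exp (- \<theta> * max (y t - z t) 0)))) (at t within {0..T})"
  proof eventually_elim
    case (elim t)
    have x': "(x has_vector_derivative f (x t) (y t) (u t)) (at t within {0..T})"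
      using bounded_linear.has_vector_derivative[OF bounded_linear_fst elim(1)] elim(3) by (simp add: F_def)
    have y': "(y has_vector_derivative g (x t) (y t) (u t)) (at t within {0..T})"
      using bounded_linear.has_vector_derivative[OF bounded_linear_snd elim(1)] elim(3) by (simp add: F_def)
    have "q t = max (g (x t) (y t) (u t)) 0 * (1 - 1 * exp (- \<theta> * max (y t - z t) 0))"
      using z elim by (simp add: level_solution_def F_def)
    then show ?case using elim(2) by (intro has_vector_derivative_Pair x' y') simp
  qed
  moreover have "(\<lambda>_. 1) \<in> measurable_controls T {0..1::real}" by (simp add: measurable_controls_def)
  ultimately show ?thesis
    using ac u D i z unfolding trajectories3_def ae_solution_def
    by (auto simp: level_solution_def intro!: bexI[of _ u] bexI[of _ "\<lambda>_. 1"])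
qed

end

subsection \<open>Optimal solutions\<close>

context controlled_system
begin

text \<open>A supersolution need not arise from a control \<open>v\<close>. Solving the level
  equation along the same \<open>(x, y)\<close> yields a genuine extended trajectory that ends no
  higher.\<close>

lemma trajectories3_below:
  assumes traj: "trajectory (\<lambda>t. (x t, y t))" and xy: "primitive T (\<lambda>t. (x t, y t)) d"
    and \<zeta>: "primitive T \<zeta> r" "y 0 \<le> \<zeta> 0"
    and \<theta>: "0 \<le> \<theta>" "\<theta> \<le> \<theta>'"
    and super: "AE t in lebesgue_on {0..T}. max (snd (d t)) 0 * (1 - exp (- \<theta>' * max (y t - \<zeta> t) 0)) \<le> r t"
  shows "\<exists>z. (x, y, z) \<in> trajectories3 \<theta> f g D U T x0 y0 \<and> z T \<le> \<zeta> T"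
proof -
  have y: "primitive T y (\<lambda>t. snd (d t))"
    using primitive_linear[OF xy bounded_linear_snd] by simp
  obtain z q where z: "level_solution T \<theta> y (\<lambda>t. snd (d t)) z q"
    using level_solution_exists[OF T_nonneg \<theta>(1) y] by blast
  have "z T \<le> \<zeta> T"
    using level_solution_le_supersolution[OF z \<zeta> \<theta> super] T_pos by simp
  then show ?thesis using trajectories3I[OF traj xy z] by blast
qed

text \<open>Hence the optimal value of the penalised problem never exceeds that of the original
  one.\<close>

lemma trajectories3_below_max_on:
  assumes traj: "trajectory (\<lambda>t. (x t, y t))" and \<theta>: "0 \<le> \<theta>"
  shows "\<exists>z. (x, y, z) \<in> trajectories3 \<theta> f g D U T x0 y0 \<and> z T \<le> max_on T y"
proof -
  obtain d where xy: "primitive T (\<lambda>t. (x t, y t)) d"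
    by (rule trajectory_primitive[OF traj])
  have y: "primitive T y (\<lambda>t. snd (d t))"
    using primitive_linear[OF xy bounded_linear_snd] by simp
  obtain z q where z: "level_solution T \<theta> y (\<lambda>t. snd (d t)) z q"
    using level_solution_exists[OF T_nonneg \<theta> y] by blast
  have "z T \<le> max_on T y"
    by (rule level_solution_le_max_on[OF z primitive_continuous_on[OF y] T_nonneg])
  then show ?thesis using trajectories3I[OF traj xy z] by blast
qed

lemma trajectories3_nondecreasing:
  assumes xyz: "(x, y, z) \<in> trajectories3 \<theta> f g D U T x0 y0" and \<theta>: "0 \<le> \<theta>"
    and t: "0 \<le> t" "t \<le> T"
  shows "z t \<le> z T"
proof -
  obtain d where d: "extended_velocity \<theta> x y z d"
    by (rule trajectories3_supersolution[OF xyz \<theta>])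
  note z = extended_velocityD(6)[OF d] and ae = extended_velocityD(8)[OF d]
  have "primitive T (\<lambda>t. - z t) (\<lambda>t. - snd (snd (d t)))"
    by (rule primitive_linear[OF z bounded_linear_minus[OF bounded_linear_ident]])
  then have "- z T - - z t \<le> 0 * (T - t)"
  proof (rule primitive_AE_le[OF _ t order_refl])
    show "AE s in lebesgue_on {0..T}. t < s \<longrightarrow> s < T \<longrightarrow> - snd (snd (d s)) \<le> 0"
      using ae by eventually_elim simp
  qed
  then show ?thesis by simp
qed

text \<open>The inequality splits into two half-space conditions on the velocity, with normals
  \<open>(0, 0, 1)\<close> and \<open>(0, - c, 1)\<close>. The first holds for all velocities of the
  sequence. In the second the coefficient \<open>c\<close> is frozen at time \<open>t\<close>,
  whereas along the sequence it varies; uniform convergence and the speed bound \<open>K\<close>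
  absorb the difference into \<open>\<epsilon>\<close>.\<close>

lemma limit_supersolution:
  assumes \<theta>: "0 \<le> \<theta>"
    and w: "\<And>n. (x n, y n, z n) \<in> trajectories3 \<theta> f g D U T x0 y0"
    and lim: "uniform_limit {0..T} (\<lambda>n t. (x n t, y n t, z n t)) (\<lambda>t. (a t, b t, \<zeta> t)) sequentially"
    and t: "t \<in> {0..T}" and cont: "continuous_on {0..T} (\<lambda>t. (a t, b t, \<zeta> t))"
    and der: "((\<lambda>t. (a t, b t, \<zeta> t)) has_vector_derivative e) (at t within {0..T})"
  shows "max (fst (snd e)) 0 * (1 - exp (- \<theta> * max (b t - \<zeta> t) 0)) \<le> snd (snd e)"
proof -
  have "\<forall>n. \<exists>d. extended_velocity \<theta> (x n) (y n) (z n) d"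
    using trajectories3_supersolution[OF w \<theta>] by metis
  from choice[OF this] obtain d where "\<forall>n. extended_velocity \<theta> (x n) (y n) (z n) (d n)" ..
  then have ev: "extended_velocity \<theta> (x n) (y n) (z n) (d n)" for n ..
  note d = extended_velocityD(4)[OF ev] and ae = extended_velocityD(8)[OF ev]
  have pw: "(\<lambda>n. (x n s, y n s, z n s)) \<longlonglongrightarrow> (a s, b s, \<zeta> s)" if "s \<in> {0..T}" for s
    using lim that by (rule tendsto_uniform_limitI)
  define h where "h s = 1 - exp (- \<theta> * max (fst (snd s) - snd (snd s)) 0)" for s :: "'x \<times> real \<times> real"
  have ch: "continuous_on UNIV h" unfolding h_def by (intro continuous_intros)
  define c where "c = h (a t, b t, \<zeta> t)"
  have "0 \<le> \<theta> * max (b t - \<zeta> t) 0" using \<theta> by simp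
  then have c: "0 \<le> c" "c = 1 - exp (- \<theta> * max (b t - \<zeta> t) 0)" by (auto simp: c_def h_def)
  have nonneg: "0 \<le> snd (snd e)"
  proof -
    have "0 \<le> (0, 0, 1) \<bullet> e"
    proof (rule limit_derivative_ge[OF T_pos d pw t der zero_less_one])
      show "\<forall>\<^sub>F k in sequentially. AE s in lebesgue_on {0..T}. \<bar>s - t\<bar> < 1 \<longrightarrow> 0 \<le> (0, 0, 1) \<bullet> d k s"
      proof (rule always_eventually, rule allI)
        fix k show "AE s in lebesgue_on {0..T}. \<bar>s - t\<bar> < 1 \<longrightarrow> 0 \<le> (0, 0, 1) \<bullet> d k s"
          using ae[of k] by eventually_elim (simp add: inner_prod_def)
      qed
    qed
    then show ?thesis by (simp add: inner_prod_def)
  qed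
  have "c * fst (snd e) \<le> snd (snd e)"
  proof (rule field_le_epsilon)
    fix \<epsilon> :: real assume \<epsilon>: "0 < \<epsilon>"
    \<comment> \<open>The error from freezing is \<open>p * (H - c)\<close> with \<open>p\<close>
      bounded by \<open>K\<close>; this is the tolerance it leaves for the coefficient.\<close>
    define \<epsilon>' where "\<epsilon>' = \<epsilon> / (K + 1)"
    have \<epsilon>': "0 < \<epsilon>'" using \<epsilon> K_nonneg by (simp add: \<epsilon>'_def)
    obtain \<eta> where \<eta>: "0 < \<eta>" "\<And>s. dist s (a t, b t, \<zeta> t) < \<eta> \<Longrightarrow> dist (h s) c < \<epsilon>'"
      using ch \<epsilon>' unfolding continuous_on_iff c_def by (metis UNIV_I)
    have "0 < \<eta> / 2" using \<eta>(1) by simp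
    then obtain \<delta> where \<delta>: "0 < \<delta>" "\<And>s. s \<in> {0..T} \<Longrightarrow> dist s t < \<delta> \<Longrightarrow> dist (a s, b s, \<zeta> s) (a t, b t, \<zeta> t) < \<eta> / 2"
      using cont t unfolding continuous_on_iff by metis
    have close: "\<forall>\<^sub>F k in sequentially. \<forall>s\<in>{0..T}. dist (x k s, y k s, z k s) (a s, b s, \<zeta> s) < \<eta> / 2"
      using lim \<open>0 < \<eta> / 2\<close> unfolding uniform_limit_iff by blast
    have "- \<epsilon> \<le> (0, - c, 1) \<bullet> e"
    proof (rule limit_derivative_ge[OF T_pos d pw t der \<delta>(1)])
      show "\<forall>\<^sub>F k in sequentially. AE s in lebesgue_on {0..T}. \<bar>s - t\<bar> < \<delta> \<longrightarrow> - \<epsilon> \<le> (0, - c, 1) \<bullet> d k s"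
        using close
      proof eventually_elim
        case (elim k)
        note AE_in_interval[of 0 T]
        with ae[of k] show ?case
        proof eventually_elim
          case inner: (elim s)
          show ?case
          proof
            assume "\<bar>s - t\<bar> < \<delta>"
            then have "dist (a s, b s, \<zeta> s) (a t, b t, \<zeta> t) < \<eta> / 2"
              using \<delta>(2) inner by (simp add: dist_real_def)
            moreover have "dist (x k s, y k s, z k s) (a s, b s, \<zeta> s) < \<eta> / 2" using elim inner by blast
            ultimately have "dist (x k s, y k s, z k s) (a t, b t, \<zeta> t) < \<eta>"
              using dist_triangle_half_r[of "(a s, b s, \<zeta> s)" "(x k s, y k s, z k s)" \<eta> "(a t, b t, \<zeta> t)"]
              by (simp only: dist_commute)
            then have hc: "\<bar>h (x k s, y k s, z k s) - c\<bar> < \<epsilon>'" using \<eta>(2) by (simp only: dist_real_def)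
            define p where "p = fst (snd (d k s))"
            define q where "q = snd (snd (d k s))"
            define H where "H = h (x k s, y k s, z k s)"
            have "0 \<le> \<theta> * max (y k s - z k s) 0" using \<theta> by simp
            then have H0: "0 \<le> H" by (simp add: H_def h_def)
            have q: "max p 0 * H \<le> q" and p: "\<bar>p\<bar> \<le> K"
              using inner unfolding p_def q_def H_def h_def by simp_all
            have "p * H \<le> max p 0 * H" using H0 by (intro mult_right_mono) auto
            moreover have "\<bar>p * (H - c)\<bar> \<le> \<epsilon>"
            proof -
              have "\<bar>p * (H - c)\<bar> \<le> K * \<epsilon>'"
                unfolding abs_mult using p hc K_nonneg by (intro mult_mono) (auto simp: H_def)
              also have "\<dots> \<le> (K + 1) * \<epsilon>'" using \<epsilon>' by (intro mult_right_mono) auto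
              also have "\<dots> = \<epsilon>" using K_nonneg by (simp add: \<epsilon>'_def)
              finally show ?thesis .
            qed
            ultimately have "- \<epsilon> \<le> q - c * p" using q by (simp add: algebra_simps abs_le_iff)
            then show "- \<epsilon> \<le> (0, - c, 1) \<bullet> d k s" by (simp add: inner_prod_def p_def q_def)
          qed
        qed
      qed
    qed
    then show "c * fst (snd e) \<le> snd (snd e) + \<epsilon>" by (simp add: inner_prod_def)
  qed
  then have "max (fst (snd e)) 0 * c \<le> snd (snd e)"
    using nonneg by (simp add: max_def mult.commute)
  then show ?thesis by (simp add: c(2))
qed

text \<open>The direct method with a twist: the limit of a minimising sequence need not be an
  extended trajectory. Its \<open>(x, y)\<close> part is a trajectory, and its \<open>z\<close> part
  is replaced by a level solution that ends no higher.\<close>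

lemma optimal_P3_exists:
  assumes \<theta>: "0 \<le> \<theta>"
  shows "\<exists>w. optimal_P3 \<theta> f g D U T x0 y0 w"
proof -
  let ?S = "trajectories3 \<theta> f g D U T x0 y0"
  define V where "V = (\<lambda>(x, y, z). z T) ` ?S"
  obtain w0 where "trajectory w0" using trajectory_exists by blast
  then have "trajectory (\<lambda>t. (fst (w0 t), snd (w0 t)))" by simp
  from trajectories3_below_max_on[OF this \<theta>]
  obtain z' where "(\<lambda>t. fst (w0 t), \<lambda>t. snd (w0 t), z') \<in> ?S" by blast
  then have ne: "V \<noteq> {}" by (auto simp: V_def)
  have "y0 \<le> z T" if "(x, y, z) \<in> ?S" for x y z
  proof -
    have "z 0 = y0" by (rule trajectories3_supersolution[OF that \<theta>]) (rule extended_velocityD(2))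
    then show ?thesis using trajectories3_nondecreasing[OF that \<theta>, of 0] T_pos by simp
  qed
  then have bdd: "bdd_below V" by (auto simp: V_def intro!: bdd_belowI[of _ y0])
  have "\<exists>x y z. (x, y, z) \<in> ?S \<and> z T < Inf V + inverse (real (Suc n))" for n
  proof -
    have "Inf V < Inf V + inverse (real (Suc n))" by simp
    then obtain v where "v \<in> V" "v < Inf V + inverse (real (Suc n))"
      using cInf_lessD[OF ne] by blast
    then show ?thesis by (auto simp: V_def)
  qed
  then obtain x y z where S: "\<And>n. (x n, y n, z n) \<in> ?S"
    and zV: "\<And>n. z n T < Inf V + inverse (real (Suc n))" by metis
  have lip: "(2 * K)-lipschitz_on {0..T} (\<lambda>t. (x n t, y n t, z n t))" for n
    by (rule trajectories3_supersolution[OF S[of n] \<theta>]) (rule extended_velocityD(5))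
  have traj: "trajectory (\<lambda>t. (x n t, y n t))" for n
    by (rule trajectories3_supersolution[OF S[of n] \<theta>]) (rule extended_velocityD(1))
  have i: "(x n 0, y n 0, z n 0) = (x0, y0, y0)" for n
  proof -
    have "z n 0 = y0"
      by (rule trajectories3_supersolution[OF S[of n] \<theta>]) (rule extended_velocityD(2))
    then show ?thesis using traj[of n] by (auto simp: trajectory_iff)
  qed
  obtain \<omega> r where r: "strict_mono r" and lip\<omega>: "(2 * K)-lipschitz_on {0..T} \<omega>"
    and ul: "uniform_limit {0..T} (\<lambda>k t. (x (r k) t, y (r k) t, z (r k) t)) \<omega> sequentially"
    and \<omega>0: "\<omega> 0 = (x0, y0, y0)"
    by (rule lipschitz_uniform_limit_subsequence[OF T_nonneg lip i])
  define a b \<zeta> where "a = (\<lambda>t. fst (\<omega> t))" and "b = (\<lambda>t. fst (snd (\<omega> t)))" and "\<zeta> = (\<lambda>t. snd (snd (\<omega> t)))"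
  have \<omega>: "\<omega> = (\<lambda>t. (a t, b t, \<zeta> t))" by (simp add: a_def b_def \<zeta>_def)
  obtain e where e: "primitive T \<omega> e"
    using lipschitz_imp_primitive[OF T_nonneg lip\<omega>] by blast
  from primitive_linear[OF e bounded_linear_triple(2)]
  have \<zeta>: "primitive T \<zeta> (\<lambda>t. snd (snd (e t)))" by (simp add: \<zeta>_def)
  from primitive_linear[OF e bounded_linear_triple(1)]
  have ab: "primitive T (\<lambda>t. (a t, b t)) (\<lambda>t. (fst (e t), fst (snd (e t))))" by (simp add: a_def b_def)
  obtain L where L: "L-lipschitz_on {0..T} (\<lambda>t. (a t, b t))" using primitive_lipschitz[OF ab] by blast
  have "uniform_limit {0..T} (\<lambda>k t. (x (r k) t, y (r k) t)) (\<lambda>t. (a t, b t)) sequentially"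
    using bounded_linear.uniform_limit[OF bounded_linear_triple(1) ul] by (simp add: \<omega>)
  then have traj': "trajectory (\<lambda>t. (a t, b t))"
    by (rule trajectory_uniform_limit[OF traj _ L]) (use \<omega>0 in \<open>simp add: a_def b_def\<close>)
  note AE_in_interval[of 0 T]
  with primitive_has_derivative[OF T_nonneg e]
  have super: "AE t in lebesgue_on {0..T}. max (fst (snd (e t))) 0 * (1 - exp (- \<theta> * max (b t - \<zeta> t) 0)) \<le> snd (snd (e t))"
  proof eventually_elim
    case (elim t)
    show ?case
      by (rule limit_supersolution[where x = "\<lambda>k. x (r k)" and y = "\<lambda>k. y (r k)" and z = "\<lambda>k. z (r k)" and a = a,
          OF \<theta> S ul[unfolded \<omega>] elim(2) lipschitz_on_continuous_on[OF lip\<omega>[unfolded \<omega>]] elim(1)[unfolded \<omega>]])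
  qed
  then have super': "AE t in lebesgue_on {0..T}. max (snd (fst (e t), fst (snd (e t)))) 0 *
      (1 - exp (- \<theta> * max (b t - \<zeta> t) 0)) \<le> snd (snd (e t))"
    by simp
  have "b 0 \<le> \<zeta> 0" using \<omega>0 by (simp add: b_def \<zeta>_def)
  from trajectories3_below[OF traj' ab \<zeta> this \<theta> order_refl super']
  obtain z' where z': "(a, b, z') \<in> ?S" "z' T \<le> \<zeta> T" by blast
  have "\<zeta> T \<le> Inf V"
  proof (rule LIMSEQ_le)
    have "(\<lambda>k. (x (r k) T, y (r k) T, z (r k) T)) \<longlonglongrightarrow> \<omega> T"
      using ul by (rule tendsto_uniform_limitI) (use T_pos in simp)
    from tendsto_snd[OF tendsto_snd[OF this]] show "(\<lambda>k. z (r k) T) \<longlonglongrightarrow> \<zeta> T" by (simp add: \<zeta>_def)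
    have "(\<lambda>n. Inf V + inverse (real (Suc n))) \<longlonglongrightarrow> Inf V + 0"
      by (intro tendsto_add tendsto_const LIMSEQ_inverse_real_of_nat)
    from LIMSEQ_subseq_LIMSEQ[OF this r]
    show "(\<lambda>k. Inf V + inverse (real (Suc (r k)))) \<longlonglongrightarrow> Inf V" by (simp add: o_def)
    show "\<exists>N. \<forall>k\<ge>N. z (r k) T \<le> Inf V + inverse (real (Suc (r k)))" using zV less_imp_le by blast
  qed
  then have min: "z' T \<le> v" if "v \<in> V" for v using z'(2) cInf_lower[OF that bdd] by simp
  have "optimal_P3 \<theta> f g D U T x0 y0 (a, b, z')"
    unfolding optimal_P3_def is_arg_min_def
  proof (intro conjI z'(1) notI)
    assume "\<exists>s. s \<in> ?S \<and> (case s of (x, y, z) \<Rightarrow> z T) < (case (a, b, z') of (x, y, z) \<Rightarrow> z T)"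
    then obtain s where "s \<in> ?S" "(case s of (x, y, z) \<Rightarrow> z T) < z' T" by auto
    then show False using min[of "case s of (x, y, z) \<Rightarrow> z T"] by (force simp: V_def)
  qed
  then show ?thesis by blast
qed

text \<open>The optimal values are monotone and bounded, so they converge along the whole sequence
  to some \<open>v\<close>; only \<open>(x, y)\<close> needs a subsequence. Every trajectory has
  maximum at least \<open>v\<close>, and the limit \<open>b\<close> stays below \<open>v\<close>, so
  \<open>b\<close> has maximum exactly \<open>v\<close> and is optimal.\<close>

theorem optimal_P3_limit:
  assumes \<theta>: "\<forall>n. \<theta> n > 0" "incseq \<theta>" "filterlim \<theta> at_top sequentially"
    and opt: "\<And>n. optimal_P3 (\<theta> n) f g D U T x0 y0 (x n, y n, z n)"
  shows "\<exists>(r :: nat \<Rightarrow> nat) x_opt y_opt. strict_mono r \<and>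
         optimal_P f g D U T x0 y0 (x_opt, y_opt) \<and>
         uniform_limit {0..T} (\<lambda>k t. (x (r k) t, y (r k) t)) (\<lambda>t. (x_opt t, y_opt t)) sequentially \<and>
         weakly_converges_L2 T (\<lambda>k. time_deriv T (\<lambda>t. (x (r k) t, y (r k) t)))
           (time_deriv T (\<lambda>t. (x_opt t, y_opt t))) \<and>
         incseq (\<lambda>n. z n T) \<and>
         (\<lambda>n. z n T) \<longlonglongrightarrow> max_on T y_opt"
proof -
  let ?S = "\<lambda>\<theta>. trajectories3 \<theta> f g D U T x0 y0"
  have \<theta>0: "0 \<le> \<theta> n" for n using \<theta>(1) less_imp_le by blast
  have S: "(x n, y n, z n) \<in> ?S (\<theta> n)" for n
    using opt[of n] by (simp add: optimal_P3_def is_arg_min_def)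
  have least: "z n T \<le> z' T" if "(x', y', z') \<in> ?S (\<theta> n)" for n x' y' z'
    using opt[of n] that by (force simp: optimal_P3_def is_arg_min_def not_less)
  have traj: "trajectory (\<lambda>t. (x n t, y n t))" for n
    by (rule trajectories3_supersolution[OF S[of n] \<theta>0]) (rule extended_velocityD(1))
  have le_max: "z n T \<le> max_on T y'" if "trajectory (\<lambda>t. (x' t, y' t))" for n x' y'
    using trajectories3_below_max_on[OF that \<theta>0[of n]] least by force
  \<comment> \<open>An optimal triple for \<open>\<theta> (Suc n)\<close> is a supersolution that
    dominates the level solution for \<open>\<theta> n\<close> along the same \<open>(x, y)\<close>,
    so it bounds the optimal value there.\<close>
  have inc: "incseq (\<lambda>n. z n T)"
  proof (rule incseq_SucI)
    fix n
    obtain d where ev: "extended_velocity (\<theta> (Suc n)) (x (Suc n)) (y (Suc n)) (z (Suc n)) d"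
      by (rule trajectories3_supersolution[OF S[of "Suc n"] \<theta>0])
    note d = extended_velocityD(1-7)[OF ev] and ae = extended_velocityD(8)[OF ev]
    have "AE t in lebesgue_on {0..T}. max (snd (fst (d t), fst (snd (d t)))) 0 *
        (1 - exp (- \<theta> (Suc n) * max (y (Suc n) t - z (Suc n) t) 0)) \<le> snd (snd (d t))"
      using ae by eventually_elim simp
    moreover have "y (Suc n) 0 \<le> z (Suc n) 0" using d(2,3) by simp
    ultimately obtain z' where z': "(x (Suc n), y (Suc n), z') \<in> ?S (\<theta> n)" "z' T \<le> z (Suc n) T"
      using trajectories3_below[OF d(1,7,6) _ \<theta>0 incseq_SucD[OF \<theta>(2)]] by blast
    show "z n T \<le> z (Suc n) T" using least[OF z'(1)] z'(2) by simp
  qed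
  have lip: "K-lipschitz_on {0..T} (\<lambda>t. (x n t, y n t))" for n
    by (rule trajectory_primitive[OF traj[of n]])
  have i: "(x n 0, y n 0) = (x0, y0)" for n using traj[of n] by (simp add: trajectory_iff)
  obtain w r where r: "strict_mono r" and lipw: "K-lipschitz_on {0..T} w"
    and ul: "uniform_limit {0..T} (\<lambda>k t. (x (r k) t, y (r k) t)) w sequentially" and w0: "w 0 = (x0, y0)"
    by (rule lipschitz_uniform_limit_subsequence[OF T_nonneg lip i])
  define a b where "a = (\<lambda>t. fst (w t))" and "b = (\<lambda>t. snd (w t))"
  have w: "w = (\<lambda>t. (a t, b t))" by (simp add: a_def b_def)
  have trajw: "trajectory w" by (rule trajectory_uniform_limit[OF traj ul lipw w0])
  then have trajab: "trajectory (\<lambda>t. (a t, b t))" by (simp add: w)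
  have pw: "(\<lambda>k. (x (r k) t, y (r k) t)) \<longlonglongrightarrow> w t" if "t \<in> {0..T}" for t
    using ul that by (rule tendsto_uniform_limitI)
  define v where "v = Sup (range (\<lambda>n. z n T))"
  have bdd: "bdd_above (range (\<lambda>n. z n T))" using le_max[OF trajab] by (intro bdd_aboveI[of _ "max_on T b"]) auto
  have zv: "(\<lambda>n. z n T) \<longlonglongrightarrow> v" unfolding v_def by (rule LIMSEQ_incseq_SUP[OF bdd inc])
  have z_le_v: "z n T \<le> v" for n unfolding v_def by (rule cSup_upper[OF _ bdd]) simp
  have v_le: "v \<le> max_on T y'" if "trajectory (\<lambda>t. (x' t, y' t))" for x' y'
    unfolding v_def by (rule cSUP_least) (use le_max[OF that] in auto)
  \<comment> \<open>The gap estimate at time \<open>t\<close> combines with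
    \<open>z (r k) t \<le> z (r k) T \<le> v\<close>; for fixed \<open>\<epsilon>\<close> the
    exponential term vanishes as \<open>k\<close> grows.\<close>
  have b_le: "b t \<le> v" if t: "t \<in> {0..T}" for t
  proof (rule field_le_epsilon)
    fix \<epsilon> :: real assume \<epsilon>: "0 < \<epsilon>"
    \<comment> \<open>The summand \<open>K * 0 * T\<close> is the limit of the exponential term,
      left in the form in which the limit rules produce it.\<close>
    have "b t \<le> v + \<epsilon> + K * 0 * T"
    proof (rule LIMSEQ_le)
      show "(\<lambda>k. y (r k) t) \<longlonglongrightarrow> b t" using tendsto_snd[OF pw[OF t]] by (simp add: b_def)
      have "filterlim (\<lambda>k. \<theta> (r k)) at_top sequentially"
        by (rule filterlim_compose[OF \<theta>(3) filterlim_subseq[OF r]])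
      then have "filterlim (\<lambda>k. \<theta> (r k) * \<epsilon>) at_top sequentially"
        by (rule filterlim_at_top_mult_tendsto_pos[OF tendsto_const \<epsilon>])
      then have "filterlim (\<lambda>k. - (\<theta> (r k) * \<epsilon>)) at_bot sequentially"
        by (simp add: filterlim_uminus_at_top)
      then have "(\<lambda>k. exp (- (\<theta> (r k) * \<epsilon>))) \<longlonglongrightarrow> 0"
        by (rule filterlim_compose[OF exp_at_bot])
      then show "(\<lambda>k. v + \<epsilon> + K * exp (- \<theta> (r k) * \<epsilon>) * T) \<longlonglongrightarrow> v + \<epsilon> + K * 0 * T"
        by (intro tendsto_intros) simp
      have "y (r k) t \<le> v + \<epsilon> + K * exp (- \<theta> (r k) * \<epsilon>) * T" for k
      proof -
        obtain d where ev: "extended_velocity (\<theta> (r k)) (x (r k)) (y (r k)) (z (r k)) d"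
          by (rule trajectories3_supersolution[OF S[of "r k"] \<theta>0])
        note d = extended_velocityD(1-7)[OF ev] and ae = extended_velocityD(8)[OF ev]
        have yp: "primitive T (y (r k)) (\<lambda>t. fst (snd (d t)))"
          using primitive_linear[OF d(7) bounded_linear_snd] by simp
        have gap: "AE t in lebesgue_on {0..T}. fst (snd (d t)) - snd (snd (d t)) \<le> K * exp (- \<theta> (r k) * max (y (r k) t - z (r k) t) 0)"
          using ae by eventually_elim blast
        have z0: "z (r k) 0 = y (r k) 0" using d(2,3) by simp
        have "y (r k) t \<le> z (r k) t + (\<epsilon> + K * exp (- \<theta> (r k) * \<epsilon>) * t)"
          using t \<epsilon> by (intro level_gap_le[OF yp d(6) z0 \<theta>0 _ K_nonneg gap]) auto
        also have "z (r k) t \<le> v"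
          using trajectories3_nondecreasing[OF S[of "r k"] \<theta>0] z_le_v[of "r k"] t by force
        also have "K * exp (- \<theta> (r k) * \<epsilon>) * t \<le> K * exp (- \<theta> (r k) * \<epsilon>) * T"
          using t K_nonneg by (intro mult_left_mono) auto
        finally show ?thesis by simp
      qed
      then show "\<exists>N. \<forall>k\<ge>N. y (r k) t \<le> v + \<epsilon> + K * exp (- \<theta> (r k) * \<epsilon>) * T" by blast
    qed
    then show "b t \<le> v + \<epsilon>" by simp
  qed
  have max_b: "max_on T b = v"
  proof (rule antisym)
    show "max_on T b \<le> v" unfolding max_on_def by (rule cSUP_least) (use T_pos b_le in auto)
    show "v \<le> max_on T b" by (rule v_le[OF trajab])
  qed
  have "optimal_P f g D U T x0 y0 (a, b)"
    unfolding optimal_P_def is_arg_min_def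
  proof (intro conjI notI)
    show "(a, b) \<in> trajectories f g D U T x0 y0" using trajab by (simp add: trajectory_def)
    assume "\<exists>s. s \<in> trajectories f g D U T x0 y0 \<and>
      (case s of (x, y) \<Rightarrow> max_on T y) < (case (a, b) of (x, y) \<Rightarrow> max_on T y)"
    then obtain x' y' where "(x', y') \<in> trajectories f g D U T x0 y0" "max_on T y' < v"
      by (auto simp: max_b)
    then show False using v_le[of x' y'] by (simp add: trajectory_def)
  qed
  moreover have "weakly_converges_L2 T (\<lambda>k. time_deriv T (\<lambda>t. (x (r k) t, y (r k) t))) (time_deriv T w)"
  proof -
    have "\<exists>d. primitive T (\<lambda>t. (x n t, y n t)) d \<and> (AE t in lebesgue_on {0..T}. norm (d t) \<le> K)" for n
      by (rule trajectory_primitive[OF traj[of n]]) blast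
    then have "\<forall>n. \<exists>d. primitive T (\<lambda>t. (x n t, y n t)) d \<and> (AE t in lebesgue_on {0..T}. norm (d t) \<le> K)" ..
    from choice[OF this] obtain d where "\<forall>n. primitive T (\<lambda>t. (x n t, y n t)) (d n) \<and>
      (AE t in lebesgue_on {0..T}. norm (d n t) \<le> K)" ..
    then have d: "\<And>k. primitive T (\<lambda>t. (x (r k) t, y (r k) t)) (d (r k))"
      "\<And>k. AE t in lebesgue_on {0..T}. norm (d (r k) t) \<le> K" by blast+
    obtain e where e: "primitive T w e" by (rule trajectory_primitive[OF trajw])
    show ?thesis by (rule weakly_converges_time_deriv[OF T_pos d(1) e d(2) pw])
  qed
  ultimately show ?thesis
    using r ul inc zv unfolding max_b[symmetric] w by (intro exI[of _ r] exI[of _ a] exI[of _ b]) simp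
qed

end

lemma C1_on_imp_continuous_on:
  assumes "F C1_on S"
  shows "continuous_on S F"
proof -
  obtain F' where "\<forall>z\<in>S. (F has_derivative blinfun_apply (F' z)) (at z within S)"
    using assms unfolding C1_on_def by blast
  then show ?thesis by (intro has_derivative_continuous_on) blast
qed

theorem proposition4p2:
  fixes f :: "real ^ 'n \<Rightarrow> real \<Rightarrow> real ^ 'p \<Rightarrow> real ^ 'n"
    and g :: "real ^ 'n \<Rightarrow> real \<Rightarrow> real ^ 'p \<Rightarrow> real"
    and D :: "((real ^ 'n) \<times> real) set"
    and U :: "(real ^ 'p) set"
    and T y0 :: real and x0 :: "real ^ 'n"
    and \<theta> :: "nat \<Rightarrow> real"
  assumes domain: "open D" "connected D"
    and U_nonempty: "U \<noteq> {}"
    and invariant: "invariant_domain f g D U"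
    and A1_compact: "compact U"
    and A1_C1: "(\<lambda>((x, y), u). f x y u) C1_on (D \<times> U)"
      "(\<lambda>((x, y), u). g x y u) C1_on (D \<times> U)"
    and A1_growth: "\<exists>C>0. \<forall>(x, y)\<in>D. \<forall>u\<in>U.
      norm (f x y u) + \<bar>g x y u\<bar> \<le> C * (1 + norm x + \<bar>y\<bar>)"
    and A2: "\<forall>(x, y)\<in>D. convex (\<Union>u\<in>U. {(f x y u, g x y u)})"
    and T_pos: "T > 0"
    and init: "(x0, y0) \<in> D"
    and \<theta>: "\<forall>n. \<theta> n > 0" "incseq \<theta>" "filterlim \<theta> at_top sequentially"
  shows "(\<forall>n. \<exists>w. optimal_P3 (\<theta> n) f g D U T x0 y0 w) \<and>
    (\<forall>x y z. (\<forall>n. optimal_P3 (\<theta> n) f g D U T x0 y0 (x n, y n, z n)) \<longrightarrow>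
      (\<exists>(r :: nat \<Rightarrow> nat) x_opt y_opt. strict_mono r \<and>
         optimal_P f g D U T x0 y0 (x_opt, y_opt) \<and>
         uniform_limit {0..T} (\<lambda>k t. (x (r k) t, y (r k) t)) (\<lambda>t. (x_opt t, y_opt t)) sequentially \<and>
         weakly_converges_L2 T (\<lambda>k. time_deriv T (\<lambda>t. (x (r k) t, y (r k) t)))
           (time_deriv T (\<lambda>t. (x_opt t, y_opt t))) \<and>
         incseq (\<lambda>n. z n T) \<and>
         (\<lambda>n. z n T) \<longlonglongrightarrow> max_on T y_opt))"
proof -
  obtain C where C: "0 < C" "\<forall>(x, y)\<in>D. \<forall>u\<in>U. norm (f x y u) + \<bar>g x y u\<bar> \<le> C * (1 + norm x + \<bar>y\<bar>)"
    using A1_growth by blast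
  have "controlled_system f g D U C T x0 y0"
  proof
    show "continuous_on (D \<times> U) (\<lambda>((x, y), u). f x y u)" "continuous_on (D \<times> U) (\<lambda>((x, y), u). g x y u)"
      by (fact C1_on_imp_continuous_on[OF A1_C1(1)], fact C1_on_imp_continuous_on[OF A1_C1(2)])
    show "norm (f x y u) + \<bar>g x y u\<bar> \<le> C * (1 + norm x + \<bar>y\<bar>)" if "(x, y) \<in> D" "u \<in> U" for x y u
      using C(2) that by blast
    show "convex (\<Union>u\<in>U. {(f x y u, g x y u)})" if "(x, y) \<in> D" for x y
      using A2 that by blast
  qed (fact domain(1) U_nonempty A1_compact invariant C(1) T_pos init)+
  then interpret controlled_system f g D U C T x0 y0 .
  have "\<exists>w. optimal_P3 (\<theta> n) f g D U T x0 y0 w" for n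
    using \<theta>(1) by (intro optimal_P3_exists less_imp_le) blast
  then show ?thesis using optimal_P3_limit[OF \<theta>] by blast
qed

end
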